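(* Let $(H,B)$ be a Rota-Baxter Hopf algebra of weight $-1$ and let $(H_+,H_-,\rhd,\lhd)$ be the matched pair of Hopf algebras on $(H,B)$. Define linear maps $C,\widetilde{C}:H_-\bowtie H_+\to H_-\bowtie H_+$ by $$C\big((\widetilde{B}(x),B(y))\big)=\Big(\widetilde{B}\big(\widetilde{B}(x_1)B(y_1)\big),\ S\circ B\circ S\big(\widetilde{B}(x_2)B(y_2)\big)\Big),$$ $$\widetilde{C}\big((\widetilde{B}(x),B(y))\big)=\Big(\widetilde{B}\circ S\big(B(S(x_1))\,B(y_1)\big),\ S\circ B\big(\widetilde{B}(x_2)\,\widetilde{B}(S(y_2))\big)\Big)$$ for any $x,y\in H$. Then $(C,\widetilde{C})$ is a projection homomorphism pair on $(H_+,H_-,\rhd,\lhd)$.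
   Context: The base field $\mathbb{K}$ has characteristic $0$; Hopf algebras are written $(H,\cdot,1,\Delta,\epsilon,S)$ and Sweedler notation $\Delta(x)=x_1\otimes x_2$ is used. A coalgebra map is a linear map $f$ with $\Delta\circ f=(f\otimes f)\circ\Delta$ and $\epsilon\circ f=\epsilon$. Rota-Baxter Hopf algebra of weight $-1$: a pair $(H,B)$ where $H$ is a cocommutative Hopf algebra and $B:H\to H$ is a coalgebra map with $B(x)B(y)=B\big(B(x_1)\,y\,S(B(x_2))\,x_3\big)$ for all $x,y\in H$. Put $\widetilde{B}(x)=x_1B(S(x_2))$ (again a Rota-Baxter operator of weight $-1$), $S_B(x)=S(B(x_1))S(x_2)B(x_3)$, $H_+=\operatorname{Im}B$ and $H_-=\operatorname{Im}\widetilde{B}$ (Hopf subalgebras of $H$). The matched pair of Hopf algebras on $(H,B)$ is $(H_+,H_-,\rhd,\lhd)$ with $B(x)\rhd\widetilde{B}(y)=\widetilde{B}(B(x_1)yS(B(x_2)))\in H_-$ and $B(x)\lhd\widetilde{B}(y)=S\big(B(S(\widetilde{B}(y_1))S_B(x)\widetilde{B}(y_2))\big)\in H_+$ for $x,y\in H$. Its double cross product $H_-\bowtie H_+$ is the Hopf algebra on $H_-\otimes H_+$ with product $(a\otimes x)(a'\otimes x')=a(x_1\rhd a'_1)\otimes(x_2\lhd a'_2)x'$, unit $1\otimes 1$ and the usual tensor product coalgebra structure. The element $a\otimes x$ is written $(a,x)$, and formulas are extended linearly. Projection homomorphism pair on a matched pair $(H,H',\rhd,\lhd)$: a pair $(P,P')$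 of idempotent homomorphisms of Hopf algebras $H'\bowtie H\to H'\bowtie H$ such that $P(z_1)P'(z_2)=z$ for all $z\in H'\bowtie H$. *)

theory Defs
  imports Complex_Main "HOL-Library.Function_Algebras"
begin

section \<open>Linear and bilinear maps on subspaces\<close>

definition linear_on ::
  "('k::field \<Rightarrow> 'a::ab_group_add \<Rightarrow> 'a) \<Rightarrow> ('k \<Rightarrow> 'b::ab_group_add \<Rightarrow> 'b) \<Rightarrow> 'a set \<Rightarrow> ('a \<Rightarrow> 'b) \<Rightarrow> bool"
  where "linear_on sA sB V f \<longleftrightarrow>
    (\<forall>u\<in>V. \<forall>v\<in>V. f (u + v) = f u + f v) \<and> (\<forall>c. \<forall>v\<in>V. f (sA c v) = sB c (f v))"

definition bilinear_on ::
  "('k::field \<Rightarrow> 'a::ab_group_add \<Rightarrow> 'a) \<Rightarrow> ('k \<Rightarrow> 'b::ab_group_add \<Rightarrow> 'b) \<Rightarrow>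
   ('k \<Rightarrow> 'c::ab_group_add \<Rightarrow> 'c) \<Rightarrow> 'a set \<Rightarrow> 'b set \<Rightarrow> ('a \<Rightarrow> 'b \<Rightarrow> 'c) \<Rightarrow> bool"
  where "bilinear_on sA sB sC V W f \<longleftrightarrow>
    (\<forall>w\<in>W. linear_on sA sC V (\<lambda>v. f v w)) \<and> (\<forall>v\<in>V. linear_on sB sC W (f v))"

section \<open>Tensor products over a field\<close>

text \<open>
  Tensors over \<open>A\<close> and \<open>B\<close> live in the space of functions from bilinear forms on \<open>A \<times> B\<close> to
  the ground field: the elementary tensor of \<open>a\<close> and \<open>b\<close> is evaluation at \<open>(a, b)\<close>, and the
  tensor product of subspaces \<open>V\<close> and \<open>W\<close> is the span of the elementary tensors with factors
  in \<open>V\<close> and \<open>W\<close>.  Over a field this is the algebraic tensor product (see the universal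
  property \<open>tensor_lift\<close> below), and the tensor product of subspaces is literally a subspace
  of the tensor product of the ambient spaces.
\<close>

type_synonym ('k, 'a, 'b) tensor = "('a \<Rightarrow> 'b \<Rightarrow> 'k) \<Rightarrow> 'k"

definition tscale :: "'k::field \<Rightarrow> ('k, 'a, 'b) tensor \<Rightarrow> ('k, 'a, 'b) tensor"
  where "tscale c t = (\<lambda>\<phi>. c * t \<phi>)"

definition tens ::
  "('k::field \<Rightarrow> 'a::ab_group_add \<Rightarrow> 'a) \<Rightarrow> ('k \<Rightarrow> 'b::ab_group_add \<Rightarrow> 'b) \<Rightarrow> 'a \<Rightarrow> 'b \<Rightarrow> ('k, 'a, 'b) tensor"
  where "tens sA sB a b = (\<lambda>\<phi>. if bilinear_on sA sB (*) UNIV UNIV \<phi> then \<phi> a b else 0)"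

definition tensor_space ::
  "('k::field \<Rightarrow> 'a::ab_group_add \<Rightarrow> 'a) \<Rightarrow> ('k \<Rightarrow> 'b::ab_group_add \<Rightarrow> 'b) \<Rightarrow> 'a set \<Rightarrow> 'b set \<Rightarrow>
   ('k, 'a, 'b) tensor set"
  where "tensor_space sA sB V W = module.span tscale {tens sA sB v w | v w. v \<in> V \<and> w \<in> W}"

text \<open>The linear map on \<open>V \<otimes> W\<close> induced by a bilinear map \<open>f\<close>; unspecified if \<open>f\<close> is not bilinear.\<close>

definition tensor_lift ::
  "('k::field \<Rightarrow> 'a::ab_group_add \<Rightarrow> 'a) \<Rightarrow> ('k \<Rightarrow> 'b::ab_group_add \<Rightarrow> 'b) \<Rightarrow>
   ('k \<Rightarrow> 'c::ab_group_add \<Rightarrow> 'c) \<Rightarrow> 'a set \<Rightarrow> 'b set \<Rightarrow> ('a \<Rightarrow> 'b \<Rightarrow> 'c) \<Rightarrow> ('k, 'a, 'b) tensor \<Rightarrow> 'c"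
  where "tensor_lift sA sB sC V W f =
    (SOME L. linear_on tscale sC (tensor_space sA sB V W) L \<and>
             (\<forall>v\<in>V. \<forall>w\<in>W. L (tens sA sB v w) = f v w))"

lemma vector_space_tscale: "vector_space (tscale :: 'k::field \<Rightarrow> ('k, 'a, 'b) tensor \<Rightarrow> _)"
  by unfold_locales (auto simp: tscale_def fun_eq_iff algebra_simps)

lemma vector_space_field: "vector_space ((*) :: 'k::field \<Rightarrow> 'k \<Rightarrow> 'k)"
  by unfold_locales (auto simp: algebra_simps)

lemma tensor_rep:
  assumes A: "vector_space sA" and V: "module.subspace sA V"
    and t: "t \<in> tensor_space sA sB V W"
  shows "\<exists>ps. set ps \<subseteq> V \<times> W \<and> t = (\<Sum>(a, b)\<leftarrow>ps. tens sA sB a b)"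
proof -
  interpret A: vector_space sA by (rule A)
  interpret T: vector_space "tscale :: 'a \<Rightarrow> ('a, 'b, 'c) tensor \<Rightarrow> _"
    by (rule vector_space_tscale)
  have sc: "tscale c (tens sA sB a b) = tens sA sB (sA c a) b" for c a b
    by (auto simp: tscale_def tens_def fun_eq_iff bilinear_on_def linear_on_def)
  show ?thesis using t unfolding tensor_space_def
  proof (induction rule: T.span_induct_alt)
    case base
    show ?case by (rule exI[of _ "[]"]) simp
  next
    case (step c x y)
    then obtain a b ps where ab: "x = tens sA sB a b" "a \<in> V" "b \<in> W"
      and ps: "set ps \<subseteq> V \<times> W" "y = (\<Sum>(a, b)\<leftarrow>ps. tens sA sB a b)" by blast
    show ?case
      by (rule exI[of _ "(sA c a, b) # ps"]) (use ab ps sc A.subspace_scale[OF V] in auto)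
  qed
qed

lemma tensor_rep_wd:
  assumes A: "vector_space sA" and B: "vector_space sB" and C: "vector_space sC"
    and V: "module.subspace sA V" and W: "module.subspace sB W"
    and f: "bilinear_on sA sB sC V W f"
    and ps: "set ps \<subseteq> V \<times> W" and qs: "set qs \<subseteq> V \<times> W"
    and eq: "(\<Sum>(a, b)\<leftarrow>ps. tens sA sB a b) = (\<Sum>(a, b)\<leftarrow>qs. tens sA sB a b)"
  shows "(\<Sum>(a, b)\<leftarrow>ps. f a b) = (\<Sum>(a, b)\<leftarrow>qs. f a b)"
proof (rule ccontr)
  assume ne: "\<not> ?thesis"
  interpret A: vector_space sA by (rule A)
  interpret B: vector_space sB by (rule B)
  interpret C: vector_space sC by (rule C)
  interpret K: vector_space "(*) :: 'a \<Rightarrow> 'a \<Rightarrow> 'a" by (rule vector_space_field)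
  interpret AA: vector_space_pair sA sA by unfold_locales
  interpret BB: vector_space_pair sB sB by unfold_locales
  interpret CK: vector_space_pair sC "(*) :: 'a \<Rightarrow> 'a \<Rightarrow> 'a" by unfold_locales
  obtain p where p: "range p \<subseteq> V" "Vector_Spaces.linear sA sA p" "\<forall>v\<in>V. p v = v"
    using AA.linear_exists_left_inverse_on[OF A.linear_id V] by auto
  obtain q where q: "range q \<subseteq> W" "Vector_Spaces.linear sB sB q" "\<forall>v\<in>W. q v = v"
    using BB.linear_exists_left_inverse_on[OF B.linear_id W] by auto
  define u where "u = (\<Sum>(a, b)\<leftarrow>ps. f a b) - (\<Sum>(a, b)\<leftarrow>qs. f a b)"
  have "u \<noteq> 0" using ne by (simp add: u_def)
  hence "C.independent {u}" by (simp add: C.dependent_single)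
  then obtain g where g: "Vector_Spaces.linear sC (*) g" "g u = 1"
    using CK.linear_independent_extend[of "{u}" "\<lambda>_. 1"] by auto
  interpret p: Vector_Spaces.linear sA sA p by (rule p(2))
  interpret q: Vector_Spaces.linear sB sB q by (rule q(2))
  interpret g: Vector_Spaces.linear sC "(*)" g by (rule g(1))
  define \<phi> where "\<phi> = (\<lambda>a b. g (f (p a) (q b)))"
  have pq: "p a \<in> V" "q b \<in> W" for a b using p(1) q(1) by auto
  have bil: "bilinear_on sA sB (*) UNIV UNIV \<phi>"
    using f pq unfolding bilinear_on_def linear_on_def \<phi>_def
    by (auto simp: p.add q.add p.scale q.scale g.add g.scale)
  have ev: "(\<Sum>(a, b)\<leftarrow>rs. tens sA sB a b) \<phi> = g (\<Sum>(a, b)\<leftarrow>rs. f a b)"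
    if "set rs \<subseteq> V \<times> W" for rs
    using that by (induction rs) (use p(3) q(3) bil in \<open>auto simp: g.zero g.add tens_def \<phi>_def\<close>)
  have "g u = 0" using ev[OF ps] ev[OF qs] eq by (simp add: u_def g.diff)
  thus False using g(2) by simp
qed

lemma tensor_lift:
  assumes A: "vector_space sA" and B: "vector_space sB" and C: "vector_space sC"
    and V: "module.subspace sA V" and W: "module.subspace sB W"
    and f: "bilinear_on sA sB sC V W f"
  shows "linear_on tscale sC (tensor_space sA sB V W) (tensor_lift sA sB sC V W f)"
    and "v \<in> V \<Longrightarrow> w \<in> W \<Longrightarrow> tensor_lift sA sB sC V W f (tens sA sB v w) = f v w"
proof -
  interpret A: vector_space sA by (rule A)
  interpret C: vector_space sC by (rule C)
  interpret T: vector_space "tscale :: 'a \<Rightarrow> ('a, 'b, 'c) tensor \<Rightarrow> _"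
    by (rule vector_space_tscale)
  define R where "R t ps \<longleftrightarrow> set ps \<subseteq> V \<times> W \<and> t = (\<Sum>(a, b)\<leftarrow>ps. tens sA sB a b)" for t ps
  define L where "L t = (\<Sum>(a, b)\<leftarrow>(SOME ps. R t ps). f a b)" for t
  have L: "L t = (\<Sum>(a, b)\<leftarrow>ps. f a b)" if "R t ps" for t ps
  proof -
    have "R t (SOME ps. R t ps)" using that by (rule someI)
    hence "set (SOME ps. R t ps) \<subseteq> V \<times> W"
      and "(\<Sum>(a, b)\<leftarrow>(SOME ps. R t ps). tens sA sB a b) = (\<Sum>(a, b)\<leftarrow>ps. tens sA sB a b)"
      using that unfolding R_def by simp_all
    moreover have "set ps \<subseteq> V \<times> W" using that unfolding R_def by (rule conjunct1)
    ultimately show ?thesis unfolding L_def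
      by (intro tensor_rep_wd[OF A B C V W f])
  qed
  have R: "\<exists>ps. R t ps" if "t \<in> tensor_space sA sB V W" for t
    using tensor_rep[OF A V that] by (simp add: R_def)
  have sc: "R (tscale c t) (map (\<lambda>(a, b). (sA c a, b)) ps)" if "R t ps" for c t ps
  proof -
    have sct: "tscale c (tens sA sB a b) = tens sA sB (sA c a) b" for a b
      by (auto simp: tscale_def tens_def fun_eq_iff bilinear_on_def linear_on_def)
    have "tscale c (\<Sum>(a, b)\<leftarrow>ps. tens sA sB a b) =
        (\<Sum>(a, b)\<leftarrow>map (\<lambda>(a, b). (sA c a, b)) ps. tens sA sB a b)"
    proof (induction ps)
      case Nil
      show ?case by (simp add: tscale_def fun_eq_iff)
    next
      case (Cons p ps)
      then show ?case
        by (cases p) (simp only: list.map sum_list.Cons prod.case T.scale_right_distrib sct)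
    qed
    moreover have "set (map (\<lambda>(a, b). (sA c a, b)) ps) \<subseteq> V \<times> W"
      using that A.subspace_scale[OF V] unfolding R_def by auto
    ultimately show ?thesis using that unfolding R_def by simp
  qed
  have scf: "(\<Sum>(a, b)\<leftarrow>map (\<lambda>(a, b). (sA c a, b)) ps. f a b) = sC c (\<Sum>(a, b)\<leftarrow>ps. f a b)"
    if "set ps \<subseteq> V \<times> W" for c ps
    using that
  proof (induction ps)
    case (Cons p ps)
    have "f (sA c a) b = sC c (f a b)" if "a \<in> V" "b \<in> W" for a b
      using f that by (simp add: bilinear_on_def linear_on_def)
    then show ?case using Cons by (auto simp: C.scale_right_distrib)
  qed simp
  have "linear_on tscale sC (tensor_space sA sB V W) L"
    unfolding linear_on_def
  proof (intro conjI ballI allI)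
    fix s t assume "s \<in> tensor_space sA sB V W" "t \<in> tensor_space sA sB V W"
    then obtain ps qs where pq: "R s ps" "R t qs" using R by blast
    hence "R (s + t) (ps @ qs)" by (simp add: R_def)
    thus "L (s + t) = L s + L t" using L pq by simp
  next
    fix c t assume "t \<in> tensor_space sA sB V W"
    then obtain ps where p: "R t ps" using R by blast
    show "L (tscale c t) = sC c (L t)"
      unfolding L[OF p] L[OF sc[OF p, of c]] using p unfolding R_def by (intro scf) (rule conjunct1)
  qed
  moreover have "L (tens sA sB v w) = f v w" if "v \<in> V" "w \<in> W" for v w
    using L[of "tens sA sB v w" "[(v, w)]"] that by (simp add: R_def)
  ultimately have "\<exists>L. linear_on tscale sC (tensor_space sA sB V W) L \<and>
             (\<forall>v\<in>V. \<forall>w\<in>W. L (tens sA sB v w) = f v w)" by auto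
  hence *: "linear_on tscale sC (tensor_space sA sB V W) (tensor_lift sA sB sC V W f) \<and>
      (\<forall>v\<in>V. \<forall>w\<in>W. tensor_lift sA sB sC V W f (tens sA sB v w) = f v w)"
    unfolding tensor_lift_def by (rule someI_ex)
  show "linear_on tscale sC (tensor_space sA sB V W) (tensor_lift sA sB sC V W f)"
    using * by (rule conjunct1)
  show "tensor_lift sA sB sC V W f (tens sA sB v w) = f v w" if "v \<in> V" "w \<in> W"
    using * that by simp
qed

section \<open>Hopf algebras\<close>

text \<open>
  The underlying vector space is a subspace \<open>carr\<close> of an ambient vector space \<open>('a, scal)\<close>, so
  that a Hopf subalgebra is obtained by shrinking \<open>carr\<close> and keeping all operations.
\<close>

record ('k, 'a) hopf =
  carr :: "'a set"
  scal :: "'k \<Rightarrow> 'a \<Rightarrow> 'a"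
  mul :: "'a \<Rightarrow> 'a \<Rightarrow> 'a"
  unt :: 'a
  comul :: "'a \<Rightarrow> ('k, 'a, 'a) tensor"
  counit :: "'a \<Rightarrow> 'k"
  antip :: "'a \<Rightarrow> 'a"

definition htens ::
  "('k::field, 'a::ab_group_add) hopf \<Rightarrow> ('k, 'b::ab_group_add) hopf \<Rightarrow> 'a \<Rightarrow> 'b \<Rightarrow> ('k, 'a, 'b) tensor"
  where "htens H H' = tens (scal H) (scal H')"

definition htensor_space ::
  "('k::field, 'a::ab_group_add) hopf \<Rightarrow> ('k, 'b::ab_group_add) hopf \<Rightarrow> ('k, 'a, 'b) tensor set"
  where "htensor_space H H' = tensor_space (scal H) (scal H') (carr H) (carr H')"

definition hlift ::
  "('k::field, 'a::ab_group_add) hopf \<Rightarrow> ('k, 'b::ab_group_add) hopf \<Rightarrow> ('k \<Rightarrow> 'c::ab_group_add \<Rightarrow> 'c) \<Rightarrow>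
   ('a \<Rightarrow> 'b \<Rightarrow> 'c) \<Rightarrow> ('k, 'a, 'b) tensor \<Rightarrow> 'c"
  where "hlift H H' s f = tensor_lift (scal H) (scal H') s (carr H) (carr H') f"

text \<open>
  Sweedler notation: for bilinear \<open>f\<close> (resp. trilinear \<open>f\<close>), \<open>sweedler H s x f\<close> is
  \<open>f x\<^sub>1 x\<^sub>2\<close> and \<open>sweedler3 H s x f\<close> is \<open>f x\<^sub>1 x\<^sub>2 x\<^sub>3\<close>, where \<open>s\<close> is the scalar multiplication of
  the target space.
\<close>

definition sweedler ::
  "('k::field, 'a::ab_group_add) hopf \<Rightarrow> ('k \<Rightarrow> 'c::ab_group_add \<Rightarrow> 'c) \<Rightarrow> 'a \<Rightarrow> ('a \<Rightarrow> 'a \<Rightarrow> 'c) \<Rightarrow> 'c"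
  where "sweedler H s x f = hlift H H s f (comul H x)"

definition sweedler3 ::
  "('k::field, 'a::ab_group_add) hopf \<Rightarrow> ('k \<Rightarrow> 'c::ab_group_add \<Rightarrow> 'c) \<Rightarrow> 'a \<Rightarrow> ('a \<Rightarrow> 'a \<Rightarrow> 'a \<Rightarrow> 'c) \<Rightarrow> 'c"
  where "sweedler3 H s x f = sweedler H s x (\<lambda>x1 x'. sweedler H s x' (\<lambda>x2 x3. f x1 x2 x3))"

definition linear_map ::
  "('k::field, 'a::ab_group_add) hopf \<Rightarrow> ('k, 'b::ab_group_add) hopf \<Rightarrow> ('a \<Rightarrow> 'b) \<Rightarrow> bool"
  where "linear_map H H' f \<longleftrightarrow> f ` carr H \<subseteq> carr H' \<and> linear_on (scal H) (scal H') (carr H) f"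

definition algebra :: "('k::field, 'a::ab_group_add) hopf \<Rightarrow> bool"
  where "algebra H \<longleftrightarrow>
    vector_space (scal H) \<and> module.subspace (scal H) (carr H) \<and>
    (\<forall>x\<in>carr H. \<forall>y\<in>carr H. mul H x y \<in> carr H) \<and>
    bilinear_on (scal H) (scal H) (scal H) (carr H) (carr H) (mul H) \<and>
    (\<forall>x\<in>carr H. \<forall>y\<in>carr H. \<forall>z\<in>carr H. mul H (mul H x y) z = mul H x (mul H y z)) \<and>
    unt H \<in> carr H \<and>
    (\<forall>x\<in>carr H. mul H (unt H) x = x \<and> mul H x (unt H) = x)"

definition coalgebra :: "('k::field, 'a::ab_group_add) hopf \<Rightarrow> bool"
  where "coalgebra H \<longleftrightarrow>
    vector_space (scal H) \<and> module.subspace (scal H) (carr H) \<and>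
    (\<forall>x\<in>carr H. comul H x \<in> htensor_space H H) \<and>
    linear_on (scal H) tscale (carr H) (comul H) \<and>
    linear_on (scal H) (*) (carr H) (counit H) \<and>
    (\<forall>x\<in>carr H.
       sweedler H tscale x (\<lambda>x1 x2. sweedler H tscale x1
         (\<lambda>x11 x12. tens (scal H) tscale x11 (htens H H x12 x2)))
     = sweedler H tscale x (\<lambda>x1 x2. tens (scal H) tscale x1 (comul H x2))) \<and>
    (\<forall>x\<in>carr H. sweedler H (scal H) x (\<lambda>x1 x2. scal H (counit H x1) x2) = x \<and>
                 sweedler H (scal H) x (\<lambda>x1 x2. scal H (counit H x2) x1) = x)"

definition bialgebra :: "('k::field, 'a::ab_group_add) hopf \<Rightarrow> bool"
  where "bialgebra H \<longleftrightarrow> algebra H \<and> coalgebra H \<and>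
    (\<forall>x\<in>carr H. \<forall>y\<in>carr H. comul H (mul H x y) =
       sweedler H tscale x (\<lambda>x1 x2. sweedler H tscale y
         (\<lambda>y1 y2. htens H H (mul H x1 y1) (mul H x2 y2)))) \<and>
    comul H (unt H) = htens H H (unt H) (unt H) \<and>
    (\<forall>x\<in>carr H. \<forall>y\<in>carr H. counit H (mul H x y) = counit H x * counit H y) \<and>
    counit H (unt H) = 1"

definition hopf_algebra :: "('k::field, 'a::ab_group_add) hopf \<Rightarrow> bool"
  where "hopf_algebra H \<longleftrightarrow> bialgebra H \<and> linear_map H H (antip H) \<and>
    (\<forall>x\<in>carr H.
       sweedler H (scal H) x (\<lambda>x1 x2. mul H (antip H x1) x2) = scal H (counit H x) (unt H) \<and>
       sweedler H (scal H) x (\<lambda>x1 x2. mul H x1 (antip H x2)) = scal H (counit H x) (unt H))"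

definition cocommutative :: "('k::field, 'a::ab_group_add) hopf \<Rightarrow> bool"
  where "cocommutative H \<longleftrightarrow>
    (\<forall>x\<in>carr H. sweedler H tscale x (\<lambda>x1 x2. htens H H x2 x1) = comul H x)"

definition coalgebra_map ::
  "('k::field, 'a::ab_group_add) hopf \<Rightarrow> ('k, 'b::ab_group_add) hopf \<Rightarrow> ('a \<Rightarrow> 'b) \<Rightarrow> bool"
  where "coalgebra_map H H' f \<longleftrightarrow> linear_map H H' f \<and>
    (\<forall>x\<in>carr H. comul H' (f x) = sweedler H tscale x (\<lambda>x1 x2. htens H' H' (f x1) (f x2))) \<and>
    (\<forall>x\<in>carr H. counit H' (f x) = counit H x)"

definition hopf_hom ::
  "('k::field, 'a::ab_group_add) hopf \<Rightarrow> ('k, 'b::ab_group_add) hopf \<Rightarrow> ('a \<Rightarrow> 'b) \<Rightarrow> bool"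
  where "hopf_hom H H' f \<longleftrightarrow> coalgebra_map H H' f \<and>
    (\<forall>x\<in>carr H. \<forall>y\<in>carr H. f (mul H x y) = mul H' (f x) (f y)) \<and>
    f (unt H) = unt H' \<and>
    (\<forall>x\<in>carr H. f (antip H x) = antip H' (f x))"

section \<open>Double cross products and projection homomorphism pairs\<close>

text \<open>
  \<open>dcp H H' l r\<close> is \<open>H' \<bowtie> H\<close>, with \<open>l x a = x \<rhd> a \<in> H'\<close> and \<open>r x a = x \<lhd> a \<in> H\<close> for
  \<open>x \<in> H\<close>, \<open>a \<in> H'\<close>.  Its antipode is forced by \<open>a \<otimes> x = (a \<otimes> 1)(1 \<otimes> x)\<close>:
  \<open>S(a \<otimes> x) = (1 \<otimes> S x)(S a \<otimes> 1)\<close>.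
\<close>

definition dcp_mul ::
  "('k::field, 'a::ab_group_add) hopf \<Rightarrow> ('k, 'b::ab_group_add) hopf \<Rightarrow>
   ('a \<Rightarrow> 'b \<Rightarrow> 'b) \<Rightarrow> ('a \<Rightarrow> 'b \<Rightarrow> 'a) \<Rightarrow>
   ('k, 'b, 'a) tensor \<Rightarrow> ('k, 'b, 'a) tensor \<Rightarrow> ('k, 'b, 'a) tensor"
  where "dcp_mul H H' l r s t =
    hlift H' H tscale (\<lambda>a x. hlift H' H tscale (\<lambda>a' x'.
      sweedler H tscale x (\<lambda>x1 x2. sweedler H' tscale a' (\<lambda>a1' a2'.
        htens H' H (mul H' a (l x1 a1')) (mul H (r x2 a2') x')))) t) s"

definition dcp ::
  "('k::field, 'a::ab_group_add) hopf \<Rightarrow> ('k, 'b::ab_group_add) hopf \<Rightarrow>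
   ('a \<Rightarrow> 'b \<Rightarrow> 'b) \<Rightarrow> ('a \<Rightarrow> 'b \<Rightarrow> 'a) \<Rightarrow> ('k, ('k, 'b, 'a) tensor) hopf"
  where "dcp H H' l r =
    \<lparr> carr = htensor_space H' H,
      scal = tscale,
      mul = dcp_mul H H' l r,
      unt = htens H' H (unt H') (unt H),
      comul = hlift H' H tscale (\<lambda>a x.
        sweedler H' tscale a (\<lambda>a1 a2. sweedler H tscale x (\<lambda>x1 x2.
          tens tscale tscale (htens H' H a1 x1) (htens H' H a2 x2)))),
      counit = hlift H' H (*) (\<lambda>a x. counit H' a * counit H x),
      antip = hlift H' H tscale (\<lambda>a x.
        dcp_mul H H' l r (htens H' H (unt H') (antip H x)) (htens H' H (antip H' a) (unt H))) \<rparr>"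

definition projection_hom_pair ::
  "('k::field, 'a::ab_group_add) hopf \<Rightarrow> ('k, 'b::ab_group_add) hopf \<Rightarrow>
   ('a \<Rightarrow> 'b \<Rightarrow> 'b) \<Rightarrow> ('a \<Rightarrow> 'b \<Rightarrow> 'a) \<Rightarrow>
   (('k, 'b, 'a) tensor \<Rightarrow> ('k, 'b, 'a) tensor) \<Rightarrow>
   (('k, 'b, 'a) tensor \<Rightarrow> ('k, 'b, 'a) tensor) \<Rightarrow> bool"
  where "projection_hom_pair H H' l r P P' \<longleftrightarrow> (let D = dcp H H' l r in
    hopf_hom D D P \<and> (\<forall>z\<in>carr D. P (P z) = P z) \<and>
    hopf_hom D D P' \<and> (\<forall>z\<in>carr D. P' (P' z) = P' z) \<and>
    (\<forall>z\<in>carr D. sweedler D tscale z (\<lambda>z1 z2. mul D (P z1) (P' z2)) = z))"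

section \<open>Rota-Baxter Hopf algebras of weight -1\<close>

definition rota_baxter_hopf :: "('k::field, 'h::ab_group_add) hopf \<Rightarrow> ('h \<Rightarrow> 'h) \<Rightarrow> bool"
  where "rota_baxter_hopf H B \<longleftrightarrow>
    hopf_algebra H \<and> cocommutative H \<and> coalgebra_map H H B \<and>
    (\<forall>x\<in>carr H. \<forall>y\<in>carr H. mul H (B x) (B y) =
       B (sweedler3 H (scal H) x (\<lambda>x1 x2 x3.
         mul H (mul H (mul H (B x1) y) (antip H (B x2))) x3)))"

definition rb_tilde :: "('k::field, 'h::ab_group_add) hopf \<Rightarrow> ('h \<Rightarrow> 'h) \<Rightarrow> 'h \<Rightarrow> 'h"
  where "rb_tilde H B x = sweedler H (scal H) x (\<lambda>x1 x2. mul H x1 (B (antip H x2)))"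

definition rb_antip :: "('k::field, 'h::ab_group_add) hopf \<Rightarrow> ('h \<Rightarrow> 'h) \<Rightarrow> 'h \<Rightarrow> 'h"
  where "rb_antip H B x = sweedler3 H (scal H) x (\<lambda>x1 x2 x3.
    mul H (mul H (antip H (B x1)) (antip H x2)) (B x3))"

definition rb_plus :: "('k::field, 'h::ab_group_add) hopf \<Rightarrow> ('h \<Rightarrow> 'h) \<Rightarrow> ('k, 'h) hopf"
  where "rb_plus H B = H\<lparr>carr := B ` carr H\<rparr>"

definition rb_minus :: "('k::field, 'h::ab_group_add) hopf \<Rightarrow> ('h \<Rightarrow> 'h) \<Rightarrow> ('k, 'h) hopf"
  where "rb_minus H B = H\<lparr>carr := rb_tilde H B ` carr H\<rparr>"

text \<open>
  The defining equations determine the actions completely on \<open>H\<^sub>+\<close> and \<open>H\<^sub>-\<close>; choice is only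
  used for the irrelevant values elsewhere.
\<close>

definition rb_left :: "('k::field, 'h::ab_group_add) hopf \<Rightarrow> ('h \<Rightarrow> 'h) \<Rightarrow> 'h \<Rightarrow> 'h \<Rightarrow> 'h"
  where "rb_left H B = (SOME l. \<forall>x\<in>carr H. \<forall>y\<in>carr H. l (B x) (rb_tilde H B y) =
    rb_tilde H B (sweedler H (scal H) x (\<lambda>x1 x2. mul H (mul H (B x1) y) (antip H (B x2)))))"

definition rb_right :: "('k::field, 'h::ab_group_add) hopf \<Rightarrow> ('h \<Rightarrow> 'h) \<Rightarrow> 'h \<Rightarrow> 'h \<Rightarrow> 'h"
  where "rb_right H B = (SOME r. \<forall>x\<in>carr H. \<forall>y\<in>carr H. r (B x) (rb_tilde H B y) =
    antip H (B (sweedler H (scal H) y (\<lambda>y1 y2.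
      mul H (mul H (antip H (rb_tilde H B y1)) (rb_antip H B x)) (rb_tilde H B y2)))))"

definition rb_dcp ::
  "('k::field, 'h::ab_group_add) hopf \<Rightarrow> ('h \<Rightarrow> 'h) \<Rightarrow> ('k, ('k, 'h, 'h) tensor) hopf"
  where "rb_dcp H B = dcp (rb_plus H B) (rb_minus H B) (rb_left H B) (rb_right H B)"

text \<open>
  \<open>rb_plus H B\<close> and \<open>rb_minus H B\<close> share the scalar multiplication of \<open>H\<close>, so \<open>htens H H\<close> also
  forms their elementary tensors.
\<close>

definition is_C ::
  "('k::field, 'h::ab_group_add) hopf \<Rightarrow> ('h \<Rightarrow> 'h) \<Rightarrow> (('k, 'h, 'h) tensor \<Rightarrow> ('k, 'h, 'h) tensor) \<Rightarrow> bool"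
  where "is_C H B C \<longleftrightarrow> linear_map (rb_dcp H B) (rb_dcp H B) C \<and>
    (\<forall>x\<in>carr H. \<forall>y\<in>carr H.
       C (htens H H (rb_tilde H B x) (B y)) =
       sweedler H tscale x (\<lambda>x1 x2. sweedler H tscale y (\<lambda>y1 y2.
         htens H H
           (rb_tilde H B (mul H (rb_tilde H B x1) (B y1)))
           (antip H (B (antip H (mul H (rb_tilde H B x2) (B y2))))))))"

definition is_C_tilde ::
  "('k::field, 'h::ab_group_add) hopf \<Rightarrow> ('h \<Rightarrow> 'h) \<Rightarrow> (('k, 'h, 'h) tensor \<Rightarrow> ('k, 'h, 'h) tensor) \<Rightarrow> bool"
  where "is_C_tilde H B C \<longleftrightarrow> linear_map (rb_dcp H B) (rb_dcp H B) C \<and>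
    (\<forall>x\<in>carr H. \<forall>y\<in>carr H.
       C (htens H H (rb_tilde H B x) (B y)) =
       sweedler H tscale x (\<lambda>x1 x2. sweedler H tscale y (\<lambda>y1 y2.
         htens H H
           (rb_tilde H B (antip H (mul H (B (antip H x1)) (B y1))))
           (antip H (B (mul H (rb_tilde H B x2) (rb_tilde H B (antip H y2))))))))"

end

theory Submission
  imports Defs "HOL-Algebra.Group"
begin

text \<open>
  For a cocommutative coalgebra \<open>T\<close> the coalgebra maps \<open>T \<rightarrow> H\<close> form a group under convolution
  (\<open>gen H T\<close> below), on which \<open>B\<close> acts by composition as a Rota-Baxter operator of a group.  As
  \<open>E \<otimes> F\<close> is the categorical product of cocommutative coalgebras, every identity of the paper can
  be checked in such a group, on the generic elements given by the projections of \<open>H \<otimes> H\<close>.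

  In a Rota-Baxter group put \<open>\<beta> x = B (x\<inverse>)\<close> and \<open>B\<^sub>t x = x (\<beta> x)\<close>, the group version of the second operator.  A
  pair \<open>(B\<^sub>t x, B y)\<close> of the double cross product is recorded by \<open>x\<close> and by \<open>g = (B\<^sub>t x) (B y)\<close>; write
  it \<open>[x, g]\<close>.  Multiplication \<open>(a, u) \<mapsto> a u\<close> is a homomorphism to the group with section
  \<open>g \<mapsto> [g, g]\<close>, and the structure becomes \<open>[x, g] [x', g'] = [g x' g\<inverse> x, g g']\<close>,
  \<open>[x, g]\<inverse> = [g\<inverse> x\<inverse> g, g\<inverse>]\<close>, \<open>C [x, g] = [g, g]\<close> and \<open>C' [x, g] = [g\<inverse> x, 1]\<close>.  All claims
  are then immediate.
\<close>

section \<open>Linear maps and tensors\<close>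

text \<open>The obstacle is that everything is prescribed through representatives. An element of H_+
  is some \<open>B x\<close> and an element of H_- some \<open>Bt y\<close>, but neither value
  determines \<open>x\<close> or \<open>y\<close>; so neither the two actions nor the maps C and C'
  are known to exist. Existence amounts to rewriting each formula, at generic elements, as a word in
  the values: such a word is the pullback of another one along \<open>B\<close> or \<open>Bt\<close>
  acting on a tensor factor, hence constant on fibres. \<open>Bt_conj\<close> and
  \<open>factor\<close> do this for the actions, and the mutual inverseness of the two components of
  C' does it for C'. In the same way \<open>x\<close> in [x, g] is not unique, but the pair sees
  only \<open>Bt x\<close>. Two more points shape the reduction to groups. Inversion by the antipode
  stays inside the group only if the antipode is a coalgebra map, which is not among the Hopf axioms
  and is derived here. And H \<otimes> H provides one generic element of the double cross product,
  whereas multiplicativity concerns two independent ones, which live over the tensor square of H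
  \<otimes> H.\<close>

lemma linear_onI:
  assumes "\<And>u v. u \<in> V \<Longrightarrow> v \<in> V \<Longrightarrow> f (u + v) = f u + f v"
    and "\<And>c v. v \<in> V \<Longrightarrow> f (sA c v) = sB c (f v)"
  shows "linear_on sA sB V f"
  using assms by (simp add: linear_on_def)

lemma linear_onD:
  assumes "linear_on sA sB V f"
  shows "u \<in> V \<Longrightarrow> v \<in> V \<Longrightarrow> f (u + v) = f u + f v"
    and "v \<in> V \<Longrightarrow> f (sA c v) = sB c (f v)"
  using assms by (auto simp: linear_on_def)

lemma bilinear_onI:
  assumes "\<And>w. w \<in> W \<Longrightarrow> linear_on sA sC V (\<lambda>v. f v w)"
    and "\<And>v. v \<in> V \<Longrightarrow> linear_on sB sC W (f v)"
  shows "bilinear_on sA sB sC V W f"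
  using assms by (simp add: bilinear_on_def)

lemma bilinear_onD:
  assumes "bilinear_on sA sB sC V W f"
  shows "w \<in> W \<Longrightarrow> linear_on sA sC V (\<lambda>v. f v w)"
    and "v \<in> V \<Longrightarrow> linear_on sB sC W (f v)"
  using assms by (auto simp: bilinear_on_def)

lemma linear_on_cong:
  assumes "linear_on sA sB V f" "module.subspace sA V" "vector_space sA" "\<And>v. v \<in> V \<Longrightarrow> f v = g v"
  shows "linear_on sA sB V g"
proof -
  interpret vector_space sA by fact
  show ?thesis
    using assms by (auto simp: linear_on_def subspace_add subspace_scale)
qed

lemma linear_on_comp:
  assumes "linear_on sA sB V f" "linear_on sB sC W g" "f ` V \<subseteq> W"
  shows "linear_on sA sC V (\<lambda>v. g (f v))"
  using assms by (auto simp: linear_on_def image_subset_iff)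

lemma linear_on_mono: "linear_on sA sB V f \<Longrightarrow> U \<subseteq> V \<Longrightarrow> linear_on sA sB U f"
  unfolding linear_on_def subset_iff by simp

lemma linear_on_zero:
  assumes "vector_space sA" "vector_space sB" "linear_on sA sB V f" "module.subspace sA V"
  shows "f 0 = 0"
proof -
  interpret A: vector_space sA by fact
  interpret B: vector_space sB by fact
  have "f (sA 0 0) = sB 0 (f 0)" using assms(3) A.subspace_0[OF assms(4)] linear_onD(2) by metis
  then show ?thesis by simp
qed

lemma subspace_image:
  assumes A: "vector_space sA" and B: "vector_space sB" and f: "linear_on sA sB V f"
    and V: "module.subspace sA V"
  shows "module.subspace sB (f ` V)"
proof -
  interpret A: vector_space sA by fact
  interpret B: vector_space sB by fact
  show ?thesis
  proof (rule B.subspaceI)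
    show "0 \<in> f ` V" using linear_on_zero[OF A B f V] A.subspace_0[OF V] by (metis imageI)
    show "x + y \<in> f ` V" if "x \<in> f ` V" "y \<in> f ` V" for x y
      using that A.subspace_add[OF V] linear_onD(1)[OF f] by (metis (no_types, lifting) image_iff)
    show "sB c x \<in> f ` V" if "x \<in> f ` V" for c x
      using that A.subspace_scale[OF V] linear_onD(2)[OF f] by (metis (no_types, lifting) image_iff)
  qed
qed

lemma linear_on_sum_list:
  assumes "vector_space sA" "vector_space sB" "module.subspace sA V" "linear_on sA sB V L"
    "\<And>p. p \<in> set ps \<Longrightarrow> f p \<in> V"
  shows "L (\<Sum>p\<leftarrow>ps. f p) = (\<Sum>p\<leftarrow>ps. L (f p)) \<and> (\<Sum>p\<leftarrow>ps. f p) \<in> V"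
  using assms(5)
proof (induction ps)
  case Nil
  interpret A: vector_space sA by fact
  from linear_on_zero[OF assms(1,2,4,3)] A.subspace_0[OF assms(3)] show ?case by simp
next
  case (Cons p ps)
  interpret A: vector_space sA by fact
  from Cons show ?case using linear_onD(1)[OF assms(4)] A.subspace_add[OF assms(3)] by simp
qed

lemma subspace_sum_list:
  assumes "vector_space sA" "module.subspace sA V" "\<And>p. p \<in> set ps \<Longrightarrow> f p \<in> V"
  shows "(\<Sum>p\<leftarrow>ps. f p) \<in> V"
proof -
  interpret A: vector_space sA by fact
  show ?thesis using assms(3)
    by (induction ps) (auto simp: A.subspace_0[OF assms(2)] A.subspace_add[OF assms(2)])
qed

lemma linear_on_fun_sum_list:
  assumes B: "vector_space sB" and "\<And>p. p \<in> set ps \<Longrightarrow> linear_on sA sB V (\<lambda>v. F v p)"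
  shows "linear_on sA sB V (\<lambda>v. \<Sum>p\<leftarrow>ps. F v p)"
proof -
  interpret B: vector_space sB by fact
  show ?thesis using assms(2)
    by (induction ps) (auto simp: linear_on_def B.scale_right_distrib)
qed

lemma tens_bilinear:
  "tens sA sB (a + a') b = tens sA sB a b + tens sA sB a' b"
  "tens sA sB a (b + b') = tens sA sB a b + tens sA sB a b'"
  "tens sA sB (sA c a) b = tscale c (tens sA sB a b)"
  "tens sA sB a (sB c b) = tscale c (tens sA sB a b)"
  by (auto simp: tens_def fun_eq_iff bilinear_on_def linear_on_def tscale_def)

lemma tscale_simps [simp]: "tscale c (s + t) = tscale c s + tscale c t"
  by (auto simp: tscale_def fun_eq_iff algebra_simps)

lemma
  fixes sA :: "'k::field \<Rightarrow> 'a::ab_group_add \<Rightarrow> 'a" and sB :: "'k \<Rightarrow> 'b::ab_group_add \<Rightarrow> 'b"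
  shows tens_in_tensor_space: "v \<in> V \<Longrightarrow> w \<in> W \<Longrightarrow> tens sA sB v w \<in> tensor_space sA sB V W"
    and subspace_tensor_space: "module.subspace tscale (tensor_space sA sB V W)"
proof -
  interpret T: vector_space "tscale :: 'k \<Rightarrow> ('k, 'a, 'b) tensor \<Rightarrow> _" by (rule vector_space_tscale)
  show "v \<in> V \<Longrightarrow> w \<in> W \<Longrightarrow> tens sA sB v w \<in> tensor_space sA sB V W"
    unfolding tensor_space_def by (rule T.span_base) blast
  show "module.subspace tscale (tensor_space sA sB V W)"
    unfolding tensor_space_def by (rule T.subspace_span)
qed

text \<open>\<open>tensor_lift\<close> is known only through a choice, so a fixed list of elementary
  tensors is attached to each \<open>t\<close>. The list does not depend on the map being lifted;
  lifts of different bilinear maps at the same \<open>t\<close> become finite sums over the same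
  list and can be compared term by term.\<close>

definition tensor_reps ::
  "('k::field \<Rightarrow> 'a::ab_group_add \<Rightarrow> 'a) \<Rightarrow> ('k \<Rightarrow> 'b::ab_group_add \<Rightarrow> 'b) \<Rightarrow> 'a set \<Rightarrow> 'b set \<Rightarrow>
   ('k, 'a, 'b) tensor \<Rightarrow> ('a \<times> 'b) list"
  where "tensor_reps sA sB V W t =
    (SOME ps. set ps \<subseteq> V \<times> W \<and> t = (\<Sum>p\<leftarrow>ps. tens sA sB (fst p) (snd p)))"

lemma tensor_reps:
  assumes A: "vector_space sA" and V: "module.subspace sA V" and t: "t \<in> tensor_space sA sB V W"
  shows "set (tensor_reps sA sB V W t) \<subseteq> V \<times> W"
    and "t = (\<Sum>p\<leftarrow>tensor_reps sA sB V W t. tens sA sB (fst p) (snd p))"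
proof -
  from tensor_rep[OF assms] obtain ps
    where "set ps \<subseteq> V \<times> W \<and> t = (\<Sum>p\<leftarrow>ps. tens sA sB (fst p) (snd p))"
    by (auto simp: case_prod_unfold)
  then have "set (tensor_reps sA sB V W t) \<subseteq> V \<times> W \<and>
      t = (\<Sum>p\<leftarrow>tensor_reps sA sB V W t. tens sA sB (fst p) (snd p))"
    unfolding tensor_reps_def by (rule someI)
  then show "set (tensor_reps sA sB V W t) \<subseteq> V \<times> W"
    and "t = (\<Sum>p\<leftarrow>tensor_reps sA sB V W t. tens sA sB (fst p) (snd p))" by blast+
qed

lemma tensor_linear_reps:
  assumes A: "vector_space sA" and V: "module.subspace sA V"
    and C: "vector_space sC" and t: "t \<in> tensor_space sA sB V W"
    and L: "linear_on tscale sC (tensor_space sA sB V W) L"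
  shows "L t = (\<Sum>p\<leftarrow>tensor_reps sA sB V W t. L (tens sA sB (fst p) (snd p)))"
proof -
  note r = tensor_reps[OF A V t]
  show ?thesis
    by (subst r(2), rule linear_on_sum_list[THEN conjunct1, OF vector_space_tscale C subspace_tensor_space L])
       (use r(1) in \<open>auto intro!: tens_in_tensor_space\<close>)
qed

lemma tensor_linear_ext:
  assumes A: "vector_space sA" and V: "module.subspace sA V" and C: "vector_space sC"
    and L: "linear_on tscale sC (tensor_space sA sB V W) L"
    and L': "linear_on tscale sC (tensor_space sA sB V W) L'"
    and eq: "\<And>v w. v \<in> V \<Longrightarrow> w \<in> W \<Longrightarrow> L (tens sA sB v w) = L' (tens sA sB v w)"
    and t: "t \<in> tensor_space sA sB V W"
  shows "L t = L' t"
  unfolding tensor_linear_reps[OF A V C t L] tensor_linear_reps[OF A V C t L']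
  using tensor_reps(1)[OF A V t] eq by (intro arg_cong[where f = sum_list] map_cong) auto

lemma tensor_linear_in:
  assumes A: "vector_space sA" and V: "module.subspace sA V" and C: "vector_space sC"
    and U: "module.subspace sC U"
    and L: "linear_on tscale sC (tensor_space sA sB V W) L"
    and eq: "\<And>v w. v \<in> V \<Longrightarrow> w \<in> W \<Longrightarrow> L (tens sA sB v w) \<in> U"
    and t: "t \<in> tensor_space sA sB V W"
  shows "L t \<in> U"
  unfolding tensor_linear_reps[OF A V C t L]
  using tensor_reps(1)[OF A V t] eq by (intro subspace_sum_list[OF C U]) (auto simp: mem_Times_iff subset_iff)

text \<open>The property by which \<open>tensor_lift\<close> is chosen mentions \<open>f\<close>
  only on \<open>V\<close> and \<open>W\<close>, so both choices are made from the same predicate.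
  Rewriting inside nested Sweedler sums rests on this.\<close>

lemma tensor_lift_cong:
  assumes "\<And>v w. v \<in> V \<Longrightarrow> w \<in> W \<Longrightarrow> f v w = g v w"
  shows "tensor_lift sA sB sC V W f = tensor_lift sA sB sC V W g"
  using assms unfolding tensor_lift_def by (auto intro!: arg_cong[where f = Eps] ext)

lemma tensor_lift_reps:
  assumes A: "vector_space sA" and B: "vector_space sB" and C: "vector_space sC"
    and V: "module.subspace sA V" and W: "module.subspace sB W"
    and f: "bilinear_on sA sB sC V W f" and t: "t \<in> tensor_space sA sB V W"
  shows "tensor_lift sA sB sC V W f t = (\<Sum>p\<leftarrow>tensor_reps sA sB V W t. f (fst p) (snd p))"
proof -
  note l = tensor_lift[OF A B C V W f]
  show ?thesis
    unfolding tensor_linear_reps[OF A V C t l(1)]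
    using tensor_reps(1)[OF A V t] l(2)
    by (intro arg_cong[where f = sum_list] map_cong) (auto simp: mem_Times_iff subset_iff)
qed

text \<open>A function on \<open>V\<close> and \<open>W\<close> that factors through
  \<open>tens\<close> and a linear \<open>L\<close> is automatically bilinear, so its lift is
  \<open>L\<close> by agreement on elementary tensors.\<close>

lemma tensor_lift_eqI:
  assumes A: "vector_space sA" and B: "vector_space sB" and C: "vector_space sC"
    and V: "module.subspace sA V" and W: "module.subspace sB W"
    and L: "linear_on tscale sC (tensor_space sA sB V W) L"
    and eq: "\<And>v w. v \<in> V \<Longrightarrow> w \<in> W \<Longrightarrow> L (tens sA sB v w) = f v w"
    and t: "t \<in> tensor_space sA sB V W"
  shows "tensor_lift sA sB sC V W f t = L t"
proof -
  interpret A: vector_space sA by fact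
  interpret B: vector_space sB by fact
  have f: "bilinear_on sA sB sC V W f"
  proof (intro bilinear_onI linear_onI)
    note [simp] = A.subspace_add[OF V] B.subspace_add[OF W] A.subspace_scale[OF V] B.subspace_scale[OF W]
    note [simp] = tens_bilinear tens_in_tensor_space linear_onD[OF L] eq[symmetric]
    show "f (u + v) w = f u w + f v w" if "w \<in> W" "u \<in> V" "v \<in> V" for u v w using that by simp
    show "f (sA c v) w = sC c (f v w)" if "w \<in> W" "v \<in> V" for c v w using that by simp
    show "f v (w + w') = f v w + f v w'" if "w \<in> W" "w' \<in> W" "v \<in> V" for w w' v using that by simp
    show "f v (sB c w) = sC c (f v w)" if "w \<in> W" "v \<in> V" for c v w using that by simp
  qed
  note l = tensor_lift[OF A B C V W f]
  show ?thesis by (rule tensor_linear_ext[OF A V C l(1) L _ t]) (simp add: l(2) eq)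
qed

text \<open>For fixed \<open>t\<close> the lift is a finite sum over \<open>tensor_reps\<close> of
  \<open>t\<close>, the same list for every parameter \<open>u\<close>; a finite sum of maps linear
  in \<open>u\<close> is linear.\<close>

lemma linear_on_tensor_lift_param:
  assumes A: "vector_space sA" and B: "vector_space sB" and C: "vector_space sC"
    and V: "module.subspace sA V" and W: "module.subspace sB W"
    and E: "vector_space sE" and U: "module.subspace sE U"
    and f: "\<And>u. u \<in> U \<Longrightarrow> bilinear_on sA sB sC V W (F u)"
    and lin: "\<And>v w. v \<in> V \<Longrightarrow> w \<in> W \<Longrightarrow> linear_on sE sC U (\<lambda>u. F u v w)"
    and t: "t \<in> tensor_space sA sB V W"
  shows "linear_on sE sC U (\<lambda>u. tensor_lift sA sB sC V W (F u) t)"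
proof -
  have "linear_on sE sC U (\<lambda>u. \<Sum>p\<leftarrow>tensor_reps sA sB V W t. F u (fst p) (snd p))"
    using tensor_reps(1)[OF A V t] lin
    by (intro linear_on_fun_sum_list[OF C]) (auto simp: mem_Times_iff subset_iff)
  then show ?thesis
    by (rule linear_on_cong[OF _ U E]) (simp add: tensor_lift_reps[OF A B C V W f t])
qed

section \<open>Sweedler calculus\<close>

definition trilinear_on ::
  "('k::field \<Rightarrow> 'a::ab_group_add \<Rightarrow> 'a) \<Rightarrow> ('k \<Rightarrow> 'b::ab_group_add \<Rightarrow> 'b) \<Rightarrow>
   ('k \<Rightarrow> 'c::ab_group_add \<Rightarrow> 'c) \<Rightarrow> ('k \<Rightarrow> 'd::ab_group_add \<Rightarrow> 'd) \<Rightarrow>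
   'a set \<Rightarrow> 'b set \<Rightarrow> 'c set \<Rightarrow> ('a \<Rightarrow> 'b \<Rightarrow> 'c \<Rightarrow> 'd) \<Rightarrow> bool"
  where "trilinear_on sA sB sC sD U V W F \<longleftrightarrow>
    (\<forall>u\<in>U. bilinear_on sB sC sD V W (F u)) \<and> (\<forall>v\<in>V. \<forall>w\<in>W. linear_on sA sD U (\<lambda>u. F u v w))"

lemma htens_bilinear [simp]:
  "htens E F (a + a') b = htens E F a b + htens E F a' b"
  "htens E F a (b + b') = htens E F a b + htens E F a b'"
  "htens E F (scal E c a) b = tscale c (htens E F a b)"
  "htens E F a (scal F c b) = tscale c (htens E F a b)"
  by (simp_all add: htens_def tens_bilinear)

lemma tscale_tscale_commute: "tscale c (tscale d t) = tscale d (tscale c t)"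
  by (simp add: tscale_def fun_eq_iff algebra_simps)

lemma bilinear_on_htens: "bilinear_on (scal E) (scal F) tscale V W (htens E F)"
  by (intro bilinear_onI linear_onI) simp_all

lemma htens_in: "a \<in> carr E \<Longrightarrow> b \<in> carr F \<Longrightarrow> htens E F a b \<in> htensor_space E F"
  unfolding htens_def htensor_space_def by (rule tens_in_tensor_space)

lemma sweedler_cong:
  assumes "\<And>a b. a \<in> carr D \<Longrightarrow> b \<in> carr D \<Longrightarrow> f a b = g a b"
  shows "sweedler D s x f = sweedler D s x g"
  unfolding sweedler_def hlift_def using assms by (simp add: tensor_lift_cong[of _ _ f g])

lemma subspace_htensor: "module.subspace tscale (htensor_space D E)"
  unfolding htensor_space_def by (rule subspace_tensor_space)

text \<open>A comultiplication before coassociativity and counit are known. Sweedler sums already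
  make sense at this level, and they are used to prove the remaining axioms for tensor products and
  for images of coalgebra maps.\<close>

locale precoalg =
  fixes D :: "('k::field, 'd::ab_group_add) hopf"
  assumes vs: "vector_space (scal D)" and sub: "module.subspace (scal D) (carr D)"
    and comul_in: "x \<in> carr D \<Longrightarrow> comul D x \<in> htensor_space D D"
    and comul_lin: "linear_on (scal D) tscale (carr D) (comul D)"
begin

abbreviation bilin :: "('k \<Rightarrow> 'c::ab_group_add \<Rightarrow> 'c) \<Rightarrow> ('d \<Rightarrow> 'd \<Rightarrow> 'c) \<Rightarrow> bool"
  where "bilin s f \<equiv> bilinear_on (scal D) (scal D) s (carr D) (carr D) f"

abbreviation trilin :: "('k \<Rightarrow> 'c::ab_group_add \<Rightarrow> 'c) \<Rightarrow> ('d \<Rightarrow> 'd \<Rightarrow> 'd \<Rightarrow> 'c) \<Rightarrow> bool"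
  where "trilin s F \<equiv> trilinear_on (scal D) (scal D) (scal D) s (carr D) (carr D) (carr D) F"

sublocale V: vector_space "scal D" by (rule vs)

lemma add_in [simp]: "x \<in> carr D \<Longrightarrow> y \<in> carr D \<Longrightarrow> x + y \<in> carr D"
  and scal_in [simp]: "x \<in> carr D \<Longrightarrow> scal D c x \<in> carr D"
  by (simp_all add: V.subspace_add[OF sub] V.subspace_scale[OF sub])

lemma sweedler_reps:
  assumes "vector_space s" "bilin s f" "x \<in> carr D"
  shows "sweedler D s x f =
    (\<Sum>p\<leftarrow>tensor_reps (scal D) (scal D) (carr D) (carr D) (comul D x). f (fst p) (snd p))"
  unfolding sweedler_def hlift_def
  by (rule tensor_lift_reps[OF vs vs assms(1) sub sub assms(2)])
     (use comul_in[OF assms(3)] in \<open>simp add: htensor_space_def\<close>)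

lemma reps_in:
  assumes "x \<in> carr D" "p \<in> set (tensor_reps (scal D) (scal D) (carr D) (carr D) (comul D x))"
  shows "fst p \<in> carr D" "snd p \<in> carr D"
  using tensor_reps(1)[OF vs sub comul_in[OF assms(1), unfolded htensor_space_def]] assms(2) by auto

lemma sweedler_lin:
  assumes "vector_space s" "bilin s f"
  shows "linear_on (scal D) s (carr D) (\<lambda>x. sweedler D s x f)"
  unfolding sweedler_def hlift_def
  by (rule linear_on_comp[OF comul_lin tensor_lift(1)[OF vs vs assms(1) sub sub assms(2)]])
     (use comul_in in \<open>auto simp: htensor_space_def\<close>)

lemma sweedler_apply:
  assumes s: "vector_space s" and s': "vector_space s'" and U: "module.subspace s U"
    and L: "linear_on s s' U L" and f: "bilin s f"
    and fU: "\<And>a b. a \<in> carr D \<Longrightarrow> b \<in> carr D \<Longrightarrow> f a b \<in> U" and x: "x \<in> carr D"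
  shows "L (sweedler D s x f) = sweedler D s' x (\<lambda>a b. L (f a b))"
proof -
  have f': "bilin s' (\<lambda>a b. L (f a b))"
    by (intro bilinear_onI linear_on_comp[OF _ L]; use f fU in \<open>auto simp: bilinear_on_def\<close>)
  show ?thesis
    unfolding sweedler_reps[OF s f x] sweedler_reps[OF s' f' x]
    by (rule linear_on_sum_list[THEN conjunct1, OF s s' U L]) (simp add: fU reps_in[OF x])
qed

lemma sweedler_in:
  assumes s: "vector_space s" and U: "module.subspace s U" and f: "bilin s f"
    and fU: "\<And>a b. a \<in> carr D \<Longrightarrow> b \<in> carr D \<Longrightarrow> f a b \<in> U" and x: "x \<in> carr D"
  shows "sweedler D s x f \<in> U"
  unfolding sweedler_reps[OF s f x]
  by (rule subspace_sum_list[OF s U]) (simp add: fU reps_in[OF x])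

text \<open>Together with \<open>sweedler_lin\<close> this gives the linearity of an inner Sweedler
  sum in the outer variables, the side condition of every manipulation of nested sums.\<close>

lemma sweedler_param:
  assumes s: "vector_space s" and E: "vector_space sE" and U: "module.subspace sE U"
    and F: "\<And>u. u \<in> U \<Longrightarrow> bilin s (F u)"
    and lin: "\<And>a b. a \<in> carr D \<Longrightarrow> b \<in> carr D \<Longrightarrow> linear_on sE s U (\<lambda>u. F u a b)"
    and x: "x \<in> carr D"
  shows "linear_on sE s U (\<lambda>u. sweedler D s x (F u))"
  unfolding sweedler_def hlift_def
  by (rule linear_on_tensor_lift_param[OF vs vs s sub sub E U F lin])
     (use comul_in[OF x] in \<open>simp_all add: htensor_space_def\<close>)

lemma comul_sweedler: "x \<in> carr D \<Longrightarrow> sweedler D tscale x (htens D D) = comul D x"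
  unfolding sweedler_def hlift_def
  by (rule tensor_lift_eqI[OF vs vs vector_space_tscale sub sub])
     (use comul_in in \<open>auto simp: linear_on_def htens_def htensor_space_def\<close>)

end

locale coalg =
  fixes D :: "('k::field, 'd::ab_group_add) hopf"
  assumes coalgebra: "coalgebra D"

sublocale coalg \<subseteq> precoalg
  by (rule precoalg.intro) (use coalgebra in \<open>auto simp: coalgebra_def\<close>)

context coalg
begin

lemma counit_lin: "linear_on (scal D) (*) (carr D) (counit D)"
  using coalgebra by (auto simp: coalgebra_def)

lemma sweedler_counit:
  assumes s: "vector_space s" and L: "linear_on (scal D) s (carr D) L" and x: "x \<in> carr D"
  shows "sweedler D s x (\<lambda>a b. s (counit D a) (L b)) = L x"
    and "sweedler D s x (\<lambda>a b. s (counit D b) (L a)) = L x"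
proof -
  interpret s: vector_space s by fact
  have c: "sweedler D (scal D) x (\<lambda>x1 x2. scal D (counit D x1) x2) = x"
    "sweedler D (scal D) x (\<lambda>x1 x2. scal D (counit D x2) x1) = x"
    using coalgebra x by (auto simp: coalgebra_def)
  note [simp] = linear_onD[OF counit_lin] linear_onD[OF L]
  have b: "bilin (scal D) (\<lambda>x1 x2. scal D (counit D x1) x2)"
    "bilin (scal D) (\<lambda>x1 x2. scal D (counit D x2) x1)"
    by (intro bilinear_onI linear_onI; simp add: V.scale_left_distrib V.scale_right_distrib mult.commute)+
  have "L (sweedler D (scal D) x (\<lambda>x1 x2. scal D (counit D x1) x2)) =
      sweedler D s x (\<lambda>a b. L (scal D (counit D a) b))"
    by (rule sweedler_apply[OF vs s sub L b(1) _ x]) simp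
  also have "\<dots> = sweedler D s x (\<lambda>a b. s (counit D a) (L b))" by (rule sweedler_cong) simp
  finally show "sweedler D s x (\<lambda>a b. s (counit D a) (L b)) = L x" by (simp add: c)
  have "L (sweedler D (scal D) x (\<lambda>x1 x2. scal D (counit D x2) x1)) =
      sweedler D s x (\<lambda>a b. L (scal D (counit D b) a))"
    by (rule sweedler_apply[OF vs s sub L b(2) _ x]) simp
  also have "\<dots> = sweedler D s x (\<lambda>a b. s (counit D b) (L a))" by (rule sweedler_cong) simp
  finally show "sweedler D s x (\<lambda>a b. s (counit D b) (L a)) = L x" by (simp add: c)
qed

text \<open>The axiom is a single equation in D \<otimes> (D \<otimes> D). Lifting \<open>F\<close>
  twice gives a linear map \<open>L\<close> on that space, and applying \<open>L\<close> to both
  sides yields the statement for every trilinear map.\<close>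

lemma coassoc:
  assumes s: "vector_space s" and F: "trilin s F" and x: "x \<in> carr D"
  shows "sweedler D s x (\<lambda>a b. sweedler D s a (\<lambda>c d. F c d b)) =
    sweedler D s x (\<lambda>a b. sweedler D s b (F a))"
proof -
  let ?W = "htensor_space D D" and ?T = tscale
  define f where "f = (\<lambda>a t. hlift D D s (F a) t)"
  note W = subspace_htensor[of D D]
  have FD: "a \<in> carr D \<Longrightarrow> bilin s (F a)" "b \<in> carr D \<Longrightarrow> c \<in> carr D \<Longrightarrow>
    linear_on (scal D) s (carr D) (\<lambda>a. F a b c)" for a b c
    using F by (auto simp: trilinear_on_def)
  have f_tens: "f a (htens D D b c) = F a b c" if "a \<in> carr D" "b \<in> carr D" "c \<in> carr D" for a b c
    unfolding f_def hlift_def htens_def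
    by (rule tensor_lift(2)[OF vs vs s sub sub FD(1)]) (use that in auto)
  have f: "bilinear_on (scal D) tscale s (carr D) ?W f"
  proof (rule bilinear_onI)
    show "linear_on (scal D) s (carr D) (\<lambda>a. f a t)" if "t \<in> ?W" for t
      unfolding f_def hlift_def
      by (rule linear_on_tensor_lift_param[OF vs vs s sub sub vs sub FD])
         (use that in \<open>auto simp: htensor_space_def\<close>)
    show "linear_on tscale s ?W (f a)" if "a \<in> carr D" for a
      unfolding f_def hlift_def htensor_space_def
      by (rule tensor_lift(1)[OF vs vs s sub sub FD(1)[OF that]])
  qed
  define L where "L = tensor_lift (scal D) tscale s (carr D) ?W f"
  note L = tensor_lift[OF vs vector_space_tscale s sub W f, folded L_def]
  have ax: "sweedler D tscale x (\<lambda>x1 x2. sweedler D tscale x1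
         (\<lambda>x11 x12. tens (scal D) tscale x11 (htens D D x12 x2)))
     = sweedler D tscale x (\<lambda>x1 x2. tens (scal D) tscale x1 (comul D x2))"
    using coalgebra x by (simp add: coalgebra_def)
  have b1: "bilin tscale (\<lambda>x1 x2. tens (scal D) tscale x1 (comul D x2))"
    using comul_lin by (auto simp: bilinear_on_def linear_on_def tens_bilinear)
  have b2: "bilin tscale (\<lambda>x11 x12. tens (scal D) tscale x11 (htens D D x12 x2))" for x2
    by (auto simp: bilinear_on_def linear_on_def tens_bilinear)
  have b3: "bilin tscale (\<lambda>x1 x2. sweedler D tscale x1
         (\<lambda>x11 x12. tens (scal D) tscale x11 (htens D D x12 x2)))"
    by (intro bilinear_onI sweedler_lin sweedler_param vector_space_tscale vs sub b2)
       (auto simp: linear_on_def tens_bilinear)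
  have TS: "module.subspace tscale (tensor_space (scal D) tscale (carr D) ?W)"
    by (rule subspace_tensor_space)
  have "L (sweedler D tscale x (\<lambda>x1 x2. tens (scal D) tscale x1 (comul D x2))) =
      sweedler D s x (\<lambda>x1 x2. L (tens (scal D) tscale x1 (comul D x2)))"
    by (rule sweedler_apply[OF vector_space_tscale s TS L(1) b1 _ x])
       (simp add: tens_in_tensor_space comul_in)
  also have "\<dots> = sweedler D s x (\<lambda>a b. sweedler D s b (F a))"
    by (rule sweedler_cong) (simp add: L comul_in f_def sweedler_def)
  finally have 1: "L (sweedler D tscale x (\<lambda>x1 x2. tens (scal D) tscale x1 (comul D x2))) = \<dots>" .
  have "L (sweedler D tscale x (\<lambda>x1 x2. sweedler D tscale x1
         (\<lambda>x11 x12. tens (scal D) tscale x11 (htens D D x12 x2)))) =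
      sweedler D s x (\<lambda>x1 x2. L (sweedler D tscale x1
         (\<lambda>x11 x12. tens (scal D) tscale x11 (htens D D x12 x2))))"
    by (rule sweedler_apply[OF vector_space_tscale s TS L(1) b3 _ x])
       (simp add: sweedler_in[OF vector_space_tscale TS b2] tens_in_tensor_space htens_in)
  also have "\<dots> = sweedler D s x (\<lambda>x1 x2. sweedler D s x1
         (\<lambda>x11 x12. L (tens (scal D) tscale x11 (htens D D x12 x2))))"
    by (rule sweedler_cong, rule sweedler_apply[OF vector_space_tscale s TS L(1) b2])
       (simp_all add: tens_in_tensor_space htens_in)
  also have "\<dots> = sweedler D s x (\<lambda>x1 x2. sweedler D s x1 (\<lambda>x11 x12. F x11 x12 x2))"
    by (intro sweedler_cong) (simp add: L htens_in f_tens)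
  finally show ?thesis using 1 ax by simp
qed

lemma cocomm:
  assumes "cocommutative D" and s: "vector_space s" and f: "bilin s f" and x: "x \<in> carr D"
  shows "sweedler D s x (\<lambda>a b. f b a) = sweedler D s x f"
proof -
  note l = tensor_lift[OF vs vs s sub sub f]
  have b: "bilin tscale (\<lambda>a b. htens D D b a)"
    by (intro bilinear_onI linear_onI) simp_all
  have "sweedler D s x f = hlift D D s f (sweedler D tscale x (\<lambda>a b. htens D D b a))"
    using assms by (simp add: cocommutative_def sweedler_def)
  also have "\<dots> = sweedler D s x (\<lambda>a b. hlift D D s f (htens D D b a))"
    unfolding hlift_def
    by (rule sweedler_apply[OF vector_space_tscale s subspace_htensor _ b _ x])
       (use l in \<open>auto simp: htensor_space_def htens_def intro!: tens_in_tensor_space\<close>)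
  also have "\<dots> = sweedler D s x (\<lambda>a b. f b a)"
    by (rule sweedler_cong) (simp add: hlift_def htens_def l)
  finally show ?thesis by simp
qed

text \<open>Rebracketing of the fourfold coproduct so that the two middle factors are the coproduct
  of one element. In this form something can be done to the middle factors alone: exchanging them,
  or feeding both to the two actions.\<close>

lemma coassoc4:
  assumes s: "vector_space s" and x: "x \<in> carr D"
    and 1: "\<And>a b. a \<in> carr D \<Longrightarrow> b \<in> carr D \<Longrightarrow> bilin s (F a b)"
    and 2: "\<And>c d. c \<in> carr D \<Longrightarrow> d \<in> carr D \<Longrightarrow> bilin s (\<lambda>a b. F a b c d)"
  shows "sweedler D s x (\<lambda>x1 x2. sweedler D s x1 (\<lambda>a b. sweedler D s x2 (F a b))) =
    sweedler D s x (\<lambda>a x'. sweedler D s x' (\<lambda>x'' d. sweedler D s x'' (\<lambda>b c. F a b c d)))"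
proof -
  have t: "trilin s (\<lambda>a b x2. sweedler D s x2 (F a b))"
    unfolding trilinear_on_def
    by (intro conjI ballI bilinear_onI sweedler_lin sweedler_param s vs sub 1)
       (use 1 2 in \<open>auto simp: bilinear_on_def\<close>)
  have t': "trilin s (F a)" if "a \<in> carr D" for a
    unfolding trilinear_on_def using 1 2 that by (auto simp: bilinear_on_def)
  have "sweedler D s x (\<lambda>x1 x2. sweedler D s x1 (\<lambda>a b. sweedler D s x2 (F a b))) =
      sweedler D s x (\<lambda>a x'. sweedler D s x' (\<lambda>b x2. sweedler D s x2 (F a b)))"
    by (rule coassoc[OF s t x])
  also have "\<dots> = sweedler D s x (\<lambda>a x'. sweedler D s x' (\<lambda>x'' d. sweedler D s x'' (\<lambda>b c. F a b c d)))"
    by (rule sweedler_cong) (rule coassoc[OF s t', symmetric])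
  finally show ?thesis .
qed

text \<open>After rebracketing by \<open>coassoc4\<close> the two middle factors belong to one
  coproduct, and cocommutativity exchanges them.\<close>

lemma shuffle:
  assumes "cocommutative D" and s: "vector_space s" and x: "x \<in> carr D"
    and 1: "\<And>a b. a \<in> carr D \<Longrightarrow> b \<in> carr D \<Longrightarrow> bilin s (F a b)"
    and 2: "\<And>c d. c \<in> carr D \<Longrightarrow> d \<in> carr D \<Longrightarrow> bilin s (\<lambda>a b. F a b c d)"
  shows "sweedler D s x (\<lambda>x1 x2. sweedler D s x1 (\<lambda>a b. sweedler D s x2 (F a b))) =
    sweedler D s x (\<lambda>x1 x2. sweedler D s x1 (\<lambda>a b. sweedler D s x2 (\<lambda>c d. F a c b d)))"
proof -
  have b: "bilin s (\<lambda>b c. F a b c d)" if "a \<in> carr D" "d \<in> carr D" for a d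
    using 1 2 that by (auto simp: bilinear_on_def)
  have 3: "bilin s (\<lambda>c d. F a c b d)" if "a \<in> carr D" "b \<in> carr D" for a b
    using 1 2 that by (auto simp: bilinear_on_def)
  have 4: "bilin s (\<lambda>a b. F a c b d)" if "c \<in> carr D" "d \<in> carr D" for c d
    using 1 2 that by (auto simp: bilinear_on_def)
  have "sweedler D s x (\<lambda>a x'. sweedler D s x' (\<lambda>x'' d. sweedler D s x'' (\<lambda>b c. F a b c d))) =
      sweedler D s x (\<lambda>a x'. sweedler D s x' (\<lambda>x'' d. sweedler D s x'' (\<lambda>c b. F a b c d)))"
    by (rule sweedler_cong, rule sweedler_cong, rule cocomm[OF assms(1) s b, symmetric])
  then show ?thesis
    using coassoc4[OF s x 1 2] coassoc4[OF s x 3 4] by simp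
qed

end

lemma sum_list_swap:
  fixes G :: "'a \<Rightarrow> 'b \<Rightarrow> 'c::comm_monoid_add"
  shows "(\<Sum>p\<leftarrow>ps. \<Sum>q\<leftarrow>qs. G p q) = (\<Sum>q\<leftarrow>qs. \<Sum>p\<leftarrow>ps. G p q)"
  by (induction ps) (simp_all add: sum_list_addf)

text \<open>Each Sweedler sum is a finite sum over a list that depends only on its own element, so
  the two summations commute.\<close>

lemma sweedler_swap:
  assumes "coalg D" "coalg E" and s: "vector_space s" and x: "x \<in> carr D" and y: "y \<in> carr E"
    and 1: "\<And>a b. a \<in> carr D \<Longrightarrow> b \<in> carr D \<Longrightarrow> bilinear_on (scal E) (scal E) s (carr E) (carr E) (F a b)"
    and 2: "\<And>c d. c \<in> carr E \<Longrightarrow> d \<in> carr E \<Longrightarrow>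
      bilinear_on (scal D) (scal D) s (carr D) (carr D) (\<lambda>a b. F a b c d)"
  shows "sweedler D s x (\<lambda>a b. sweedler E s y (F a b)) =
    sweedler E s y (\<lambda>c d. sweedler D s x (\<lambda>a b. F a b c d))"
proof -
  interpret D: coalg D by fact
  interpret E: coalg E by fact
  have "bilinear_on (scal D) (scal D) s (carr D) (carr D) (\<lambda>a b. sweedler E s y (F a b))"
    by (intro bilinear_onI E.sweedler_param s D.vs D.sub 1 y)
       (use 2 in \<open>auto simp: bilinear_on_def\<close>)
  note a = D.sweedler_reps[OF s this x]
  have "bilinear_on (scal E) (scal E) s (carr E) (carr E) (\<lambda>c d. sweedler D s x (\<lambda>a b. F a b c d))"
    by (intro bilinear_onI D.sweedler_param s E.vs E.sub 2 x)
       (use 1 in \<open>auto simp: bilinear_on_def\<close>)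
  note b = E.sweedler_reps[OF s this y]
  show ?thesis unfolding a b
    by (simp add: E.sweedler_reps[OF s 1 y] D.sweedler_reps[OF s 2 x] D.reps_in[OF x] E.reps_in[OF y]
      sum_list_swap[of _ "tensor_reps (scal D) _ _ _ _"] cong: map_cong)
qed

section \<open>Coalgebra maps\<close>

lemma coalgebra_mapD:
  assumes "coalgebra_map D E f"
  shows "x \<in> carr D \<Longrightarrow> f x \<in> carr E" "linear_on (scal D) (scal E) (carr D) f"
    "x \<in> carr D \<Longrightarrow> comul E (f x) = sweedler D tscale x (\<lambda>a b. htens E E (f a) (f b))"
    "x \<in> carr D \<Longrightarrow> counit E (f x) = counit D x"
  using assms by (auto simp: coalgebra_map_def linear_map_def)

lemma bilinear_on_comp:
  assumes "linear_on sA sC V g" "linear_on sB sD W h" "\<And>v. v \<in> V \<Longrightarrow> g v \<in> V'"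
    "\<And>w. w \<in> W \<Longrightarrow> h w \<in> W'" "bilinear_on sC sD s V' W' f"
  shows "bilinear_on sA sB s V W (\<lambda>v w. f (g v) (h w))"
  using assms by (auto simp: bilinear_on_def linear_on_def)

text \<open>Stated with a target \<open>E\<close> that need not be a coalgebra yet, because
  \<open>coalgebra_image\<close> uses it to prove the coalgebra axioms for \<open>E\<close>.\<close>

lemma sweedler_cmap_aux:
  assumes D: "precoalg D" and E: "vector_space (scal E)" "module.subspace (scal E) (carr E)"
    and s: "vector_space s"
    and f: "bilinear_on (scal E) (scal E) s (carr E) (carr E) f" and x: "x \<in> carr D"
    and h: "\<And>x. x \<in> carr D \<Longrightarrow> h x \<in> carr E" "linear_on (scal D) (scal E) (carr D) h"
      "comul E (h x) = sweedler D tscale x (\<lambda>a b. htens E E (h a) (h b))"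
  shows "sweedler E s (h x) f = sweedler D s x (\<lambda>a b. f (h a) (h b))"
proof -
  interpret D: precoalg D by fact
  have b: "D.bilin tscale (\<lambda>a b. htens E E (h a) (h b))"
    by (rule bilinear_on_comp[OF h(2) h(2) _ _ bilinear_on_htens]) (rule h, assumption)+
  note l = tensor_lift[OF E(1) E(1) s E(2) E(2) f]
  have "sweedler E s (h x) f = hlift E E s f (sweedler D tscale x (\<lambda>a b. htens E E (h a) (h b)))"
    using h by (simp add: sweedler_def)
  also have "\<dots> = sweedler D s x (\<lambda>a b. hlift E E s f (htens E E (h a) (h b)))"
    unfolding hlift_def
    by (rule D.sweedler_apply[OF vector_space_tscale s subspace_htensor _ b _ x])
       (use l(1) h(1) in \<open>auto simp: htensor_space_def intro!: htens_in[unfolded htensor_space_def]\<close>)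
  also have "\<dots> = sweedler D s x (\<lambda>a b. f (h a) (h b))"
    by (rule sweedler_cong) (simp add: hlift_def htens_def l h(1))
  finally show ?thesis .
qed

lemma sweedler_cmap:
  assumes "coalg D" and "coalg E" and s: "vector_space s"
    and f: "bilinear_on (scal E) (scal E) s (carr E) (carr E) f" and x: "x \<in> carr D"
    and h: "coalgebra_map D E h"
  shows "sweedler E s (h x) f = sweedler D s x (\<lambda>a b. f (h a) (h b))"
proof -
  interpret D: coalg D by fact
  interpret E: coalg E by fact
  note h = coalgebra_mapD[OF h]
  show ?thesis
    by (rule sweedler_cmap_aux[OF D.precoalg_axioms E.vs E.sub s f x h(1,2,3)]) (simp_all add: x)
qed

lemma coalgebra_map_comp:
  assumes "coalg D" and "coalg E" and "coalgebra_map D E f" and g: "coalgebra_map E F g"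
  shows "coalgebra_map D F (\<lambda>x. g (f x))"
proof -
  note f = coalgebra_mapD[OF assms(3)] and g = coalgebra_mapD[OF g]
  have b: "bilinear_on (scal E) (scal E) tscale (carr E) (carr E) (\<lambda>a b. htens F F (g a) (g b))"
    by (rule bilinear_on_comp[OF g(2) g(2) _ _ bilinear_on_htens]) (rule g, assumption)+
  show ?thesis
    unfolding coalgebra_map_def linear_map_def
    using f g linear_on_comp[OF f(2) g(2)] sweedler_cmap[OF assms(1,2) vector_space_tscale b _ assms(3)]
    by auto
qed

lemma coalgebra_map_id:
  assumes "coalg D"
  shows "coalgebra_map D D (\<lambda>x. x)"
proof -
  interpret coalg D by fact
  show ?thesis
    by (auto simp: coalgebra_map_def linear_map_def linear_on_def comul_sweedler)
qed

lemma coalgebra_map_cong: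
  assumes "coalg D" "coalgebra_map D E f" "\<And>x. x \<in> carr D \<Longrightarrow> f x = g x"
  shows "coalgebra_map D E g"
proof -
  interpret D: coalg D by fact
  have "sweedler D tscale x (\<lambda>a b. htens E E (f a) (f b)) = sweedler D tscale x (\<lambda>a b. htens E E (g a) (g b))" for x
    by (rule sweedler_cong) (simp add: assms)
  then show ?thesis
    using assms(2,3) linear_on_cong[OF _ D.sub D.vs, of "scal E" f g]
    by (auto simp: coalgebra_map_def linear_map_def)
qed

text \<open>Every element of \<open>E\<close> is some \<open>h d\<close>, and a Sweedler sum over
  \<open>h d\<close> is a Sweedler sum over \<open>d\<close> with \<open>h\<close> applied to the
  factors; thus each law of \<open>E\<close> is the image of the law of \<open>D\<close>. This makes
  the images of \<open>B\<close> and \<open>Bt\<close> into cocommutative coalgebras.\<close>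

lemma coalgebra_image:
  assumes "coalg D" and "cocommutative D" and h: "coalgebra_map D E h"
    and E: "vector_space (scal E)" "module.subspace (scal E) (carr E)"
      "linear_on (scal E) tscale (carr E) (comul E)" "linear_on (scal E) (*) (carr E) (counit E)"
    and surj: "h ` carr D = carr E"
  shows "coalg E" and "cocommutative E"
proof -
  interpret D: coalg D by fact
  note h = coalgebra_mapD[OF h]
  interpret E: precoalg E
  proof (rule precoalg.intro)
    show "comul E x \<in> htensor_space E E" if "x \<in> carr E" for x
    proof -
      from that surj obtain d where d: "x = h d" "d \<in> carr D" by blast
      show ?thesis unfolding d h(3)[OF d(2)]
        by (rule D.sweedler_in[OF vector_space_tscale subspace_htensor _ _ d(2)])
           (use h in \<open>auto intro: htens_in bilinear_on_comp[OF h(2) h(2) _ _ bilinear_on_htens]\<close>)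
    qed
  qed (rule E)+
  have sw: "sweedler E s (h x) f = sweedler D s x (\<lambda>a b. f (h a) (h b))"
    if "vector_space s" "E.bilin s f" "x \<in> carr D" for s :: "_ \<Rightarrow> 'z::ab_group_add \<Rightarrow> _" and x f
    by (rule sweedler_cmap_aux[OF D.precoalg_axioms E.vs E.sub that h(1,2,3)]) (simp_all add: that)
  note [simp] = linear_onD[OF h(2)] tens_bilinear
  show "cocommutative E"
    unfolding cocommutative_def surj[symmetric]
  proof (clarify)
    fix x assume x: "x \<in> carr D"
    have "sweedler E tscale (h x) (\<lambda>x1 x2. htens E E x2 x1) =
        sweedler D tscale x (\<lambda>x1 x2. htens E E (h x2) (h x1))"
      by (rule sw[OF vector_space_tscale _ x]) (intro bilinear_onI linear_onI; simp)
    also have "\<dots> = sweedler D tscale x (\<lambda>x1 x2. htens E E (h x1) (h x2))"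
      by (rule D.cocomm[OF assms(2) vector_space_tscale _ x])
         (rule bilinear_on_comp[OF h(2) h(2) _ _ bilinear_on_htens], (rule h, assumption)+)
    finally show "sweedler E tscale (h x) (\<lambda>x1 x2. htens E E x2 x1) = comul E (h x)"
      by (simp add: h(3)[OF x])
  qed
  show "coalg E"
  proof
    have "sweedler E tscale x (\<lambda>x1 x2. sweedler E tscale x1
         (\<lambda>x11 x12. tens (scal E) tscale x11 (htens E E x12 x2)))
     = sweedler E tscale x (\<lambda>x1 x2. tens (scal E) tscale x1 (comul E x2))"
      (is "?l = ?r") if "x \<in> carr E" for x
    proof -
      from that surj obtain d where d: "x = h d" "d \<in> carr D" by blast
      have b1: "E.bilin tscale (\<lambda>x11 x12. tens (scal E) tscale x11 (htens E E x12 x2))" for x2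
        by (intro bilinear_onI linear_onI; simp)
      have b2: "E.bilin tscale (\<lambda>x1 x2. sweedler E tscale x1 (\<lambda>x11 x12. tens (scal E) tscale x11 (htens E E x12 x2)))"
        by (intro bilinear_onI E.sweedler_lin E.sweedler_param vector_space_tscale E.vs E.sub b1 linear_onI; simp)
      have b3: "E.bilin tscale (\<lambda>x1 x2. tens (scal E) tscale x1 (comul E x2))"
        by (intro bilinear_onI linear_onI; simp add: linear_onD[OF E.comul_lin])
      have b4: "D.bilin tscale (\<lambda>a b. htens E E (h a) (h b))"
        by (intro bilinear_onI linear_onI; simp)
      have t: "D.trilin tscale (\<lambda>a b c. tens (scal E) tscale (h a) (htens E E (h b) (h c)))"
        unfolding trilinear_on_def by (intro conjI ballI bilinear_onI linear_onI; simp)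
      have "?l = sweedler D tscale d (\<lambda>x1 x2. sweedler D tscale x1
         (\<lambda>x11 x12. tens (scal E) tscale (h x11) (htens E E (h x12) (h x2))))"
        unfolding d sw[OF vector_space_tscale b2 d(2)]
        by (rule sweedler_cong) (rule sw[OF vector_space_tscale b1])
      also have "\<dots> = sweedler D tscale d (\<lambda>x1 x2. sweedler D tscale x2
         (\<lambda>x21 x22. tens (scal E) tscale (h x1) (htens E E (h x21) (h x22))))"
        by (rule D.coassoc[OF vector_space_tscale t d(2)])
      also have "\<dots> = sweedler D tscale d (\<lambda>x1 x2. tens (scal E) tscale (h x1)
          (sweedler D tscale x2 (\<lambda>x21 x22. htens E E (h x21) (h x22))))"
      proof (rule sweedler_cong)
        fix a b assume "a \<in> carr D" "b \<in> carr D"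
        then show "sweedler D tscale b (\<lambda>x21 x22. tens (scal E) tscale (h a) (htens E E (h x21) (h x22))) =
          tens (scal E) tscale (h a) (sweedler D tscale b (\<lambda>x21 x22. htens E E (h x21) (h x22)))"
          by (intro D.sweedler_apply[OF vector_space_tscale vector_space_tscale subspace_htensor[of E E] _ b4,
                 where L = "tens (scal E) tscale (h a)", symmetric]
               linear_onI htens_in h; simp)
      qed
      also have "\<dots> = ?r"
        unfolding d sw[OF vector_space_tscale b3 d(2)]
        by (rule sweedler_cong) (simp add: h(3))
      finally show ?thesis .
    qed
    moreover have "sweedler E (scal E) x (\<lambda>x1 x2. scal E (counit E x1) x2) = x \<and>
        sweedler E (scal E) x (\<lambda>x1 x2. scal E (counit E x2) x1) = x" if "x \<in> carr E" for x
    proof -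
      from that surj obtain d where d: "x = h d" "d \<in> carr D" by blast
      have b: "E.bilin (scal E) (\<lambda>x1 x2. scal E (counit E x1) x2)" "E.bilin (scal E) (\<lambda>x1 x2. scal E (counit E x2) x1)"
        by (intro bilinear_onI linear_onI; simp add: linear_onD[OF E(4)] E.V.scale_left_distrib E.V.scale_right_distrib mult.commute)+
      have "sweedler D (scal E) d (\<lambda>a b. scal E (counit E (h a)) (h b)) = sweedler D (scal E) d (\<lambda>a b. scal E (counit D a) (h b))"
        by (rule sweedler_cong) (simp add: h(4))
      moreover have "sweedler D (scal E) d (\<lambda>a b. scal E (counit E (h b)) (h a)) = sweedler D (scal E) d (\<lambda>a b. scal E (counit D b) (h a))"
        by (rule sweedler_cong) (simp add: h(4))
      ultimately show ?thesis
        unfolding d sw[OF E.vs b(1) d(2)] sw[OF E.vs b(2) d(2)]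
        using D.sweedler_counit[OF E.vs h(2) d(2)] by simp
    qed
    ultimately show "coalgebra E"
      unfolding coalgebra_def using E E.comul_in by blast
  qed
qed

section \<open>Tensor products of coalgebras\<close>

lemma dcp_simps [simp]:
  "carr (dcp F E l r) = htensor_space E F" "scal (dcp F E l r) = tscale"
  by (simp_all add: dcp_def)

lemma htens_tscale [simp]:
  "scal E = tscale \<Longrightarrow> htens E F (tscale c a) b = tscale c (htens E F a b)"
  "scal F = tscale \<Longrightarrow> htens E F a (tscale c b) = tscale c (htens E F a b)"
  by (metis htens_bilinear(3)) (metis htens_bilinear(4))

text \<open>Carrier, comultiplication and counit of \<open>dcp\<close> are those of the tensor
  product coalgebra and do not involve the actions. Leaving \<open>l\<close> and \<open>r\<close>
  arbitrary lets one development serve both H \<otimes> H and the double cross product. Note the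
  order: \<open>dcp F E\<close> lives on E \<otimes> F.\<close>

locale coalg2 = E: coalg E + F: coalg F
  for E :: "('k::field, 'a::ab_group_add) hopf" and F :: "('k, 'b::ab_group_add) hopf" +
  fixes l :: "'b \<Rightarrow> 'a \<Rightarrow> 'a" and r :: "'b \<Rightarrow> 'a \<Rightarrow> 'b"
begin

abbreviation X where "X \<equiv> dcp F E l r"

lemma tensor_ext:
  assumes "vector_space s" "linear_on tscale s (htensor_space E F) L" "linear_on tscale s (htensor_space E F) L'"
    "\<And>a b. a \<in> carr E \<Longrightarrow> b \<in> carr F \<Longrightarrow> L (htens E F a b) = L' (htens E F a b)"
    "z \<in> htensor_space E F"
  shows "L z = L' z"
  using assms unfolding htensor_space_def htens_def
  by (intro tensor_linear_ext[OF E.vs E.sub assms(1), where L = L and L' = L' and W = "carr F" and sB = "scal F" and t = z]) auto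

lemma tensor_in:
  assumes "vector_space s" "module.subspace s U" "linear_on tscale s (htensor_space E F) L"
    "\<And>a b. a \<in> carr E \<Longrightarrow> b \<in> carr F \<Longrightarrow> L (htens E F a b) \<in> U"
    "z \<in> htensor_space E F"
  shows "L z \<in> U"
  using assms unfolding htensor_space_def htens_def
  by (intro tensor_linear_in[OF E.vs E.sub assms(1,2), where L = L and W = "carr F" and sB = "scal F" and t = z]) auto

lemma hlift:
  assumes "vector_space s" "bilinear_on (scal E) (scal F) s (carr E) (carr F) f"
  shows "linear_on tscale s (htensor_space E F) (hlift E F s f)"
    and "a \<in> carr E \<Longrightarrow> b \<in> carr F \<Longrightarrow> hlift E F s f (htens E F a b) = f a b"
  unfolding hlift_def htens_def htensor_space_def
  by (rule tensor_lift[OF E.vs F.vs assms(1) E.sub F.sub assms(2)]; simp)+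

lemma bilin_sweedler2:
  assumes s: "vector_space s"
    and 1: "\<And>a b. a \<in> carr E \<Longrightarrow> b \<in> carr E \<Longrightarrow> F.bilin s (G a b)"
    and 2: "\<And>c d. c \<in> carr F \<Longrightarrow> d \<in> carr F \<Longrightarrow> E.bilin s (\<lambda>a b. G a b c d)"
  shows "y \<in> carr F \<Longrightarrow> E.bilin s (\<lambda>a b. sweedler F s y (G a b))"
    and "bilinear_on (scal E) (scal F) s (carr E) (carr F) (\<lambda>x y. sweedler E s x (\<lambda>a b. sweedler F s y (G a b)))"
proof -
  show *: "E.bilin s (\<lambda>a b. sweedler F s y (G a b))" if "y \<in> carr F" for y
    by (intro bilinear_onI F.sweedler_param s E.vs E.sub 1) (use 2 that in \<open>auto simp: bilinear_on_def\<close>)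
  show "bilinear_on (scal E) (scal F) s (carr E) (carr F) (\<lambda>x y. sweedler E s x (\<lambda>a b. sweedler F s y (G a b)))"
    by (intro bilinear_onI E.sweedler_lin E.sweedler_param F.sweedler_lin s * 1 F.vs F.sub)
qed

abbreviation pc where
  "pc a x \<equiv> sweedler E tscale a (\<lambda>a1 a2. sweedler F tscale x (\<lambda>x1 x2.
          tens tscale tscale (htens E F a1 x1) (htens E F a2 x2)))"

lemma pc_bilin:
  "F.bilin tscale (\<lambda>x1 x2. tens tscale tscale (htens E F a1 x1) (htens E F a2 x2))"
  "E.bilin tscale (\<lambda>a1 a2. tens tscale tscale (htens E F a1 x1) (htens E F a2 x2))"
  by (intro bilinear_onI linear_onI; simp add: tens_bilinear)+

lemma comul_X:
  shows "a \<in> carr E \<Longrightarrow> b \<in> carr F \<Longrightarrow> comul X (htens E F a b) = pc a b"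
    and "linear_on tscale tscale (htensor_space E F) (comul X)"
  using hlift[OF vector_space_tscale bilin_sweedler2(2)[OF vector_space_tscale pc_bilin]]
  by (simp_all add: dcp_def)

lemma tens_in_X: "z \<in> htensor_space E F \<Longrightarrow> w \<in> htensor_space E F \<Longrightarrow>
    tens tscale tscale z w \<in> htensor_space X X"
  by (simp add: htensor_space_def[of X] tens_in_tensor_space)

sublocale X: precoalg X
proof (rule precoalg.intro)
  show "vector_space (scal X)" by (simp add: vector_space_tscale)
  show "module.subspace (scal X) (carr X)" by (simp add: subspace_htensor)
  show "linear_on (scal X) tscale (carr X) (comul X)" using comul_X by simp
  show "comul X z \<in> htensor_space X X" if "z \<in> carr X" for z
  proof (rule tensor_in[OF vector_space_tscale subspace_htensor comul_X(2)])
    show "comul X (htens E F a b) \<in> htensor_space X X" if "a \<in> carr E" "b \<in> carr F" for a b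
      unfolding comul_X(1)[OF that]
      by (intro E.sweedler_in[OF vector_space_tscale subspace_htensor] that(1)
          bilin_sweedler2(1)[OF vector_space_tscale] pc_bilin
          F.sweedler_in[OF vector_space_tscale subspace_htensor] tens_in_X htens_in that(2))
  qed (use that in simp)
qed

text \<open>The laws of the tensor product coalgebra are checked on elementary tensors, where this
  formula splits them into laws of the two factors.\<close>

lemma sweedler_X:
  assumes s: "vector_space s" and f: "X.bilin s f" and a: "a \<in> carr E" and b: "b \<in> carr F"
  shows "sweedler X s (htens E F a b) f = sweedler E s a (\<lambda>a1 a2. sweedler F s b (\<lambda>b1 b2.
    f (htens E F a1 b1) (htens E F a2 b2)))"
proof -
  note l = tensor_lift[OF X.vs X.vs s X.sub X.sub f]
  let ?L = "tensor_lift (scal X) (scal X) s (carr X) (carr X) f"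
  have L: "linear_on tscale s (htensor_space X X) ?L" using l(1) by (simp add: htensor_space_def[of X])
  have "sweedler X s (htens E F a b) f = ?L (pc a b)"
    unfolding sweedler_def hlift_def comul_X(1)[OF a b] ..
  also have "\<dots> = sweedler E s a (\<lambda>a1 a2. ?L (sweedler F tscale b (\<lambda>x1 x2.
          tens tscale tscale (htens E F a1 x1) (htens E F a2 x2))))"
    by (rule E.sweedler_apply[OF vector_space_tscale s subspace_htensor L bilin_sweedler2(1)[OF vector_space_tscale pc_bilin b] _ a])
      (intro F.sweedler_in[OF vector_space_tscale subspace_htensor] pc_bilin tens_in_X htens_in b)
  also have "\<dots> = sweedler E s a (\<lambda>a1 a2. sweedler F s b (\<lambda>x1 x2.
          ?L (tens tscale tscale (htens E F a1 x1) (htens E F a2 x2))))"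
    by (rule sweedler_cong, rule F.sweedler_apply[OF vector_space_tscale s subspace_htensor L pc_bilin(1) _ b])
      (intro tens_in_X htens_in)
  also have "\<dots> = sweedler E s a (\<lambda>a1 a2. sweedler F s b (\<lambda>x1 x2. f (htens E F a1 x1) (htens E F a2 x2)))"
    by (intro sweedler_cong) (use l(2) in \<open>simp add: htens_in\<close>)
  finally show ?thesis .
qed

lemma counit_X: "linear_on tscale (*) (htensor_space E F) (counit X)"
  "a \<in> carr E \<Longrightarrow> b \<in> carr F \<Longrightarrow> counit X (htens E F a b) = counit E a * counit F b"
proof -
  have "bilinear_on (scal E) (scal F) (*) (carr E) (carr F) (\<lambda>a x. counit E a * counit F x)"
    by (intro bilinear_onI linear_onI; simp add: linear_onD[OF E.counit_lin] linear_onD[OF F.counit_lin] algebra_simps)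
  from hlift[OF vector_space_field this]
  show "linear_on tscale (*) (htensor_space E F) (counit X)"
    "a \<in> carr E \<Longrightarrow> b \<in> carr F \<Longrightarrow> counit X (htens E F a b) = counit E a * counit F b"
    by (simp_all add: dcp_def)
qed

text \<open>On an elementary tensor the four nested sums are reordered by
  \<open>sweedler_swap\<close> so that the two sums over \<open>E\<close> and the two over
  \<open>F\<close> are adjacent. Coassociativity then applies in each factor separately, and a
  second exchange restores the nesting.\<close>

lemma X_coassoc:
  assumes z: "z \<in> carr X"
  shows "sweedler X tscale z (\<lambda>x1 x2. sweedler X tscale x1
         (\<lambda>x11 x12. tens (scal X) tscale x11 (htens X X x12 x2)))
     = sweedler X tscale z (\<lambda>x1 x2. tens (scal X) tscale x1 (comul X x2))"
proof -
  let ?T = "\<lambda>x y z. tens tscale tscale x (htens X X y z)"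
  note vt = vector_space_tscale
  note [simp] = tens_bilinear
  have b1: "X.bilin tscale (\<lambda>x11 x12. ?T x11 x12 x2)" for x2
    by (intro bilinear_onI linear_onI; simp)
  have b2: "X.bilin tscale (\<lambda>x1 x2. sweedler X tscale x1 (\<lambda>x11 x12. ?T x11 x12 x2))"
    by (intro bilinear_onI X.sweedler_lin X.sweedler_param vt X.vs X.sub b1 linear_onI; simp)
  have b3: "X.bilin tscale (\<lambda>x1 x2. tens (scal X) tscale x1 (comul X x2))"
    by (intro bilinear_onI linear_onI; simp add: linear_onD[OF comul_X(2)])
  have b4: "X.bilin tscale (\<lambda>x12 x2. ?T x11 x12 x2)" for x11
    by (intro bilinear_onI linear_onI; simp)
  show ?thesis
  proof (rule tensor_ext[OF vt, where z = z and
      L = "\<lambda>z. sweedler X tscale z (\<lambda>x1 x2. sweedler X tscale x1 (\<lambda>x11 x12. tens (scal X) tscale x11 (htens X X x12 x2)))" and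
      L' = "\<lambda>z. sweedler X tscale z (\<lambda>x1 x2. tens (scal X) tscale x1 (comul X x2))"])
    show "z \<in> htensor_space E F" using z by simp
    show "linear_on tscale tscale (htensor_space E F) (\<lambda>z. sweedler X tscale z (\<lambda>x1 x2. sweedler X tscale x1
         (\<lambda>x11 x12. tens (scal X) tscale x11 (htens X X x12 x2))))"
      using X.sweedler_lin[OF vt b2] by simp
    show "linear_on tscale tscale (htensor_space E F) (\<lambda>z. sweedler X tscale z (\<lambda>x1 x2. tens (scal X) tscale x1 (comul X x2)))"
      using X.sweedler_lin[OF vt b3] by simp
    fix a b assume a: "a \<in> carr E" and b: "b \<in> carr F"
    let ?S = "\<lambda>a11 b11 a12 b12 a2 b2. ?T (htens E F a11 b11) (htens E F a12 b12) (htens E F a2 b2)"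
    have lin6:
      "linear_on (scal E) tscale (carr E) (\<lambda>a1. ?S a1 b1 a2 b2 a3 b3)"
      "linear_on (scal E) tscale (carr E) (\<lambda>a2. ?S a1 b1 a2 b2 a3 b3)"
      "linear_on (scal E) tscale (carr E) (\<lambda>a3. ?S a1 b1 a2 b2 a3 b3)"
      "linear_on (scal F) tscale (carr F) (\<lambda>b1. ?S a1 b1 a2 b2 a3 b3)"
      "linear_on (scal F) tscale (carr F) (\<lambda>b2. ?S a1 b1 a2 b2 a3 b3)"
      "linear_on (scal F) tscale (carr F) (\<lambda>b3. ?S a1 b1 a2 b2 a3 b3)"
      for a1 b1 a2 b2 a3 b3
      by (intro linear_onI; simp)+
    have tF: "F.trilin tscale (\<lambda>b1 b2 b3. ?S a1 b1 a2 b2 a3 b3)" for a1 a2 a3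
      unfolding trilinear_on_def by (intro conjI ballI bilinear_onI lin6)
    have tE: "E.trilin tscale (\<lambda>a1 a2 a3. sweedler F tscale b (\<lambda>b1 b'. sweedler F tscale b' (\<lambda>b2 b3. ?S a1 b1 a2 b2 a3 b3)))"
      unfolding trilinear_on_def
      by (intro conjI ballI bilinear_onI F.sweedler_param F.sweedler_lin lin6 vt E.vs E.sub F.vs F.sub b)
    have "sweedler X tscale (htens E F a b) (\<lambda>x1 x2. sweedler X tscale x1 (\<lambda>x11 x12. ?T x11 x12 x2)) =
      sweedler E tscale a (\<lambda>a' a3. sweedler F tscale b (\<lambda>b' b3.
        sweedler X tscale (htens E F a' b') (\<lambda>x11 x12. ?T x11 x12 (htens E F a3 b3))))"
      by (rule sweedler_X[OF vt b2 a b])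
    also have "\<dots> = sweedler E tscale a (\<lambda>a' a3. sweedler F tscale b (\<lambda>b' b3.
        sweedler E tscale a' (\<lambda>a1 a2. sweedler F tscale b' (\<lambda>b1 b2. ?S a1 b1 a2 b2 a3 b3))))"
      by (intro sweedler_cong sweedler_X[OF vt b1])
    also have "\<dots> = sweedler E tscale a (\<lambda>a' a3. sweedler E tscale a' (\<lambda>a1 a2. sweedler F tscale b (\<lambda>b' b3.
        sweedler F tscale b' (\<lambda>b1 b2. ?S a1 b1 a2 b2 a3 b3))))"
      by (rule sweedler_cong, rule sweedler_swap[OF F.coalg_axioms E.coalg_axioms vt b])
        (assumption, (intro bilinear_onI F.sweedler_param F.sweedler_lin lin6 vt E.vs E.sub F.vs F.sub; assumption)+)
    also have "\<dots> = sweedler E tscale a (\<lambda>a' a3. sweedler E tscale a' (\<lambda>a1 a2. sweedler F tscale b (\<lambda>b1 b'.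
        sweedler F tscale b' (\<lambda>b2 b3. ?S a1 b1 a2 b2 a3 b3))))"
      by (rule sweedler_cong, rule sweedler_cong, rule F.coassoc[OF vt tF b])
    also have "\<dots> = sweedler E tscale a (\<lambda>a1 a'. sweedler E tscale a' (\<lambda>a2 a3. sweedler F tscale b (\<lambda>b1 b'.
        sweedler F tscale b' (\<lambda>b2 b3. ?S a1 b1 a2 b2 a3 b3))))"
      by (rule E.coassoc[OF vt tE a])
    also have "\<dots> = sweedler E tscale a (\<lambda>a1 a'. sweedler F tscale b (\<lambda>b1 b'. sweedler E tscale a' (\<lambda>a2 a3.
        sweedler F tscale b' (\<lambda>b2 b3. ?S a1 b1 a2 b2 a3 b3))))"
      by (rule sweedler_cong, rule sweedler_swap[OF E.coalg_axioms F.coalg_axioms vt _ b])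
        (assumption, (intro bilinear_onI F.sweedler_param F.sweedler_lin lin6 vt E.vs E.sub F.vs F.sub; assumption)+)
    also have "\<dots> = sweedler E tscale a (\<lambda>a1 a'. sweedler F tscale b (\<lambda>b1 b'.
        tens tscale tscale (htens E F a1 b1) (comul X (htens E F a' b'))))"
    proof (rule sweedler_cong, rule sweedler_cong)
      fix a1 a' b1 b' assume *: "a1 \<in> carr E" "a' \<in> carr E" "b1 \<in> carr F" "b' \<in> carr F"
      have z': "htens E F a' b' \<in> carr X" using * by (simp add: htens_in)
      have "tens tscale tscale (htens E F a1 b1) (comul X (htens E F a' b')) =
        tens tscale tscale (htens E F a1 b1) (sweedler X tscale (htens E F a' b') (htens X X))"
        using X.comul_sweedler[OF z'] by simp
      also have "\<dots> = sweedler X tscale (htens E F a' b') (?T (htens E F a1 b1))"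
        by (rule X.sweedler_apply[OF vt vt subspace_htensor[of X X] _ bilinear_on_htens _ z',
              where L = "tens tscale tscale (htens E F a1 b1)"])
          (intro linear_onI htens_in; simp)+
      also have "\<dots> = sweedler E tscale a' (\<lambda>a2 a3. sweedler F tscale b' (\<lambda>b2 b3. ?S a1 b1 a2 b2 a3 b3))"
        by (rule sweedler_X[OF vt b4 *(2,4)])
      finally show "sweedler E tscale a' (\<lambda>a2 a3. sweedler F tscale b' (\<lambda>b2 b3. ?S a1 b1 a2 b2 a3 b3)) =
        tens tscale tscale (htens E F a1 b1) (comul X (htens E F a' b'))" by simp
    qed
    also have "\<dots> = sweedler X tscale (htens E F a b) (\<lambda>x1 x2. tens (scal X) tscale x1 (comul X x2))"
      using sweedler_X[OF vt b3 a b] by simp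
    finally show "sweedler X tscale (htens E F a b) (\<lambda>x1 x2. sweedler X tscale x1
         (\<lambda>x11 x12. tens (scal X) tscale x11 (htens X X x12 x2))) =
      sweedler X tscale (htens E F a b) (\<lambda>x1 x2. tens (scal X) tscale x1 (comul X x2))"
      by simp
  qed
qed

lemma X_counit:
  assumes z: "z \<in> carr X"
  shows "sweedler X (scal X) z (\<lambda>x1 x2. scal X (counit X x1) x2) = z"
    and "sweedler X (scal X) z (\<lambda>x1 x2. scal X (counit X x2) x1) = z"
proof -
  note vt = vector_space_tscale
  interpret T: vector_space "tscale :: 'k \<Rightarrow> ('k, 'a, 'b) tensor \<Rightarrow> _" by (rule vt)
  have z': "z \<in> htensor_space E F" using z by simp
  have id: "linear_on tscale tscale (htensor_space E F) (\<lambda>z. z)" by (simp add: linear_on_def)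
  have b: "X.bilin tscale (\<lambda>x1 x2. tscale (counit X x1) x2)" "X.bilin tscale (\<lambda>x1 x2. tscale (counit X x2) x1)"
    by (intro bilinear_onI linear_onI;
        simp add: linear_onD[OF counit_X(1)] T.scale_left_distrib mult.commute)+
  have 1: "tscale (counit E a * counit F b) (htens E F a' b') = htens E F (scal E (counit E a) a') (scal F (counit F b) b')"
    for a b a' b' by (simp add: mult.commute)
  have lin: "linear_on (scal F) tscale (carr F) (htens E F a)" for a by (simp add: linear_on_def)
  have lin': "linear_on (scal E) tscale (carr E) (\<lambda>a. htens E F a b)" for b by (simp add: linear_on_def)
  have "sweedler X tscale z (\<lambda>x1 x2. tscale (counit X x1) x2) = z"
  proof (rule tensor_ext[OF vt _ id _ z',
      where L = "\<lambda>z. sweedler X tscale z (\<lambda>x1 x2. tscale (counit X x1) x2)"])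
    show "linear_on tscale tscale (htensor_space E F) (\<lambda>z. sweedler X tscale z (\<lambda>x1 x2. tscale (counit X x1) x2))"
      using X.sweedler_lin[OF vt b(1)] by simp
    fix a b assume a: "a \<in> carr E" and b': "b \<in> carr F"
    have "sweedler X tscale (htens E F a b) (\<lambda>x1 x2. tscale (counit X x1) x2) =
      sweedler E tscale a (\<lambda>a1 a2. sweedler F tscale b (\<lambda>b1 b2. tscale (counit F b1) (htens E F (scal E (counit E a1) a2) b2)))"
      unfolding sweedler_X[OF vt b(1) a b']
      by (intro sweedler_cong) (simp add: counit_X mult.commute)
    also have "\<dots> = sweedler E tscale a (\<lambda>a1 a2. tscale (counit E a1) (htens E F a2 b))"
      by (rule sweedler_cong) (rule F.sweedler_counit(1)[OF vt lin b', THEN trans], simp)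
    also have "\<dots> = htens E F a b" by (rule E.sweedler_counit(1)[OF vt lin' a])
    finally show "sweedler X tscale (htens E F a b) (\<lambda>x1 x2. tscale (counit X x1) x2) = htens E F a b" .
  qed
  then show "sweedler X (scal X) z (\<lambda>x1 x2. scal X (counit X x1) x2) = z" by simp
  have "sweedler X tscale z (\<lambda>x1 x2. tscale (counit X x2) x1) = z"
  proof (rule tensor_ext[OF vt _ id _ z',
      where L = "\<lambda>z. sweedler X tscale z (\<lambda>x1 x2. tscale (counit X x2) x1)"])
    show "linear_on tscale tscale (htensor_space E F) (\<lambda>z. sweedler X tscale z (\<lambda>x1 x2. tscale (counit X x2) x1))"
      using X.sweedler_lin[OF vt b(2)] by simp
    fix a b assume a: "a \<in> carr E" and b': "b \<in> carr F"
    have "sweedler X tscale (htens E F a b) (\<lambda>x1 x2. tscale (counit X x2) x1) =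
      sweedler E tscale a (\<lambda>a1 a2. sweedler F tscale b (\<lambda>b1 b2. tscale (counit F b2) (htens E F (scal E (counit E a2) a1) b1)))"
      unfolding sweedler_X[OF vt b(2) a b']
      by (intro sweedler_cong) (simp add: counit_X mult.commute)
    also have "\<dots> = sweedler E tscale a (\<lambda>a1 a2. tscale (counit E a2) (htens E F a1 b))"
      by (rule sweedler_cong) (rule F.sweedler_counit(2)[OF vt lin b', THEN trans], simp)
    also have "\<dots> = htens E F a b" by (rule E.sweedler_counit(2)[OF vt lin' a])
    finally show "sweedler X tscale (htens E F a b) (\<lambda>x1 x2. tscale (counit X x2) x1) = htens E F a b" .
  qed
  then show "sweedler X (scal X) z (\<lambda>x1 x2. scal X (counit X x2) x1) = z" by simp
qed

sublocale X: coalg X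
proof (rule coalg.intro)
  show "coalgebra X"
    unfolding coalgebra_def
    using X.vs X.sub X.comul_in X.comul_lin counit_X(1) X_coassoc X_counit by auto
qed

end

section \<open>Pairings and projections\<close>

text \<open>The map into the tensor product induced by \<open>f\<close> and \<open>g\<close>. With
  \<open>proj1\<close> and \<open>proj2\<close> as projections it exhibits E \<otimes> F as a
  product in the category of cocommutative coalgebras.\<close>

definition pair ::
  "('k::field, 't::ab_group_add) hopf \<Rightarrow> ('k, 'a::ab_group_add) hopf \<Rightarrow> ('k, 'b::ab_group_add) hopf \<Rightarrow>
   ('t \<Rightarrow> 'a) \<Rightarrow> ('t \<Rightarrow> 'b) \<Rightarrow> 't \<Rightarrow> ('k, 'a, 'b) tensor"
  where "pair T E F f g d = sweedler T tscale d (\<lambda>a b. htens E F (f a) (g b))"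

lemma tscale_tscale: "tscale c (tscale d t) = tscale (c * d) t"
  by (simp add: tscale_def fun_eq_iff mult.assoc)

definition proj1 ::
  "('k::field, 'a::ab_group_add) hopf \<Rightarrow> ('k, 'b::ab_group_add) hopf \<Rightarrow> ('k, 'a, 'b) tensor \<Rightarrow> 'a"
  where "proj1 E F = hlift E F (scal E) (\<lambda>a b. scal E (counit F b) a)"

definition proj2 ::
  "('k::field, 'a::ab_group_add) hopf \<Rightarrow> ('k, 'b::ab_group_add) hopf \<Rightarrow> ('k, 'a, 'b) tensor \<Rightarrow> 'b"
  where "proj2 E F = hlift E F (scal F) (\<lambda>a b. scal F (counit E a) b)"

lemma coalgebra_map_linear: "coalgebra_map D E f \<Longrightarrow> linear_map D E f"
  by (simp add: coalgebra_map_def)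

lemma linear_mapD:
  assumes "linear_map D E f"
  shows "x \<in> carr D \<Longrightarrow> f x \<in> carr E" "linear_on (scal D) (scal E) (carr D) f"
  using assms by (auto simp: linear_map_def)

lemma linear_mapI:
  assumes "\<And>x. x \<in> carr D \<Longrightarrow> f x \<in> carr E" "linear_on (scal D) (scal E) (carr D) f"
  shows "linear_map D E f"
  using assms by (auto simp: linear_map_def)

lemma bilinear_on_linear_maps:
  assumes "linear_map D E f" "linear_map D' E' g"
    "bilinear_on (scal E) (scal E') s (carr E) (carr E') \<Phi>"
  shows "bilinear_on (scal D) (scal D') s (carr D) (carr D') (\<lambda>a b. \<Phi> (f a) (g b))"
  by (rule bilinear_on_comp[OF linear_mapD(2)[OF assms(1)] linear_mapD(2)[OF assms(2)] _ _ assms(3)])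
     (auto intro: linear_mapD(1) assms)

context coalg2
begin

lemma cocommutative_X:
  assumes "cocommutative E" "cocommutative F"
  shows "cocommutative X"
  unfolding cocommutative_def
proof
  fix z assume z: "z \<in> carr X"
  note vt = vector_space_tscale
  have b: "X.bilin tscale (\<lambda>z1 z2. htens X X z2 z1)" "X.bilin tscale (htens X X)"
    by (intro bilinear_onI linear_onI; simp)+
  have lin:
    "F.bilin tscale (\<lambda>b1 b2. htens X X (htens E F a1 b1) (htens E F a2 b2))"
    "E.bilin tscale (\<lambda>a1 a2. htens X X (htens E F a1 b1) (htens E F a2 b2))" for a1 a2 b1 b2
    by (intro bilinear_onI linear_onI; simp)+
  show "sweedler X tscale z (\<lambda>x1 x2. htens X X x2 x1) = comul X z"
  proof (rule tensor_ext[OF vt _ comul_X(2), where L = "\<lambda>z. sweedler X tscale z (\<lambda>x1 x2. htens X X x2 x1)"])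
    show "linear_on tscale tscale (htensor_space E F) (\<lambda>z. sweedler X tscale z (\<lambda>x1 x2. htens X X x2 x1))"
      using X.sweedler_lin[OF vt b(1)] by simp
    fix a b' assume a: "a \<in> carr E" and b': "b' \<in> carr F"
    have "sweedler X tscale (htens E F a b') (\<lambda>x1 x2. htens X X x2 x1) =
        sweedler E tscale a (\<lambda>a1 a2. sweedler F tscale b' (\<lambda>b1 b2. htens X X (htens E F a2 b2) (htens E F a1 b1)))"
      by (rule sweedler_X[OF vt b(1) a b'])
    also have "\<dots> = sweedler E tscale a (\<lambda>a1 a2. sweedler F tscale b' (\<lambda>b1 b2. htens X X (htens E F a2 b1) (htens E F a1 b2)))"
      by (rule sweedler_cong, rule F.cocomm[OF assms(2) vt lin(1) b'])
    also have "\<dots> = sweedler E tscale a (\<lambda>a1 a2. sweedler F tscale b' (\<lambda>b1 b2. htens X X (htens E F a1 b1) (htens E F a2 b2)))"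
      by (rule E.cocomm[OF assms(1) vt bilin_sweedler2(1)[OF vt lin b'] a])
    also have "\<dots> = sweedler X tscale (htens E F a b') (htens X X)"
      by (rule sweedler_X[OF vt b(2) a b', symmetric])
    also have "\<dots> = comul X (htens E F a b')"
      by (rule X.comul_sweedler) (simp add: htens_in a b')
    finally show "sweedler X tscale (htens E F a b') (\<lambda>x1 x2. htens X X x2 x1) = comul X (htens E F a b')" .
  qed (use z in simp)
qed

lemma proj1: "linear_on tscale (scal E) (htensor_space E F) (proj1 E F)"
  "a \<in> carr E \<Longrightarrow> b \<in> carr F \<Longrightarrow> proj1 E F (htens E F a b) = scal E (counit F b) a"
proof -
  have "bilinear_on (scal E) (scal F) (scal E) (carr E) (carr F) (\<lambda>a b. scal E (counit F b) a)"
    by (intro bilinear_onI linear_onI; simp add: linear_onD[OF F.counit_lin] E.V.scale_left_distrib E.V.scale_right_distrib mult.commute)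
  from hlift[OF E.vs this]
  show "linear_on tscale (scal E) (htensor_space E F) (proj1 E F)"
    "a \<in> carr E \<Longrightarrow> b \<in> carr F \<Longrightarrow> proj1 E F (htens E F a b) = scal E (counit F b) a"
    by (simp_all add: proj1_def)
qed

lemma proj2: "linear_on tscale (scal F) (htensor_space E F) (proj2 E F)"
  "a \<in> carr E \<Longrightarrow> b \<in> carr F \<Longrightarrow> proj2 E F (htens E F a b) = scal F (counit E a) b"
proof -
  have "bilinear_on (scal E) (scal F) (scal F) (carr E) (carr F) (\<lambda>a b. scal F (counit E a) b)"
    by (intro bilinear_onI linear_onI; simp add: linear_onD[OF E.counit_lin] F.V.scale_left_distrib F.V.scale_right_distrib mult.commute)
  from hlift[OF F.vs this]
  show "linear_on tscale (scal F) (htensor_space E F) (proj2 E F)"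
    "a \<in> carr E \<Longrightarrow> b \<in> carr F \<Longrightarrow> proj2 E F (htens E F a b) = scal F (counit E a) b"
    by (simp_all add: proj2_def)
qed

lemma proj1_map: "coalgebra_map X E (proj1 E F)"
  unfolding coalgebra_map_def
proof (intro conjI ballI)
  show lin: "linear_map X E (proj1 E F)"
    unfolding linear_map_def
    using proj1 tensor_in[OF E.vs E.sub proj1(1)] by auto
  note vt = vector_space_tscale
  have b: "X.bilin tscale (\<lambda>z1 z2. htens E E (proj1 E F z1) (proj1 E F z2))"
    by (rule bilinear_on_linear_maps[OF lin lin bilinear_on_htens])
  show "comul E (proj1 E F z) = sweedler X tscale z (\<lambda>z1 z2. htens E E (proj1 E F z1) (proj1 E F z2))"
    if "z \<in> carr X" for z
  proof (rule tensor_ext[OF vt, where L = "\<lambda>z. comul E (proj1 E F z)" and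
      L' = "\<lambda>z. sweedler X tscale z (\<lambda>z1 z2. htens E E (proj1 E F z1) (proj1 E F z2))"])
    show "linear_on tscale tscale (htensor_space E F) (\<lambda>z. comul E (proj1 E F z))"
      using linear_on_comp[OF proj1(1) E.comul_lin] lin by (simp add: linear_map_def)
    show "linear_on tscale tscale (htensor_space E F) (\<lambda>z. sweedler X tscale z (\<lambda>z1 z2. htens E E (proj1 E F z1) (proj1 E F z2)))"
      using X.sweedler_lin[OF vt b] by simp
    fix a b' assume a: "a \<in> carr E" and b': "b' \<in> carr F"
    have l: "linear_on (scal F) tscale (carr F) (\<lambda>c. htens E E (scal E (counit F c) a1) a2)" for a1 a2
      by (intro linear_onI; simp add: linear_onD[OF F.counit_lin] E.V.scale_left_distrib tscale_def fun_eq_iff algebra_simps)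
    have l2: "linear_on tscale tscale (htensor_space E E) (tscale c)" for c
      by (intro linear_onI; simp add: tscale_tscale_commute)
    have "sweedler X tscale (htens E F a b') (\<lambda>z1 z2. htens E E (proj1 E F z1) (proj1 E F z2)) =
      sweedler E tscale a (\<lambda>a1 a2. sweedler F tscale b' (\<lambda>b1 b2. tscale (counit F b2) (htens E E (scal E (counit F b1) a1) a2)))"
      unfolding sweedler_X[OF vt b a b'] by (intro sweedler_cong) (simp add: proj1 tscale_tscale_commute)
    also have "\<dots> = sweedler E tscale a (\<lambda>a1 a2. tscale (counit F b') (htens E E a1 a2))"
      by (rule sweedler_cong) (rule F.sweedler_counit(2)[OF vt l b', THEN trans], simp)
    also have "\<dots> = tscale (counit F b') (sweedler E tscale a (htens E E))"
      by (rule E.sweedler_apply[OF vt vt subspace_htensor l2 bilinear_on_htens htens_in a, symmetric])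
    also have "\<dots> = comul E (proj1 E F (htens E F a b'))"
      using a b' by (simp add: proj1 E.comul_sweedler linear_onD[OF E.comul_lin])
    finally show "comul E (proj1 E F (htens E F a b')) =
      sweedler X tscale (htens E F a b') (\<lambda>z1 z2. htens E E (proj1 E F z1) (proj1 E F z2))" by simp
  qed (use that in simp)
  show "counit E (proj1 E F z) = counit X z" if "z \<in> carr X" for z
    by (rule tensor_ext[OF vector_space_field _ counit_X(1), where L = "\<lambda>z. counit E (proj1 E F z)"])
       (use that linear_on_comp[OF proj1(1) E.counit_lin] lin in
         \<open>auto simp: proj1 counit_X linear_onD[OF E.counit_lin] linear_map_def\<close>)
qed

lemma proj2_map: "coalgebra_map X F (proj2 E F)"
  unfolding coalgebra_map_def
proof (intro conjI ballI)
  note vt = vector_space_tscale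
  show lin: "linear_map X F (proj2 E F)"
    unfolding linear_map_def
    using proj2 tensor_in[OF F.vs F.sub proj2(1)] by auto
  have b: "X.bilin tscale (\<lambda>z1 z2. htens F F (proj2 E F z1) (proj2 E F z2))"
    by (rule bilinear_on_linear_maps[OF lin lin bilinear_on_htens])
  show "comul F (proj2 E F z) = sweedler X tscale z (\<lambda>z1 z2. htens F F (proj2 E F z1) (proj2 E F z2))"
    if "z \<in> carr X" for z
  proof (rule tensor_ext[OF vt, where L = "\<lambda>z. comul F (proj2 E F z)" and
      L' = "\<lambda>z. sweedler X tscale z (\<lambda>z1 z2. htens F F (proj2 E F z1) (proj2 E F z2))"])
    show "linear_on tscale tscale (htensor_space E F) (\<lambda>z. comul F (proj2 E F z))"
      using linear_on_comp[OF proj2(1) F.comul_lin] lin by (simp add: linear_map_def)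
    show "linear_on tscale tscale (htensor_space E F) (\<lambda>z. sweedler X tscale z (\<lambda>z1 z2. htens F F (proj2 E F z1) (proj2 E F z2)))"
      using X.sweedler_lin[OF vt b] by simp
    fix a b' assume a: "a \<in> carr E" and b': "b' \<in> carr F"
    have e: "E.bilin (*) (\<lambda>a1 a2. counit E a1 * counit E a2)"
      by (intro bilinear_onI linear_onI; simp add: linear_onD[OF E.counit_lin] algebra_simps)
    have l: "linear_on (*) tscale UNIV (\<lambda>c. tscale c t)" for t :: "('k, 'b, 'b) tensor"
      by (intro linear_onI; simp add: tscale_def fun_eq_iff algebra_simps)
    have l2: "linear_on tscale tscale (htensor_space F F) (tscale c)" for c
      by (intro linear_onI; simp add: tscale_tscale_commute)
    interpret K: vector_space "(*) :: 'k \<Rightarrow> _" by (rule vector_space_field)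
    have "sweedler X tscale (htens E F a b') (\<lambda>z1 z2. htens F F (proj2 E F z1) (proj2 E F z2)) =
      sweedler E tscale a (\<lambda>a1 a2. sweedler F tscale b' (\<lambda>b1 b2. tscale (counit E a1 * counit E a2) (htens F F b1 b2)))"
      unfolding sweedler_X[OF vt b a b'] by (intro sweedler_cong) (simp add: proj2 tscale_tscale mult.commute)
    \<comment> \<open>The inner sum becomes a scalar multiple of \<open>comul F b'\<close>, so the
      sum over \<open>a\<close> reduces to a sum of scalars, which the counit law evaluates.\<close>
    also have "\<dots> = sweedler E tscale a (\<lambda>a1 a2. tscale (counit E a1 * counit E a2) (comul F b'))"
      unfolding F.comul_sweedler[OF b', symmetric]
      by (rule sweedler_cong, rule F.sweedler_apply[OF vt vt subspace_htensor l2 bilinear_on_htens htens_in b', symmetric])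
    also have "\<dots> = tscale (sweedler E (*) a (\<lambda>a1 a2. counit E a1 * counit E a2)) (comul F b')"
      by (rule E.sweedler_apply[OF vector_space_field vt K.subspace_UNIV l e _ a, symmetric]) simp
    also have "\<dots> = comul F (proj2 E F (htens E F a b'))"
      using a b' by (simp add: proj2 linear_onD[OF F.comul_lin]
          E.sweedler_counit(1)[OF vector_space_field E.counit_lin a])
    finally show "comul F (proj2 E F (htens E F a b')) =
      sweedler X tscale (htens E F a b') (\<lambda>z1 z2. htens F F (proj2 E F z1) (proj2 E F z2))" by simp
  qed (use that in simp)
  show "counit F (proj2 E F z) = counit X z" if "z \<in> carr X" for z
    by (rule tensor_ext[OF vector_space_field _ counit_X(1), where L = "\<lambda>z. counit F (proj2 E F z)"])
       (use that linear_on_comp[OF proj2(1) F.counit_lin] lin in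
         \<open>auto simp: proj2 counit_X linear_onD[OF F.counit_lin] linear_map_def\<close>)
qed

end

locale cocoalg = coalg T for T :: "('k::field, 't::ab_group_add) hopf" +
  assumes cocommutative: "cocommutative T"

lemma cocoalg_dcp:
  assumes "cocoalg E" "cocoalg F"
  shows "cocoalg (dcp F E l r)"
proof -
  interpret E: cocoalg E by fact
  interpret F: cocoalg F by fact
  interpret coalg2 E F l r ..
  show ?thesis by unfold_locales (rule cocommutative_X[OF E.cocommutative F.cocommutative])
qed

locale pairing = coalg2 E F l r + T: cocoalg T
  for E :: "('k::field, 'a::ab_group_add) hopf" and F :: "('k, 'b::ab_group_add) hopf"
    and l r and T :: "('k, 't::ab_group_add) hopf"
begin

lemma pair_bilin:
  assumes "linear_map T E f" "linear_map T F g"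
  shows "T.bilin tscale (\<lambda>a b. htens E F (f a) (g b))"
  by (rule bilinear_on_linear_maps[OF assms bilinear_on_htens])

lemma pair_linear:
  assumes "linear_map T E f" "linear_map T F g"
  shows "linear_map T X (pair T E F f g)"
proof (rule linear_mapI)
  note b = pair_bilin[OF assms]
  show "linear_on (scal T) (scal X) (carr T) (pair T E F f g)"
    unfolding pair_def using T.sweedler_lin[OF vector_space_tscale b] by simp
  show "pair T E F f g d \<in> carr X" if "d \<in> carr T" for d
    unfolding pair_def using assms
    by (simp add: T.sweedler_in[OF vector_space_tscale subspace_htensor b _ that] htens_in linear_mapD)
qed

lemma pair_apply:
  assumes f: "linear_map T E f" and g: "linear_map T F g" and s: "vector_space s"
    and L: "linear_on tscale s (htensor_space E F) L" and d: "d \<in> carr T"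
  shows "L (pair T E F f g d) = sweedler T s d (\<lambda>a b. L (htens E F (f a) (g b)))"
  unfolding pair_def
  by (rule T.sweedler_apply[OF vector_space_tscale s subspace_htensor L pair_bilin[OF f g] _ d])
     (intro htens_in linear_mapD(1)[OF f] linear_mapD(1)[OF g])

lemma proj1_pair:
  assumes f: "linear_map T E f" and g: "coalgebra_map T F g" and d: "d \<in> carr T"
  shows "proj1 E F (pair T E F f g d) = f d"
proof -
  have "proj1 E F (pair T E F f g d) = sweedler T (scal E) d (\<lambda>a b. scal E (counit T b) (f a))"
    unfolding pair_apply[OF f coalgebra_map_linear[OF g] E.vs proj1(1) d]
    by (rule sweedler_cong) (simp add: proj1 linear_mapD[OF f] coalgebra_mapD[OF g])
  then show ?thesis using T.sweedler_counit(2)[OF E.vs linear_mapD(2)[OF f] d] by simp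
qed

lemma proj2_pair:
  assumes f: "coalgebra_map T E f" and g: "linear_map T F g" and d: "d \<in> carr T"
  shows "proj2 E F (pair T E F f g d) = g d"
proof -
  have "proj2 E F (pair T E F f g d) = sweedler T (scal F) d (\<lambda>a b. scal F (counit T a) (g b))"
    unfolding pair_apply[OF coalgebra_map_linear[OF f] g F.vs proj2(1) d]
    by (rule sweedler_cong) (simp add: proj2 linear_mapD[OF g] coalgebra_mapD[OF f])
  then show ?thesis using T.sweedler_counit(1)[OF F.vs linear_mapD(2)[OF g] d] by simp
qed

text \<open>Comultiplying \<open>f d1\<close> \<otimes> \<open>g d2\<close> produces the factors in
  the order f d11, g d21, f d12, g d22, while the pair of pairs needs f d11, g d12, f d21, g d22.
  The exchange is \<open>shuffle\<close>; this is where cocommutativity of \<open>T\<close>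
  enters.\<close>

lemma pair_map:
  assumes f: "coalgebra_map T E f" and g: "coalgebra_map T F g"
  shows "coalgebra_map T X (pair T E F f g)"
  unfolding coalgebra_map_def
proof (intro conjI ballI)
  note vt = vector_space_tscale
  note lf = coalgebra_map_linear[OF f] and lg = coalgebra_map_linear[OF g]
  note mf = linear_mapD[OF lf] and mg = linear_mapD[OF lg]
  note [simp] = linear_onD[OF mf(2)] linear_onD[OF mg(2)]
  show lp: "linear_map T X (pair T E F f g)" by (rule pair_linear[OF lf lg])
  fix d assume d: "d \<in> carr T"
  have bX: "X.bilin tscale (htens X X)"
    by (intro bilinear_onI linear_onI; simp)
  have lin:
    "F.bilin tscale (\<lambda>b1 b2. htens X X (htens E F a1 b1) (htens E F a2 b2))"
    "E.bilin tscale (\<lambda>a1 a2. htens X X (htens E F a1 b1) (htens E F a2 b2))" for a1 a2 b1 b2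
    by (intro bilinear_onI linear_onI; simp)+
  have linT:
    "T.bilin tscale (\<lambda>a b. htens X X (htens E F (f a) (g c)) (htens E F (f b) (g e)))"
    "T.bilin tscale (\<lambda>c e. htens X X (htens E F (f a) (g c)) (htens E F (f b) (g e)))"
    "T.bilin tscale (\<lambda>c e. htens X X (htens E F (f a) (g b)) (htens E F (f c) (g e)))" for a b c e
    by (intro bilinear_onI linear_onI; simp)+
  have "comul X (pair T E F f g d) = sweedler T tscale d (\<lambda>d1 d2. comul X (htens E F (f d1) (g d2)))"
    by (rule pair_apply[OF lf lg vt comul_X(2) d])
  also have "\<dots> = sweedler T tscale d (\<lambda>d1 d2. sweedler T tscale d1 (\<lambda>a b. sweedler T tscale d2 (\<lambda>c e.
      htens X X (htens E F (f a) (g c)) (htens E F (f b) (g e)))))"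
  proof (rule sweedler_cong)
    fix d1 d2 assume d1: "d1 \<in> carr T" and d2: "d2 \<in> carr T"
    have "comul X (htens E F (f d1) (g d2)) = sweedler X tscale (htens E F (f d1) (g d2)) (htens X X)"
      using d1 d2 by (intro X.comul_sweedler[symmetric]) (simp add: htens_in mf mg)
    also have "\<dots> = sweedler E tscale (f d1) (\<lambda>a1 a2. sweedler F tscale (g d2) (\<lambda>b1 b2.
        htens X X (htens E F a1 b1) (htens E F a2 b2)))"
      by (rule sweedler_X[OF vt bX mf(1)[OF d1] mg(1)[OF d2]])
    also have "\<dots> = sweedler T tscale d1 (\<lambda>a b. sweedler F tscale (g d2) (\<lambda>b1 b2.
        htens X X (htens E F (f a) b1) (htens E F (f b) b2)))"
      by (rule sweedler_cmap[OF T.coalg_axioms E.coalg_axioms vt bilin_sweedler2(1)[OF vt lin mg(1)[OF d2]] d1 f])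
    also have "\<dots> = sweedler T tscale d1 (\<lambda>a b. sweedler T tscale d2 (\<lambda>c e.
        htens X X (htens E F (f a) (g c)) (htens E F (f b) (g e))))"
      by (rule sweedler_cong, rule sweedler_cmap[OF T.coalg_axioms F.coalg_axioms vt lin(1) d2 g])
    finally show "comul X (htens E F (f d1) (g d2)) = sweedler T tscale d1 (\<lambda>a b. sweedler T tscale d2 (\<lambda>c e.
        htens X X (htens E F (f a) (g c)) (htens E F (f b) (g e))))" .
  qed
  also have "\<dots> = sweedler T tscale d (\<lambda>d1 d2. sweedler T tscale d1 (\<lambda>a b. sweedler T tscale d2 (\<lambda>c e.
      htens X X (htens E F (f a) (g b)) (htens E F (f c) (g e)))))"
    by (rule T.shuffle[OF T.cocommutative vt d linT(2,1)])
  also have "\<dots> = sweedler T tscale d (\<lambda>d1 d2. htens X X (pair T E F f g d1) (pair T E F f g d2))"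
  proof (rule sweedler_cong)
    fix d1 d2 assume d1: "d1 \<in> carr T" and d2: "d2 \<in> carr T"
    have "htens X X (pair T E F f g d1) (pair T E F f g d2) =
        sweedler T tscale d1 (\<lambda>a b. htens X X (htens E F (f a) (g b)) (pair T E F f g d2))"
      by (rule pair_apply[OF lf lg vt _ d1, where L = "\<lambda>z. htens X X z (pair T E F f g d2)"])
         (intro linear_onI; simp)
    also have "\<dots> = sweedler T tscale d1 (\<lambda>a b. sweedler T tscale d2 (\<lambda>c e.
        htens X X (htens E F (f a) (g b)) (htens E F (f c) (g e))))"
      by (rule sweedler_cong, rule pair_apply[OF lf lg vt _ d2, where L = "htens X X z" for z])
         (intro linear_onI; simp)
    finally show "sweedler T tscale d1 (\<lambda>a b. sweedler T tscale d2 (\<lambda>c e.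
        htens X X (htens E F (f a) (g b)) (htens E F (f c) (g e)))) =
      htens X X (pair T E F f g d1) (pair T E F f g d2)" by simp
  qed
  finally show "comul X (pair T E F f g d) =
    sweedler T tscale d (\<lambda>d1 d2. htens X X (pair T E F f g d1) (pair T E F f g d2))" .
  have "counit X (pair T E F f g d) = sweedler T (*) d (\<lambda>a b. counit T a * counit T b)"
    unfolding pair_apply[OF lf lg vector_space_field counit_X(1) d]
    by (rule sweedler_cong) (simp add: counit_X mf mg coalgebra_mapD[OF f] coalgebra_mapD[OF g])
  also have "\<dots> = counit T d"
    by (rule T.sweedler_counit(1)[OF vector_space_field T.counit_lin d])
  finally show "counit X (pair T E F f g d) = counit T d" .
qed

end

lemma pair_cong:
  assumes "\<And>x. x \<in> carr T \<Longrightarrow> f x = f' x" "\<And>x. x \<in> carr T \<Longrightarrow> g x = g' x"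
  shows "pair T E F f g d = pair T E F f' g' d"
  unfolding pair_def by (rule sweedler_cong) (simp add: assms)

lemma pair_comp:
  assumes "coalg S" "coalg T" and h: "coalgebra_map S T h"
    and f: "linear_map T E f" and g: "linear_map T F g" and d: "d \<in> carr S"
  shows "pair T E F f g (h d) = pair S E F (\<lambda>x. f (h x)) (\<lambda>x. g (h x)) d"
  unfolding pair_def
  by (rule sweedler_cmap[OF assms(1,2) vector_space_tscale _ d h])
     (rule bilinear_on_linear_maps[OF f g bilinear_on_htens])

context coalg2
begin

text \<open>The two projections of a \<otimes> b recover \<open>a\<close> and \<open>b\<close>,
  since the counit law removes the discarded part of each coproduct. An expression in two
  independent variables thereby becomes a Sweedler sum over one element, which is what convolution
  computes.\<close>

lemma sweedler_proj:
  assumes s: "vector_space s" and a: "a \<in> carr E" and b: "b \<in> carr F"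
    and \<Phi>: "bilinear_on (scal E) (scal F) s (carr E) (carr F) \<Phi>"
  shows "sweedler X s (htens E F a b) (\<lambda>z1 z2. \<Phi> (proj1 E F z1) (proj2 E F z2)) = \<Phi> a b"
proof -
  note p1 = coalgebra_map_linear[OF proj1_map] and p2 = coalgebra_map_linear[OF proj2_map]
  interpret s: vector_space s by fact
  have l: "linear_on (scal F) s (carr F) (\<lambda>b. \<Phi> a b)" if "a \<in> carr E" for a
    using \<Phi> that by (auto simp: bilinear_on_def)
  have l': "linear_on (scal E) s (carr E) (\<lambda>a. \<Phi> a b)"
    using \<Phi> b by (auto simp: bilinear_on_def)
  have "sweedler X s (htens E F a b) (\<lambda>z1 z2. \<Phi> (proj1 E F z1) (proj2 E F z2)) =
    sweedler E s a (\<lambda>a1 a2. sweedler F s b (\<lambda>b1 b2. s (counit F b1) (\<Phi> (scal E (counit E a2) a1) b2)))"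
    unfolding sweedler_X[OF s bilinear_on_linear_maps[OF p1 p2 \<Phi>] a b]
    by (intro sweedler_cong) (use \<Phi> in \<open>simp add: proj1 proj2 bilinear_on_def linear_on_def mult.commute\<close>)
  also have "\<dots> = sweedler E s a (\<lambda>a1 a2. s (counit E a2) (\<Phi> a1 b))"
    by (rule sweedler_cong, rule F.sweedler_counit(1)[OF s l b, THEN trans])
       (simp_all add: linear_onD(2)[OF l'])
  also have "\<dots> = \<Phi> a b" by (rule E.sweedler_counit(2)[OF s l' a])
  finally show ?thesis .
qed

lemma pair_proj:
  assumes "linear_map E E' f" "linear_map F F' g" "a \<in> carr E" "b \<in> carr F"
  shows "pair X E' F' (\<lambda>z. f (proj1 E F z)) (\<lambda>z. g (proj2 E F z)) (htens E F a b) = htens E' F' (f a) (g b)"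
  unfolding pair_def
  by (rule sweedler_proj[OF vector_space_tscale assms(3,4), where \<Phi> = "\<lambda>a b. htens E' F' (f a) (g b)"])
     (rule bilinear_on_linear_maps[OF assms(1,2) bilinear_on_htens])

end

section \<open>Convolution groups\<close>

context coalg2
begin

text \<open>Only the first Sweedler factor is projected here, so the counit absorbs the coproduct of
  \<open>b\<close> and \<open>a\<close> alone stays duplicated.\<close>

lemma sweedler_proj1:
  assumes s: "vector_space s" and a: "a \<in> carr E" and b: "b \<in> carr F"
    and \<Phi>: "bilinear_on (scal E) tscale s (carr E) (htensor_space E F) \<Phi>"
  shows "sweedler X s (htens E F a b) (\<lambda>z1 z2. \<Phi> (proj1 E F z1) z2) =
    sweedler E s a (\<lambda>a1 a2. \<Phi> a1 (htens E F a2 b))"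
proof -
  have "linear_map X X (\<lambda>z. z)" by (simp add: linear_map_def linear_on_def)
  then have bX: "X.bilin s (\<lambda>z1 z2. \<Phi> (proj1 E F z1) z2)"
    using bilinear_on_linear_maps[OF coalgebra_map_linear[OF proj1_map]] \<Phi> by fastforce
  note \<Phi>l = linear_onD[OF bilinear_onD(1)[OF \<Phi>]] and \<Phi>r = linear_onD[OF bilinear_onD(2)[OF \<Phi>]]
  have l: "linear_on (scal F) s (carr F) (\<lambda>b. \<Phi> a1 (htens E F a2 b))"
    if "a1 \<in> carr E" "a2 \<in> carr E" for a1 a2
    by (intro linear_onI) (use that in \<open>simp_all add: \<Phi>r htens_in\<close>)
  show ?thesis
    unfolding sweedler_X[OF s bX a b]
  proof (rule sweedler_cong)
    fix a1 a2 assume *: "a1 \<in> carr E" "a2 \<in> carr E"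
    have "sweedler F s b (\<lambda>b1 b2. \<Phi> (proj1 E F (htens E F a1 b1)) (htens E F a2 b2)) =
        sweedler F s b (\<lambda>b1 b2. s (counit F b1) (\<Phi> a1 (htens E F a2 b2)))"
      by (rule sweedler_cong) (simp add: * proj1 \<Phi>l htens_in)
    also have "\<dots> = \<Phi> a1 (htens E F a2 b)"
      by (rule F.sweedler_counit(1)[OF s l[OF *] b])
    finally show "sweedler F s b (\<lambda>b1 b2. \<Phi> (proj1 E F (htens E F a1 b1)) (htens E F a2 b2)) = \<Phi> a1 (htens E F a2 b)" .
  qed
qed

lemma sweedler_proj2:
  assumes s: "vector_space s" and a: "a \<in> carr E" and b: "b \<in> carr F"
    and \<Phi>: "bilinear_on (scal F) tscale s (carr F) (htensor_space E F) \<Phi>"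
  shows "sweedler X s (htens E F a b) (\<lambda>z1 z2. \<Phi> (proj2 E F z1) z2) =
    sweedler F s b (\<lambda>b1 b2. \<Phi> b1 (htens E F a b2))"
proof -
  have "linear_map X X (\<lambda>z. z)" by (simp add: linear_map_def linear_on_def)
  then have bX: "X.bilin s (\<lambda>z1 z2. \<Phi> (proj2 E F z1) z2)"
    using bilinear_on_linear_maps[OF coalgebra_map_linear[OF proj2_map]] \<Phi> by fastforce
  note \<Phi>l = linear_onD[OF bilinear_onD(1)[OF \<Phi>]] and \<Phi>r = linear_onD[OF bilinear_onD(2)[OF \<Phi>]]
  have b': "F.bilin s (\<lambda>b1 b2. \<Phi> b1 (htens E F a b2))" if "a \<in> carr E" for a
    by (intro bilinear_onI linear_onI) (use that in \<open>simp_all add: \<Phi>l \<Phi>r htens_in\<close>)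
  have l: "linear_on (scal E) s (carr E) (\<lambda>a. sweedler F s b (\<lambda>b1 b2. \<Phi> b1 (htens E F a b2)))"
    by (rule F.sweedler_param[OF s E.vs E.sub b' _ b]) (auto intro!: linear_onI simp: \<Phi>l \<Phi>r htens_in)
  have "sweedler X s (htens E F a b) (\<lambda>z1 z2. \<Phi> (proj2 E F z1) z2) =
    sweedler E s a (\<lambda>a1 a2. sweedler F s b (\<lambda>b1 b2. s (counit E a1) (\<Phi> b1 (htens E F a2 b2))))"
    unfolding sweedler_X[OF s bX a b]
    by (intro sweedler_cong) (simp add: proj2 \<Phi>l htens_in)
  also have "\<dots> = sweedler E s a (\<lambda>a1 a2. s (counit E a1) (sweedler F s b (\<lambda>b1 b2. \<Phi> b1 (htens E F a2 b2))))"
  proof (rule sweedler_cong)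
    fix a1 a2 assume *: "a1 \<in> carr E" "a2 \<in> carr E"
    interpret s: vector_space s by fact
    show "sweedler F s b (\<lambda>b1 b2. s (counit E a1) (\<Phi> b1 (htens E F a2 b2))) =
      s (counit E a1) (sweedler F s b (\<lambda>b1 b2. \<Phi> b1 (htens E F a2 b2)))"
      by (rule F.sweedler_apply[OF s s s.subspace_UNIV _ b'[OF *(2)] _ b, symmetric])
         (auto intro!: linear_onI simp: s.scale_right_distrib mult.commute)
  qed
  also have "\<dots> = sweedler F s b (\<lambda>b1 b2. \<Phi> b1 (htens E F a b2))"
    by (rule E.sweedler_counit(1)[OF s l a])
  finally show ?thesis .
qed

end

section \<open>Convolution of coalgebra maps into a Hopf algebra\<close>

definition conv ::
  "('k::field, 'h::ab_group_add) hopf \<Rightarrow> ('k, 't::ab_group_add) hopf \<Rightarrow> ('t \<Rightarrow> 'h) \<Rightarrow> ('t \<Rightarrow> 'h) \<Rightarrow> 't \<Rightarrow> 'h"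
  where "conv H T f g = (\<lambda>d\<in>carr T. sweedler T (scal H) d (\<lambda>a b. mul H (f a) (g b)))"

text \<open>The maps are made extensional, so that equality in the group is equality on \<open>carr T\<close>.\<close>

definition gen ::
  "('k::field, 'h::ab_group_add) hopf \<Rightarrow> ('k, 't::ab_group_add) hopf \<Rightarrow> ('t \<Rightarrow> 'h) monoid"
  where "gen H T = \<lparr> carrier = {f. coalgebra_map T H f \<and> f \<in> extensional (carr T)}, mult = conv H T,
    one = (\<lambda>d\<in>carr T. scal H (counit T d) (unt H)) \<rparr>"

locale cocommutative_hopf =
  fixes H :: "('k::field, 'h::ab_group_add) hopf"
  assumes hopf: "hopf_algebra H" and cocomm: "cocommutative H"
begin

lemma bialg: "bialgebra H" and alg: "algebra H" and coalg: "coalgebra H"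
  using hopf by (auto simp: hopf_algebra_def bialgebra_def)

sublocale H: cocoalg H
  by unfold_locales (rule coalg, rule cocomm)

abbreviation HH where "HH \<equiv> dcp H H undefined undefined"

sublocale HH: coalg2 H H undefined undefined ..

lemma HH_cocoalg: "cocoalg HH" by (rule cocoalg_dcp) unfold_locales

lemma mul_in [simp]: "x \<in> carr H \<Longrightarrow> y \<in> carr H \<Longrightarrow> mul H x y \<in> carr H"
  and mul_bilinear: "H.bilin (scal H) (mul H)"
  and mul_assoc: "x \<in> carr H \<Longrightarrow> y \<in> carr H \<Longrightarrow> z \<in> carr H \<Longrightarrow> mul H (mul H x y) z = mul H x (mul H y z)"
  and unt_in [simp]: "unt H \<in> carr H"
  and unt_left [simp]: "x \<in> carr H \<Longrightarrow> mul H (unt H) x = x"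
  and unt_right [simp]: "x \<in> carr H \<Longrightarrow> mul H x (unt H) = x"
  using alg by (auto simp: algebra_def)

lemma mul_lin:
  shows "y \<in> carr H \<Longrightarrow> linear_on (scal H) (scal H) (carr H) (\<lambda>x. mul H x y)"
    "x \<in> carr H \<Longrightarrow> linear_on (scal H) (scal H) (carr H) (\<lambda>y. mul H x y)"
  using mul_bilinear by (auto simp: bilinear_on_def)

lemmas mul_linD [simp] = linear_onD[OF mul_lin(1)] linear_onD[OF mul_lin(2)]

lemma antip_linear: "linear_map H H (antip H)"
  and antip_left: "x \<in> carr H \<Longrightarrow> sweedler H (scal H) x (\<lambda>x1 x2. mul H (antip H x1) x2) = scal H (counit H x) (unt H)"
  and antip_right: "x \<in> carr H \<Longrightarrow> sweedler H (scal H) x (\<lambda>x1 x2. mul H x1 (antip H x2)) = scal H (counit H x) (unt H)"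
  using hopf by (auto simp: hopf_algebra_def)

lemma conv_bilin:
  assumes "linear_map T H f" "linear_map T H g"
  shows "bilinear_on (scal T) (scal T) (scal H) (carr T) (carr T) (\<lambda>a b. mul H (f a) (g b))"
  by (rule bilinear_on_linear_maps[OF assms mul_bilinear])

definition mulm where "mulm = hlift H H (scal H) (mul H)"

lemma mulm_htens: "x \<in> carr H \<Longrightarrow> y \<in> carr H \<Longrightarrow> mulm (htens H H x y) = mul H x y"
  and mulm_lin: "linear_on tscale (scal H) (htensor_space H H) mulm"
  using HH.hlift[OF H.vs mul_bilinear] by (simp_all add: mulm_def)

text \<open>On elementary tensors, the compatibility of product and coproduct in a bialgebra says
  precisely that multiplication is a coalgebra map on H \<otimes> H.\<close>

lemma mulm_map: "coalgebra_map HH H mulm"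
  unfolding coalgebra_map_def
proof (intro conjI ballI)
  note vt = vector_space_tscale
  show lin: "linear_map HH H mulm"
    by (rule linear_mapI)
       (use HH.tensor_in[OF H.vs H.sub mulm_lin] mulm_lin in \<open>auto simp: mulm_htens\<close>)
  have b: "HH.X.bilin tscale (\<lambda>z1 z2. htens H H (mulm z1) (mulm z2))"
    by (rule bilinear_on_linear_maps[OF lin lin bilinear_on_htens])
  show "comul H (mulm z) = sweedler HH tscale z (\<lambda>z1 z2. htens H H (mulm z1) (mulm z2))"
    if "z \<in> carr HH" for z
  proof (rule HH.tensor_ext[OF vt, where L = "\<lambda>z. comul H (mulm z)" and
      L' = "\<lambda>z. sweedler HH tscale z (\<lambda>z1 z2. htens H H (mulm z1) (mulm z2))"])
    show "linear_on tscale tscale (htensor_space H H) (\<lambda>z. comul H (mulm z))"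
      using linear_on_comp[OF mulm_lin H.comul_lin] lin by (simp add: linear_map_def)
    show "linear_on tscale tscale (htensor_space H H) (\<lambda>z. sweedler HH tscale z (\<lambda>z1 z2. htens H H (mulm z1) (mulm z2)))"
      using HH.X.sweedler_lin[OF vt b] by simp
    fix x y assume x: "x \<in> carr H" and y: "y \<in> carr H"
    have "comul H (mulm (htens H H x y)) = sweedler H tscale x (\<lambda>x1 x2. sweedler H tscale y
         (\<lambda>y1 y2. htens H H (mul H x1 y1) (mul H x2 y2)))"
      using bialg x y by (simp add: bialgebra_def mulm_htens)
    also have "\<dots> = sweedler HH tscale (htens H H x y) (\<lambda>z1 z2. htens H H (mulm z1) (mulm z2))"
      unfolding HH.sweedler_X[OF vt b x y] by (intro sweedler_cong) (simp add: mulm_htens)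
    finally show "comul H (mulm (htens H H x y)) =
      sweedler HH tscale (htens H H x y) (\<lambda>z1 z2. htens H H (mulm z1) (mulm z2))" .
  qed (use that in simp)
  show "counit H (mulm z) = counit HH z" if "z \<in> carr HH" for z
    by (rule HH.tensor_ext[OF vector_space_field _ HH.counit_X(1), where L = "\<lambda>z. counit H (mulm z)"])
       (use that linear_on_comp[OF mulm_lin H.counit_lin] lin bialg in
         \<open>auto simp: mulm_htens HH.counit_X linear_map_def bialgebra_def\<close>)
qed

text \<open>For coalgebra maps \<open>f\<close> and \<open>g\<close> this writes their convolution
  as a composite of coalgebra maps, so that closure under convolution is immediate.\<close>

lemma conv_mulm:
  assumes "cocoalg T" "linear_map T H f" "linear_map T H g" "d \<in> carr T"
  shows "conv H T f g d = mulm (pair T H H f g d)"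
proof -
  interpret T: cocoalg T by fact
  interpret P: pairing H H undefined undefined T ..
  have "mulm (pair T H H f g d) = sweedler T (scal H) d (\<lambda>a b. mul H (f a) (g b))"
    unfolding P.pair_apply[OF assms(2,3) H.vs mulm_lin assms(4)]
    by (rule sweedler_cong) (simp add: mulm_htens assms linear_mapD[OF assms(2)] linear_mapD[OF assms(3)])
  then show ?thesis using assms(4) by (simp add: conv_def)
qed

lemma conv_linear:
  assumes "cocoalg T" "linear_map T H f" "linear_map T H g"
  shows "linear_map T H (conv H T f g)"
proof -
  interpret T: cocoalg T by fact
  note b = conv_bilin[OF assms(2,3)]
  show ?thesis
  proof (rule linear_mapI)
    show "linear_on (scal T) (scal H) (carr T) (conv H T f g)"
      by (rule linear_on_cong[OF T.sweedler_lin[OF H.vs b] T.sub T.vs]) (simp add: conv_def)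
    show "conv H T f g x \<in> carr H" if "x \<in> carr T" for x
      using T.sweedler_in[OF H.vs H.sub b _ that] assms that
      by (simp add: conv_def linear_mapD)
  qed
qed

lemma conv_map:
  assumes "cocoalg T" "coalgebra_map T H f" "coalgebra_map T H g"
  shows "coalgebra_map T H (conv H T f g)"
proof -
  interpret T: cocoalg T by fact
  interpret P: pairing H H undefined undefined T ..
  have "coalgebra_map T H (\<lambda>d. mulm (pair T H H f g d))"
    by (rule coalgebra_map_comp[OF T.coalg_axioms HH.X.coalg_axioms P.pair_map[OF assms(2,3)] mulm_map])
  then show ?thesis
    by (rule coalgebra_map_cong[OF T.coalg_axioms])
       (simp add: conv_mulm[OF assms(1) assms(2,3)[THEN coalgebra_map_linear]])
qed

lemma conv_assoc:
  assumes "cocoalg T" "linear_map T H f" "linear_map T H g" "linear_map T H h"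
  shows "conv H T (conv H T f g) h = conv H T f (conv H T g h)"
proof
  fix d
  interpret T: cocoalg T by fact
  note m = linear_mapD[OF assms(2)] linear_mapD[OF assms(3)] linear_mapD[OF assms(4)]
  note [simp] = m(1,3,5) linear_onD[OF m(2)] linear_onD[OF m(4)] linear_onD[OF m(6)]
  show "conv H T (conv H T f g) h d = conv H T f (conv H T g h) d"
  proof (cases "d \<in> carr T")
    case d: True
    have t: "T.trilin (scal H) (\<lambda>a b c. mul H (mul H (f a) (g b)) (h c))"
      unfolding trilinear_on_def by (intro conjI ballI bilinear_onI linear_onI; simp)
    have "conv H T (conv H T f g) h d = sweedler T (scal H) d (\<lambda>a b.
        mul H (sweedler T (scal H) a (\<lambda>c e. mul H (f c) (g e))) (h b))"
      using d by (simp add: conv_def cong: sweedler_cong)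
    also have "\<dots> = sweedler T (scal H) d (\<lambda>a b. sweedler T (scal H) a (\<lambda>c e. mul H (mul H (f c) (g e)) (h b)))"
      by (rule sweedler_cong, rule T.sweedler_apply[OF H.vs H.vs H.sub _ conv_bilin[OF assms(2,3)], where L = "\<lambda>x. mul H x y" for y])
         (simp_all add: mul_lin)
    also have "\<dots> = sweedler T (scal H) d (\<lambda>a b. sweedler T (scal H) b (\<lambda>c e. mul H (mul H (f a) (g c)) (h e)))"
      by (rule T.coassoc[OF H.vs t d])
    also have "\<dots> = sweedler T (scal H) d (\<lambda>a b. sweedler T (scal H) b (\<lambda>c e. mul H (f a) (mul H (g c) (h e))))"
      by (intro sweedler_cong) (simp add: mul_assoc)
    also have "\<dots> = sweedler T (scal H) d (\<lambda>a b. mul H (f a) (sweedler T (scal H) b (\<lambda>c e. mul H (g c) (h e))))"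
      by (rule sweedler_cong, rule T.sweedler_apply[OF H.vs H.vs H.sub _ conv_bilin[OF assms(3,4)], where L = "\<lambda>x. mul H y x" for y, symmetric])
         (simp_all add: mul_lin)
    also have "\<dots> = conv H T f (conv H T g h) d"
      using d by (simp add: conv_def cong: sweedler_cong)
    finally show ?thesis .
  qed (simp add: conv_def)
qed

abbreviation eta where "eta T \<equiv> \<lambda>d\<in>carr T. scal H (counit T d) (unt H)"

lemma counit_unt [simp]: "counit H (unt H) = 1"
  and comul_unt: "comul H (unt H) = htens H H (unt H) (unt H)"
  using bialg by (simp_all add: bialgebra_def)

lemma eta_map:
  assumes "cocoalg T"
  shows "coalgebra_map T H (eta T)"
proof -
  interpret T: cocoalg T by fact
  note vt = vector_space_tscale
  note [simp] = linear_onD[OF T.counit_lin]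
  have lin: "linear_map T H (eta T)"
    by (intro linear_mapI linear_onI; simp add: H.V.scale_left_distrib)
  have "comul H (eta T d) = sweedler T tscale d (\<lambda>a b. htens H H (eta T a) (eta T b))" if d: "d \<in> carr T" for d
  proof -
    have e: "T.bilin (*) (\<lambda>a1 a2. counit T a1 * counit T a2)"
      by (intro bilinear_onI linear_onI; simp add: algebra_simps)
    have l: "linear_on (*) tscale UNIV (\<lambda>c. tscale c t)" for t :: "('k, 'h, 'h) tensor"
      by (intro linear_onI; simp add: tscale_def fun_eq_iff algebra_simps)
    interpret K: vector_space "(*) :: 'k \<Rightarrow> _" by (rule vector_space_field)
    have "comul H (eta T d) = tscale (counit T d) (htens H H (unt H) (unt H))"
      using d by (simp add: linear_onD[OF H.comul_lin] comul_unt)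
    also have "\<dots> = tscale (sweedler T (*) d (\<lambda>a b. counit T a * counit T b)) (htens H H (unt H) (unt H))"
      using T.sweedler_counit(1)[OF vector_space_field T.counit_lin d] by simp
    also have "\<dots> = sweedler T tscale d (\<lambda>a b. tscale (counit T a * counit T b) (htens H H (unt H) (unt H)))"
      by (rule T.sweedler_apply[OF vector_space_field vt K.subspace_UNIV l e _ d]) simp
    also have "\<dots> = sweedler T tscale d (\<lambda>a b. htens H H (eta T a) (eta T b))"
      by (rule sweedler_cong) (simp add: tscale_tscale mult.commute)
    finally show ?thesis .
  qed
  moreover have "counit H (eta T d) = counit T d" if "d \<in> carr T" for d
    using that by (simp add: linear_onD[OF H.counit_lin])
  ultimately show ?thesis using lin unfolding coalgebra_map_def by blast
qed

lemma eta_conv: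
  assumes "cocoalg T" "linear_map T H f" "f \<in> extensional (carr T)"
  shows "conv H T (eta T) f = f" "conv H T f (eta T) = f"
proof -
  interpret T: cocoalg T by fact
  note m = linear_mapD[OF assms(2)]
  have "conv H T (eta T) f d = f d" for d
  proof (cases "d \<in> carr T")
    case True
    have "conv H T (eta T) f d = sweedler T (scal H) d (\<lambda>a b. scal H (counit T a) (f b))"
      using True unfolding conv_def by (simp, intro sweedler_cong) (simp add: m)
    then show ?thesis using T.sweedler_counit(1)[OF H.vs m(2) True] by simp
  qed (use assms(3) in \<open>simp add: conv_def extensional_def\<close>)
  moreover have "conv H T f (eta T) d = f d" for d
  proof (cases "d \<in> carr T")
    case True
    have "conv H T f (eta T) d = sweedler T (scal H) d (\<lambda>a b. scal H (counit T b) (f a))"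
      using True unfolding conv_def by (simp, intro sweedler_cong) (simp add: m)
    then show ?thesis using T.sweedler_counit(2)[OF H.vs m(2) True] by simp
  qed (use assms(3) in \<open>simp add: conv_def extensional_def\<close>)
  ultimately show "conv H T (eta T) f = f" "conv H T f (eta T) = f" by auto
qed

end

lemma coalgebra_map_inverse:
  assumes "coalg D" "coalg E" and f: "coalgebra_map D E f" and g: "linear_map E D g"
    and gf: "\<And>x. x \<in> carr D \<Longrightarrow> g (f x) = x" and fg: "\<And>y. y \<in> carr E \<Longrightarrow> f (g y) = y"
  shows "coalgebra_map E D g"
  unfolding coalgebra_map_def
proof (intro conjI ballI g)
  interpret D: coalg D by fact
  interpret E: coalg E by fact
  fix y assume y: "y \<in> carr E"
  then have x: "g y \<in> carr D" by (rule linear_mapD(1)[OF g])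
  have "sweedler E tscale (f (g y)) (\<lambda>a b. htens D D (g a) (g b)) =
      sweedler D tscale (g y) (\<lambda>a b. htens D D (g (f a)) (g (f b)))"
    by (rule sweedler_cmap[OF assms(1,2) vector_space_tscale _ x f])
       (rule bilinear_on_linear_maps[OF g g bilinear_on_htens])
  also have "\<dots> = sweedler D tscale (g y) (htens D D)"
    by (rule sweedler_cong) (simp add: gf)
  finally show "comul D (g y) = sweedler E tscale y (\<lambda>a b. htens D D (g a) (g b))"
    by (simp add: D.comul_sweedler x fg y)
  show "counit D (g y) = counit E y"
    using coalgebra_mapD(4)[OF f x] by (simp add: fg y)
qed

lemma linear_map_comp: "linear_map D E f \<Longrightarrow> linear_map E F g \<Longrightarrow> linear_map D F (\<lambda>x. g (f x))"
  by (auto simp: linear_map_def linear_on_def image_subset_iff)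

lemma linear_map_id: "linear_map D D (\<lambda>x. x)"
  by (simp add: linear_map_def linear_on_def)

context cocommutative_hopf
begin

text \<open>
  The antipode is a coalgebra map because \<open>twist antip\<close> is the inverse of \<open>twist id\<close>, which is
  the coalgebra map \<open>x \<otimes> y \<mapsto> x\<^sub>1 \<otimes> x\<^sub>2 y\<close>.
\<close>

definition twist where
  "twist \<theta> = hlift H H tscale (\<lambda>a b. sweedler H tscale a (\<lambda>a1 a2. htens H H a1 (mul H (\<theta> a2) b)))"

lemma twist:
  assumes "linear_map H H \<theta>"
  shows "linear_map HH HH (twist \<theta>)"
    and "a \<in> carr H \<Longrightarrow> b \<in> carr H \<Longrightarrow>
      twist \<theta> (htens H H a b) = sweedler H tscale a (\<lambda>a1 a2. htens H H a1 (mul H (\<theta> a2) b))"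
    and "b \<in> carr H \<Longrightarrow> H.bilin tscale (\<lambda>a1 a2. htens H H a1 (mul H (\<theta> a2) b))"
proof -
  note vt = vector_space_tscale
  note m = linear_mapD[OF assms]
  note [simp] = m(1) linear_onD[OF m(2)]
  show b: "H.bilin tscale (\<lambda>a1 a2. htens H H a1 (mul H (\<theta> a2) b))" if "b \<in> carr H" for b
    by (intro bilinear_onI linear_onI; simp add: that)
  have "bilinear_on (scal H) (scal H) tscale (carr H) (carr H)
      (\<lambda>a b. sweedler H tscale a (\<lambda>a1 a2. htens H H a1 (mul H (\<theta> a2) b)))"
    by (intro bilinear_onI H.sweedler_lin H.sweedler_param vt H.vs H.sub b; (intro linear_onI)?; simp)
  note l = HH.hlift[OF vt this, folded twist_def]
  show e: "a \<in> carr H \<Longrightarrow> b \<in> carr H \<Longrightarrow>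
      twist \<theta> (htens H H a b) = sweedler H tscale a (\<lambda>a1 a2. htens H H a1 (mul H (\<theta> a2) b))" for a b
    by (rule l)
  show "linear_map HH HH (twist \<theta>)"
  proof (rule linear_mapI)
    show "linear_on (scal HH) (scal HH) (carr HH) (twist \<theta>)" using l(1) by simp
    show "twist \<theta> z \<in> carr HH" if "z \<in> carr HH" for z
      using that HH.tensor_in[OF vt subspace_htensor l(1)]
      by (simp add: e H.sweedler_in[OF vt subspace_htensor b] htens_in)
  qed
qed

text \<open>Coassociativity brings the two inserted factors next to each other, where the
  convolution of \<open>\<theta>\<close> and \<open>\<eta>\<close> collapses to the counit. Used in
  both orders, it shows that the twists by the identity and by the antipode are mutually
  inverse.\<close>

lemma twist_twist:
  assumes \<theta>: "linear_map H H \<theta>" and \<eta>: "linear_map H H \<eta>"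
    and inv: "\<And>x. x \<in> carr H \<Longrightarrow> sweedler H (scal H) x (\<lambda>a b. mul H (\<theta> a) (\<eta> b)) = scal H (counit H x) (unt H)"
    and z: "z \<in> carr HH"
  shows "twist \<theta> (twist \<eta> z) = z"
proof -
  note vt = vector_space_tscale
  note t\<theta> = twist[OF \<theta>] and t\<eta> = twist[OF \<eta>]
  note m = linear_mapD[OF \<theta>] linear_mapD[OF \<eta>]
  note [simp] = m(1,3) linear_onD[OF m(2)] linear_onD[OF m(4)]
  show ?thesis
  proof (rule HH.tensor_ext[OF vt, where L = "\<lambda>z. twist \<theta> (twist \<eta> z)" and L' = "\<lambda>z. z"])
    show "linear_on tscale tscale (htensor_space H H) (\<lambda>z. twist \<theta> (twist \<eta> z))"
      using linear_mapD(2)[OF linear_map_comp[OF t\<eta>(1) t\<theta>(1)]] by simp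
    fix a b assume a: "a \<in> carr H" and b: "b \<in> carr H"
    have tri: "H.trilin tscale (\<lambda>c d a2. htens H H c (mul H (\<theta> d) (mul H (\<eta> a2) b)))"
      unfolding trilinear_on_def by (intro conjI ballI bilinear_onI linear_onI; simp add: b)
    have "twist \<theta> (twist \<eta> (htens H H a b)) =
        sweedler H tscale a (\<lambda>a1 a2. twist \<theta> (htens H H a1 (mul H (\<eta> a2) b)))"
      unfolding t\<eta>(2)[OF a b]
      by (rule H.sweedler_apply[OF vt vt subspace_htensor _ t\<eta>(3)[OF b] _ a])
         (use linear_mapD(2)[OF t\<theta>(1)] b in \<open>auto intro!: htens_in\<close>)
    also have "\<dots> = sweedler H tscale a (\<lambda>a1 a2. sweedler H tscale a1 (\<lambda>c d. htens H H c (mul H (\<theta> d) (mul H (\<eta> a2) b))))"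
      by (rule sweedler_cong) (simp add: t\<theta>(2) b)
    also have "\<dots> = sweedler H tscale a (\<lambda>a1 a'. sweedler H tscale a' (\<lambda>d a2. htens H H a1 (mul H (\<theta> d) (mul H (\<eta> a2) b))))"
      by (rule H.coassoc[OF vt tri a])
    also have "\<dots> = sweedler H tscale a (\<lambda>a1 a'. tscale (counit H a') (htens H H a1 b))"
    proof (rule sweedler_cong)
      fix a1 a' assume *: "a1 \<in> carr H" "a' \<in> carr H"
      have "sweedler H tscale a' (\<lambda>d a2. htens H H a1 (mul H (\<theta> d) (mul H (\<eta> a2) b))) =
        sweedler H tscale a' (\<lambda>d a2. htens H H a1 (mul H (mul H (\<theta> d) (\<eta> a2)) b))"
        by (rule sweedler_cong) (simp add: mul_assoc b)
      also have "\<dots> = htens H H a1 (mul H (sweedler H (scal H) a' (\<lambda>d a2. mul H (\<theta> d) (\<eta> a2))) b)"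
        by (rule H.sweedler_apply[OF H.vs vt H.sub _ conv_bilin[OF \<theta> \<eta>] _ *(2), symmetric,
              where L = "\<lambda>x. htens H H a1 (mul H x b)"])
           (auto intro!: linear_onI simp: b)
      finally show "sweedler H tscale a' (\<lambda>d a2. htens H H a1 (mul H (\<theta> d) (mul H (\<eta> a2) b))) =
        tscale (counit H a') (htens H H a1 b)"
        using * b by (simp add: inv)
    qed
    also have "\<dots> = htens H H a b"
      by (rule H.sweedler_counit(2)[OF vt _ a]) (intro linear_onI; simp)
    finally show "twist \<theta> (twist \<eta> (htens H H a b)) = htens H H a b" .
  qed (use z in \<open>simp_all add: linear_on_def\<close>)
qed

text \<open>The map is the pair of the first projection and multiplication, two coalgebra maps on H
  \<otimes> H.\<close>

lemma twist_id_map: "coalgebra_map HH HH (twist (\<lambda>x. x))"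
proof -
  interpret T: cocoalg HH by (rule HH_cocoalg)
  interpret P: pairing H H undefined undefined HH ..
  note vt = vector_space_tscale
  note t = twist[OF linear_map_id]
  have p: "coalgebra_map HH HH (pair HH H H (proj1 H H) mulm)"
    by (rule P.pair_map[OF HH.proj1_map mulm_map])
  have "pair HH H H (proj1 H H) mulm z = twist (\<lambda>x. x) z" if "z \<in> carr HH" for z
  proof (rule HH.tensor_ext[OF vt, where L = "pair HH H H (proj1 H H) mulm" and L' = "twist (\<lambda>x. x)"])
    show "linear_on tscale tscale (htensor_space H H) (pair HH H H (proj1 H H) mulm)"
      using coalgebra_mapD(2)[OF p] by simp
    show "linear_on tscale tscale (htensor_space H H) (twist (\<lambda>x. x))"
      using linear_mapD(2)[OF t(1)] by simp
    fix a b assume a: "a \<in> carr H" and b: "b \<in> carr H"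
    have "pair HH H H (proj1 H H) mulm (htens H H a b) = sweedler H tscale a (\<lambda>a1 a2. htens H H a1 (mulm (htens H H a2 b)))"
      unfolding pair_def
      by (rule HH.sweedler_proj1[OF vt a b, where \<Phi> = "\<lambda>a z. htens H H a (mulm z)"])
         (intro bilinear_onI linear_onI; simp add: linear_onD[OF mulm_lin])
    also have "\<dots> = twist (\<lambda>x. x) (htens H H a b)"
      unfolding t(2)[OF a b] by (rule sweedler_cong) (simp add: mulm_htens b)
    finally show "pair HH H H (proj1 H H) mulm (htens H H a b) = twist (\<lambda>x. x) (htens H H a b)" .
  qed (use that in simp)
  then show ?thesis by (rule coalgebra_map_cong[OF HH.X.coalg_axioms p])
qed

text \<open>\<open>antip H x\<close> is the second component of \<open>twist (antip H)\<close> at x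
  \<otimes> 1, and x \<mapsto> x \<otimes> 1 is the pair of the identity and the convolution unit.
  The antipode is therefore a composite of coalgebra maps.\<close>

lemma antip_map: "coalgebra_map H H (antip H)"
proof -
  interpret P: pairing H H undefined undefined H ..
  note vt = vector_space_tscale
  note ti = twist[OF linear_map_id] and ta = twist[OF antip_linear]
  note m = linear_mapD[OF antip_linear]
  have tm: "coalgebra_map HH HH (twist (antip H))"
    by (rule coalgebra_map_inverse[OF HH.X.coalg_axioms HH.X.coalg_axioms twist_id_map ta(1)])
       (rule twist_twist[OF antip_linear linear_map_id antip_left] twist_twist[OF linear_map_id antip_linear antip_right]; assumption)+
  have e: "coalgebra_map H H (eta H)" by (rule eta_map) unfold_locales
  have i: "coalgebra_map H H (\<lambda>x. x)" by (rule coalgebra_map_id) unfold_locales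
  have pm: "coalgebra_map H HH (pair H H H (\<lambda>x. x) (eta H))"
    by (rule P.pair_map[OF i e])
  have "coalgebra_map H H (\<lambda>x. proj2 H H (twist (antip H) (pair H H H (\<lambda>x. x) (eta H) x)))"
    by (rule coalgebra_map_comp[OF H.coalg_axioms HH.X.coalg_axioms
          coalgebra_map_comp[OF H.coalg_axioms HH.X.coalg_axioms pm tm] HH.proj2_map])
  then show ?thesis
  proof (rule coalgebra_map_cong[OF H.coalg_axioms])
    fix x assume x: "x \<in> carr H"
    have "pair H H H (\<lambda>x. x) (eta H) x = sweedler H tscale x (\<lambda>a b. tscale (counit H b) (htens H H a (unt H)))"
      unfolding pair_def by (rule sweedler_cong) simp
    also have "\<dots> = htens H H x (unt H)"
      by (rule H.sweedler_counit(2)[OF vt _ x]) (intro linear_onI; simp)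
    finally have "proj2 H H (twist (antip H) (pair H H H (\<lambda>x. x) (eta H) x)) =
        proj2 H H (sweedler H tscale x (\<lambda>a1 a2. htens H H a1 (mul H (antip H a2) (unt H))))"
      by (simp add: ta(2) x)
    also have "\<dots> = sweedler H (scal H) x (\<lambda>a1 a2. proj2 H H (htens H H a1 (mul H (antip H a2) (unt H))))"
      by (rule H.sweedler_apply[OF vt H.vs subspace_htensor HH.proj2(1) ta(3)[OF unt_in] _ x])
         (simp add: htens_in m)
    also have "\<dots> = sweedler H (scal H) x (\<lambda>a1 a2. scal H (counit H a1) (antip H a2))"
      by (rule sweedler_cong) (simp add: HH.proj2 m)
    also have "\<dots> = antip H x"
      by (rule H.sweedler_counit(1)[OF H.vs m(2) x])
    finally show "proj2 H H (twist (antip H) (pair H H H (\<lambda>x. x) (eta H) x)) = antip H x" .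
  qed
qed

section \<open>The group of coalgebra maps under convolution\<close>

lemma gen_carrierI: "coalgebra_map T H f \<Longrightarrow> f \<in> extensional (carr T) \<Longrightarrow> f \<in> carrier (gen H T)"
  and gen_map: "f \<in> carrier (gen H T) \<Longrightarrow> coalgebra_map T H f"
  and gen_ext: "f \<in> carrier (gen H T) \<Longrightarrow> f \<in> extensional (carr T)"
  and gen_mult: "mult (gen H T) = conv H T"
  and gen_one: "one (gen H T) = eta T"
  by (simp_all add: gen_def)

lemma gen_compose:
  assumes T: "coalg T" and f: "f \<in> carrier (gen H T)" and h: "coalgebra_map H H h"
  shows "compose (carr T) h f \<in> carrier (gen H T)"
proof (rule gen_carrierI)
  show "coalgebra_map T H (compose (carr T) h f)"
    by (rule coalgebra_map_cong[OF T coalgebra_map_comp[OF T H.coalg_axioms gen_map[OF f] h]])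
       (simp add: compose_def)
qed (simp add: compose_def)

lemma conv_antip:
  assumes T: "cocoalg T" and f: "f \<in> carrier (gen H T)"
  shows "conv H T (compose (carr T) (antip H) f) f = eta T"
proof
  fix d
  interpret T: cocoalg T by fact
  show "conv H T (compose (carr T) (antip H) f) f d = eta T d"
  proof (cases "d \<in> carr T")
    case d: True
    have "conv H T (compose (carr T) (antip H) f) f d = sweedler T (scal H) d (\<lambda>a b. mul H (antip H (f a)) (f b))"
      using d unfolding conv_def by (simp, intro sweedler_cong) (simp add: compose_def)
    also have "\<dots> = sweedler H (scal H) (f d) (\<lambda>a b. mul H (antip H a) b)"
      by (rule sweedler_cmap[OF T.coalg_axioms H.coalg_axioms H.vs conv_bilin[OF antip_linear linear_map_id] d gen_map[OF f], symmetric])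
    also have "\<dots> = eta T d"
      using d coalgebra_mapD[OF gen_map[OF f]] by (simp add: antip_left)
    finally show ?thesis .
  qed (simp add: conv_def)
qed

text \<open>Inverses are composites with the antipode; they stay in the carrier because the antipode
  is itself a coalgebra map.\<close>

lemma gen_group:
  assumes T: "cocoalg T"
  shows "group (gen H T)"
proof (rule groupI; unfold gen_mult gen_one)
  interpret T: cocoalg T by fact
  note lin = coalgebra_map_linear[OF gen_map]
  show "conv H T f g \<in> carrier (gen H T)" if "f \<in> carrier (gen H T)" "g \<in> carrier (gen H T)" for f g
    using conv_map[OF T gen_map[OF that(1)] gen_map[OF that(2)]]
    by (intro gen_carrierI) (simp_all add: conv_def)
  show "eta T \<in> carrier (gen H T)" by (intro gen_carrierI eta_map T) simp
  show "conv H T (conv H T f g) h = conv H T f (conv H T g h)"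
    if "f \<in> carrier (gen H T)" "g \<in> carrier (gen H T)" "h \<in> carrier (gen H T)" for f g h
    by (rule conv_assoc[OF T lin[OF that(1)] lin[OF that(2)] lin[OF that(3)]])
  show "conv H T (eta T) f = f" if "f \<in> carrier (gen H T)" for f
    by (rule eta_conv(1)[OF T lin[OF that] gen_ext[OF that]])
  show "\<exists>g\<in>carrier (gen H T). conv H T g f = eta T" if "f \<in> carrier (gen H T)" for f
    using conv_antip[OF T that] gen_compose[OF T.coalg_axioms that antip_map] by blast
qed

lemma gen_inv:
  assumes T: "cocoalg T" and f: "f \<in> carrier (gen H T)"
  shows "m_inv (gen H T) f = compose (carr T) (antip H) f"
proof -
  interpret T: cocoalg T by fact
  interpret G: group "gen H T" by (rule gen_group[OF T])
  show ?thesis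
    by (rule G.inv_equality)
       (use conv_antip[OF T f] f gen_compose[OF T.coalg_axioms f antip_map] in \<open>simp_all add: gen_mult gen_one\<close>)
qed

section \<open>Pulling back convolution products, and their values at x \<otimes> y\<close>

lemma conv_pull:
  assumes S: "coalg S" and T: "coalg T" and h: "coalgebra_map S T h"
    and f: "linear_map T H f" and g: "linear_map T H g" and d: "d \<in> carr S"
  shows "conv H T f g (h d) = conv H S (\<lambda>x. f (h x)) (\<lambda>x. g (h x)) d"
  using sweedler_cmap[OF S T H.vs conv_bilin[OF f g] d h] coalgebra_mapD(1)[OF h d] d
  by (simp add: conv_def)

lemma conv_cong:
  assumes "\<And>x. x \<in> carr T \<Longrightarrow> f x = f' x" "\<And>x. x \<in> carr T \<Longrightarrow> g x = g' x"
  shows "conv H T f g = conv H T f' g'"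
  unfolding conv_def by (intro restrict_ext sweedler_cong) (simp add: assms)

text \<open>Factors that depend on different generic variables multiply without any Sweedler sum;
  this is how group words turn into the formulas of the Hopf algebra.\<close>

lemma conv_12:
  assumes f: "linear_map H H f" and g: "linear_map H H g" and x: "x \<in> carr H" and y: "y \<in> carr H"
  shows "conv H HH (\<lambda>z. f (proj1 H H z)) (\<lambda>z. g (proj2 H H z)) (htens H H x y) = mul H (f x) (g y)"
  using HH.sweedler_proj[OF H.vs x y conv_bilin[OF f g]] x y by (simp add: conv_def htens_in)

lemma conv_21:
  assumes f: "linear_map H H f" and g: "linear_map H H g" and x: "x \<in> carr H" and y: "y \<in> carr H"
  shows "conv H HH (\<lambda>z. f (proj2 H H z)) (\<lambda>z. g (proj1 H H z)) (htens H H x y) = mul H (f y) (g x)"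
proof -
  interpret T: cocoalg HH by (rule HH_cocoalg)
  note p1 = coalgebra_map_linear[OF HH.proj1_map] and p2 = coalgebra_map_linear[OF HH.proj2_map]
  have b: "bilinear_on (scal H) (scal H) (scal H) (carr H) (carr H) (\<lambda>a b. mul H (f b) (g a))"
    using conv_bilin[OF f g] by (auto simp: bilinear_on_def)
  have z: "htens H H x y \<in> carr HH" by (simp add: htens_in x y)
  have "sweedler HH (scal H) (htens H H x y) (\<lambda>z1 z2. mul H (f (proj2 H H z1)) (g (proj1 H H z2))) =
    sweedler HH (scal H) (htens H H x y) (\<lambda>z1 z2. mul H (f (proj2 H H z2)) (g (proj1 H H z1)))"
    by (rule HH.X.cocomm[OF T.cocommutative H.vs bilinear_on_linear_maps[OF p1 p2 b] z])
  then show ?thesis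
    using HH.sweedler_proj[OF H.vs x y b] z by (simp add: conv_def)
qed

text \<open>When \<open>F\<close> involves both variables, a further factor in \<open>x\<close>
  duplicates \<open>x\<close> only. The projected factor has to come first for
  \<open>sweedler_proj1\<close>; cocommutativity, used in \<open>HH\<close> and again in
  \<open>H\<close>, moves it there and back.\<close>

lemma conv_right1:
  assumes F: "linear_map HH H F" and g: "linear_map H H g" and x: "x \<in> carr H" and y: "y \<in> carr H"
  shows "conv H HH F (\<lambda>z. g (proj1 H H z)) (htens H H x y) =
    sweedler H (scal H) x (\<lambda>a b. mul H (F (htens H H a y)) (g b))"
proof -
  interpret T: cocoalg HH by (rule HH_cocoalg)
  note p1 = coalgebra_map_linear[OF HH.proj1_map]
  note m = linear_mapD[OF F] linear_mapD[OF g]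
  note [simp] = m(1,3) linear_onD[OF m(4)] linear_onD[OF m(2)[simplified]]
  have b: "bilinear_on (scal H) tscale (scal H) (carr H) (htensor_space H H) (\<lambda>a z. mul H (F z) (g a))"
    using m(1) by (intro bilinear_onI linear_onI; simp)
  have b2: "H.bilin (scal H) (\<lambda>a b. mul H (F (htens H H a y)) (g b))"
    using m(1) by (intro bilinear_onI linear_onI; simp add: htens_in y)
  have z: "htens H H x y \<in> carr HH" by (simp add: htens_in x y)
  have "conv H HH F (\<lambda>z. g (proj1 H H z)) (htens H H x y) =
      sweedler HH (scal H) (htens H H x y) (\<lambda>z1 z2. mul H (F z2) (g (proj1 H H z1)))"
    using HH.X.cocomm[OF T.cocommutative H.vs conv_bilin[OF F linear_map_comp[OF p1 g]] z] z
    by (simp add: conv_def)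
  also have "\<dots> = sweedler H (scal H) x (\<lambda>a b. mul H (F (htens H H b y)) (g a))"
    by (rule HH.sweedler_proj1[OF H.vs x y b])
  also have "\<dots> = sweedler H (scal H) x (\<lambda>a b. mul H (F (htens H H a y)) (g b))"
    by (rule H.cocomm[OF cocomm H.vs b2 x])
  finally show ?thesis .
qed

lemma conv_right2:
  assumes F: "linear_map HH H F" and g: "linear_map H H g" and x: "x \<in> carr H" and y: "y \<in> carr H"
  shows "conv H HH F (\<lambda>z. g (proj2 H H z)) (htens H H x y) =
    sweedler H (scal H) y (\<lambda>a b. mul H (F (htens H H x a)) (g b))"
proof -
  interpret T: cocoalg HH by (rule HH_cocoalg)
  note p2 = coalgebra_map_linear[OF HH.proj2_map]
  note m = linear_mapD[OF F] linear_mapD[OF g]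
  note [simp] = m(1,3) linear_onD[OF m(4)] linear_onD[OF m(2)[simplified]]
  have b: "bilinear_on (scal H) tscale (scal H) (carr H) (htensor_space H H) (\<lambda>a z. mul H (F z) (g a))"
    using m(1) by (intro bilinear_onI linear_onI; simp)
  have b2: "H.bilin (scal H) (\<lambda>a b. mul H (F (htens H H x a)) (g b))"
    using m(1) by (intro bilinear_onI linear_onI; simp add: htens_in x)
  have z: "htens H H x y \<in> carr HH" by (simp add: htens_in x y)
  have "conv H HH F (\<lambda>z. g (proj2 H H z)) (htens H H x y) =
      sweedler HH (scal H) (htens H H x y) (\<lambda>z1 z2. mul H (F z2) (g (proj2 H H z1)))"
    using HH.X.cocomm[OF T.cocommutative H.vs conv_bilin[OF F linear_map_comp[OF p2 g]] z] z
    by (simp add: conv_def)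
  also have "\<dots> = sweedler H (scal H) y (\<lambda>a b. mul H (F (htens H H x b)) (g a))"
    by (rule HH.sweedler_proj2[OF H.vs x y b])
  also have "\<dots> = sweedler H (scal H) y (\<lambda>a b. mul H (F (htens H H x a)) (g b))"
    by (rule H.cocomm[OF cocomm H.vs b2 y])
  finally show ?thesis .
qed

end

section \<open>Rota-Baxter groups\<close>

locale rb_group = group G for G (structure) +
  fixes B :: "'a \<Rightarrow> 'a"
  assumes B_closed [simp]: "x \<in> carrier G \<Longrightarrow> B x \<in> carrier G"
    and rb: "x \<in> carrier G \<Longrightarrow> y \<in> carrier G \<Longrightarrow> B x \<otimes> B y = B (B x \<otimes> y \<otimes> inv (B x) \<otimes> x)"
begin

definition beta where "beta x = B (inv x)"
definition Bt where "Bt x = x \<otimes> beta x"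
text \<open>\<open>beta\<close> is a Rota-Baxter operator of weight 1 in the usual form, \<open>beta
  x \<otimes> beta y = beta (x \<otimes> beta x \<otimes> y \<otimes> inv (beta x))\<close>. This is
  its descendent product, with inverse \<open>cinv\<close>; both \<open>beta\<close> and
  \<open>Bt\<close> turn it into the product of \<open>G\<close>.\<close>

definition circ where "circ x y = x \<otimes> beta x \<otimes> y \<otimes> inv (beta x)"
definition cinv where "cinv x = inv (beta x) \<otimes> inv x \<otimes> beta x"

lemma closed [simp]:
  "x \<in> carrier G \<Longrightarrow> beta x \<in> carrier G"
  "x \<in> carrier G \<Longrightarrow> Bt x \<in> carrier G"
  "x \<in> carrier G \<Longrightarrow> cinv x \<in> carrier G"
  "x \<in> carrier G \<Longrightarrow> y \<in> carrier G \<Longrightarrow> circ x y \<in> carrier G"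
  by (simp_all add: beta_def Bt_def circ_def cinv_def)

lemma cancel:
  "x \<in> carrier G \<Longrightarrow> y \<in> carrier G \<Longrightarrow> x \<otimes> (inv x \<otimes> y) = y"
  "x \<in> carrier G \<Longrightarrow> y \<in> carrier G \<Longrightarrow> inv x \<otimes> (x \<otimes> y) = y"
  by (simp_all flip: m_assoc)

text \<open>Brings group words to reduced, right-nested form, so that equations between words are
  settled by rewriting.\<close>

lemmas grp = m_assoc inv_mult_group cancel

text \<open>The Rota-Baxter identity at the unit says that \<open>B \<one>\<close> is
  idempotent.\<close>

lemma B_one [simp]: "B \<one> = \<one>"
  using rb[of \<one> \<one>] by (simp add: r_cancel_one')

lemma beta_one [simp]: "beta \<one> = \<one>" and Bt_one [simp]: "Bt \<one> = \<one>"
  by (simp_all add: beta_def Bt_def)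

lemma B_beta: "x \<in> carrier G \<Longrightarrow> B x = beta (inv x)"
  by (simp add: beta_def)

lemma beta_circ: "x \<in> carrier G \<Longrightarrow> y \<in> carrier G \<Longrightarrow> beta (circ x y) = beta x \<otimes> beta y"
  using rb[of "inv x" "inv y"] by (simp add: circ_def beta_def grp)

lemma Bt_circ: "x \<in> carrier G \<Longrightarrow> y \<in> carrier G \<Longrightarrow> Bt (circ x y) = Bt x \<otimes> Bt y"
  using beta_circ[of x y] by (simp add: Bt_def) (simp add: circ_def grp)

lemma circ_cinv: "x \<in> carrier G \<Longrightarrow> circ x (cinv x) = \<one>"
  by (simp add: circ_def cinv_def grp)

lemma beta_cinv: "x \<in> carrier G \<Longrightarrow> beta (cinv x) = inv (beta x)"
  using beta_circ[of x "cinv x"] inv_equality[of "beta x" "beta (cinv x)"]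
  by (simp add: circ_cinv) (metis inv_inv closed)

lemma Bt_cinv: "x \<in> carrier G \<Longrightarrow> Bt (cinv x) = inv (Bt x)"
  using Bt_circ[of x "cinv x"] inv_equality[of "Bt x" "Bt (cinv x)"]
  by (simp add: circ_cinv) (metis inv_inv closed)

text \<open>Because \<open>circ x (beta x) = Bt x\<close>, the homomorphism property of
  \<open>beta\<close> gives \<open>beta (Bt x) = beta x \<otimes> beta (beta x)\<close>, which is
  \<open>Bt (beta x)\<close>.\<close>

lemma Bt_beta: "x \<in> carrier G \<Longrightarrow> Bt (beta x) = beta (Bt x)"
  using beta_circ[of x "beta x"] by (simp add: Bt_def circ_def grp)

text \<open>Expresses the effect on \<open>Bt\<close> of a right factor \<open>beta r\<close>
  through \<open>Bt g\<close> and \<open>Bt r\<close> alone, the mechanism behind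
  \<open>Bt_conj\<close>.\<close>

lemma Bt_mult_beta:
  assumes "g \<in> carrier G" "r \<in> carrier G"
  shows "Bt (g \<otimes> beta r) = Bt g \<otimes> beta (inv (Bt g) \<otimes> Bt r \<otimes> Bt g)"
proof -
  \<comment> \<open>A conjugate of \<open>r\<close> for \<open>circ\<close>, so that
    \<open>beta ?w\<close> is the conjugate of \<open>beta r\<close> by \<open>beta g\<close>. The
    conjugation built into \<open>circ g\<close> undoes it, whence
    \<open>circ g (beta ?w) = g \<otimes> beta r\<close>.\<close>
  let ?w = "circ (circ (cinv g) r) g"
  have "g \<otimes> beta r = circ g (beta ?w)"
    using assms by (simp add: circ_def[of g] beta_circ beta_cinv grp)
  then have "Bt (g \<otimes> beta r) = Bt g \<otimes> beta (Bt ?w)"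
    using assms by (simp add: Bt_circ Bt_beta)
  then show ?thesis using assms by (simp add: Bt_circ Bt_cinv)
qed

text \<open>The right-hand side depends on \<open>y\<close> only through \<open>Bt y\<close>; hence the left action is well defined.\<close>

lemma Bt_conj:
  assumes "s \<in> carrier G" "y \<in> carrier G"
  defines "k \<equiv> Bt (beta s \<otimes> Bt y)"
  shows "Bt (beta s \<otimes> y \<otimes> inv (beta s)) = k \<otimes> beta (inv k \<otimes> inv (Bt s \<otimes> Bt y) \<otimes> k)"
proof -
  \<comment> \<open>Replace \<open>y\<close> by \<open>Bt y \<otimes> inv (beta y)\<close>; the
    remaining \<open>inv (beta y) \<otimes> inv (beta s)\<close> is a single value of
    \<open>beta\<close>, at \<open>cinv (circ s y)\<close>, so that \<open>Bt_mult_beta\<close>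
    applies.\<close>
  have "beta s \<otimes> y \<otimes> inv (beta s) = (beta s \<otimes> Bt y) \<otimes> beta (cinv (circ s y))"
    using assms(1,2) by (simp add: beta_cinv beta_circ grp) (simp add: Bt_def grp)
  then show ?thesis
    using assms(1,2) by (simp add: Bt_mult_beta Bt_cinv Bt_circ k_def)
qed

text \<open>The group form of \<open>rb_antip\<close>: the inverse of \<open>y\<close> for the
  product \<open>B y \<otimes> z \<otimes> inv (B y) \<otimes> y\<close> of \<open>y\<close> and
  \<open>z\<close>, which \<open>B\<close> turns into the product of \<open>G\<close>.\<close>

definition SB where "SB y = inv (B y) \<otimes> inv y \<otimes> B y"

lemma SB_closed [simp]: "y \<in> carrier G \<Longrightarrow> SB y \<in> carrier G"
  by (simp add: SB_def)

definition ract where "ract y x = inv (B (inv (Bt x) \<otimes> SB y \<otimes> Bt x))"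

lemma ract_closed [simp]: "y \<in> carrier G \<Longrightarrow> x \<in> carrier G \<Longrightarrow> ract y x \<in> carrier G"
  by (simp add: ract_def)

text \<open>The factorisation that characterises a matched pair: moving \<open>B y\<close> past
  \<open>Bt x\<close> leaves the left action followed by the right one. In terms of \<open>v\<close>
  and \<open>k\<close> the right-hand side is \<open>v \<otimes> beta k\<close>, the left action is
  \<open>Bt v = v \<otimes> beta v\<close>, and the right action turns out to be
  \<open>inv (beta v) \<otimes> beta k\<close>.\<close>

lemma factor:
  assumes x: "x \<in> carrier G" and y: "y \<in> carrier G"
  shows "Bt (B y \<otimes> x \<otimes> inv (B y)) \<otimes> ract y x = B y \<otimes> Bt x"
proof -
  define s where "s = inv y"
  define v where "v = B y \<otimes> x \<otimes> inv (B y)"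
  define k where "k = circ s x"
  have s: "s \<in> carrier G" "B y = beta s" "inv s = y" and v: "v \<in> carrier G" and k: "k \<in> carrier G"
    using x y by (simp_all add: s_def beta_def v_def k_def)
  have kv: "k = s \<otimes> v" using x s by (simp add: k_def v_def circ_def grp)
  have vk: "v \<otimes> beta k = B y \<otimes> Bt x"
    using x s by (simp add: k_def v_def beta_circ Bt_def grp)
  \<comment> \<open>The argument of \<open>B\<close> inside \<open>ract\<close> is the inverse of a
    conjugate of \<open>y\<close>. That conjugate is a quotient of \<open>v\<close> by
    \<open>k\<close> for \<open>circ\<close>, so the homomorphism property of \<open>beta\<close>
    evaluates it.\<close>
  have "circ (cinv k) v = inv (beta k) \<otimes> inv k \<otimes> v \<otimes> beta k"
    using k v by (simp add: circ_def beta_cinv) (simp add: cinv_def grp)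
  also have "\<dots> = inv (v \<otimes> beta k) \<otimes> y \<otimes> (v \<otimes> beta k)"
    using s v k y by (simp add: kv grp)
  finally have c: "circ (cinv k) v = inv (B y \<otimes> Bt x) \<otimes> y \<otimes> (B y \<otimes> Bt x)" by (simp add: vk)
  have "inv (Bt x) \<otimes> SB y \<otimes> Bt x = inv (circ (cinv k) v)"
    unfolding c using x y by (simp add: SB_def grp)
  then have "B (inv (Bt x) \<otimes> SB y \<otimes> Bt x) = beta (circ (cinv k) v)"
    by (simp add: beta_def)
  then have "ract y x = inv (beta v) \<otimes> beta k"
    using k v by (simp add: ract_def beta_circ beta_cinv grp)
  then have "Bt v \<otimes> ract y x = v \<otimes> beta k"
    using v k by (simp add: Bt_def grp)
  then show ?thesis unfolding vk by (simp only: v_def)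
qed

definition plus where "plus = B ` carrier G"

lemma B_plus: "x \<in> carrier G \<Longrightarrow> B x \<in> plus" by (simp add: plus_def)

text \<open>\<open>B\<close> is \<open>beta\<close> at inverses, and \<open>beta\<close> sends
  \<open>cinv\<close> to the inverse.\<close>

lemma plus_inv: assumes "u \<in> plus" shows "inv u \<in> plus"
proof -
  from assms obtain y where "y \<in> carrier G" "u = beta (inv y)" by (auto simp: plus_def beta_def)
  then have "inv u = B (inv (cinv (inv y)))" "inv (cinv (inv y)) \<in> carrier G"
    by (simp_all add: beta_cinv flip: beta_def)
  then show ?thesis by (auto simp: plus_def)
qed

lemma plus_mult: "u \<in> plus \<Longrightarrow> w \<in> plus \<Longrightarrow> u \<otimes> w \<in> plus"
  using rb by (force simp: plus_def)

lemma plus_carrier [simp]: "u \<in> plus \<Longrightarrow> u \<in> carrier G"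
  by (auto simp: plus_def)

text \<open>The first component of a product in the coordinates [x, g]. With
  \<open>g = Bt x \<otimes> B y\<close>, the new coordinate is a \<open>circ\<close> product because
  \<open>inv (Bt x) \<otimes> x = inv (beta x)\<close>.\<close>

lemma left_mult:
  assumes x: "x \<in> carrier G" "x' \<in> carrier G" and y: "y \<in> carrier G"
  shows "Bt x \<otimes> Bt (B y \<otimes> x' \<otimes> inv (B y)) =
    Bt ((Bt x \<otimes> B y) \<otimes> x' \<otimes> inv (Bt x \<otimes> B y) \<otimes> x)"
proof -
  have "(Bt x \<otimes> B y) \<otimes> x' \<otimes> inv (Bt x \<otimes> B y) \<otimes> x = circ x (B y \<otimes> x' \<otimes> inv (B y))"
    using x y by (simp add: circ_def Bt_def grp)
  then show ?thesis using x y by (simp add: Bt_circ)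
qed

text \<open>By \<open>factor\<close>, the product of the two components of the result is the product
  in \<open>G\<close> of the two coordinates \<open>g\<close>; so the second component is what
  remains after dividing by the first.\<close>

lemma right_mult:
  assumes x: "x \<in> carrier G" "x' \<in> carrier G" and y: "y \<in> carrier G" "y' \<in> carrier G"
  shows "ract y x' \<otimes> B y' = inv (Bt ((Bt x \<otimes> B y) \<otimes> x' \<otimes> inv (Bt x \<otimes> B y) \<otimes> x)) \<otimes>
    ((Bt x \<otimes> B y) \<otimes> (Bt x' \<otimes> B y'))"
proof -
  have "ract y x' = inv (Bt (B y \<otimes> x' \<otimes> inv (B y))) \<otimes> (B y \<otimes> Bt x')"
    using x y by (simp flip: factor add: grp)
  then show ?thesis unfolding left_mult[OF x y(1), symmetric]
    using x y by (simp add: grp)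
qed

lemma tilde_fst:
  assumes "x \<in> carrier G" "y \<in> carrier G"
  shows "Bt (inv (B (inv x) \<otimes> B y)) = Bt (inv (Bt x \<otimes> B y) \<otimes> x)"
  using assms by (simp add: Bt_def beta_def grp)

text \<open>With \<open>?t\<close> the \<open>circ\<close> inverse of \<open>circ x (inv y)\<close>,
  the value of \<open>B\<close> on the left becomes \<open>beta (Bt ?t)\<close>. Exchanging
  \<open>beta\<close> and \<open>Bt\<close> exposes \<open>beta ?t\<close>, which is
  \<open>inv g \<otimes> x\<close> for \<open>g = Bt x \<otimes> B y\<close>. With
  \<open>tilde_fst\<close>, both components of C' are governed by this single element.\<close>

lemma tilde_snd:
  assumes "x \<in> carrier G" "y \<in> carrier G"
  shows "inv (B (Bt x \<otimes> Bt (inv y))) = inv (Bt (inv (Bt x \<otimes> B y) \<otimes> x))"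
proof -
  let ?t = "cinv (circ x (inv y))"
  have "B (Bt x \<otimes> Bt (inv y)) = beta (Bt ?t)"
    using assms by (simp add: Bt_cinv Bt_circ beta_def)
  also have "\<dots> = Bt (beta ?t)" using assms by (simp add: Bt_beta)
  also have "beta ?t = inv (Bt x \<otimes> B y) \<otimes> x"
    using assms by (simp add: beta_cinv beta_circ Bt_def grp B_beta)
  finally show ?thesis by simp
qed

lemma C_snd:
  assumes "g \<in> carrier G"
  shows "inv (B (inv g)) = inv (Bt g) \<otimes> g"
  using assms by (simp add: Bt_def beta_def grp)

end

section \<open>Rota-Baxter Hopf algebras\<close>

context cocommutative_hopf
begin

section \<open>Change of the test coalgebra, and the generic elements\<close>

lemma pull_gen:
  assumes "coalg S" "coalg T" "coalgebra_map S T h" "f \<in> carrier (gen H T)"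
  shows "compose (carr S) f h \<in> carrier (gen H S)"
  by (rule gen_carrierI, rule coalgebra_map_cong[OF assms(1) coalgebra_map_comp[OF assms(1,2,3) gen_map[OF assms(4)]]])
     (simp_all add: compose_def)

lemma pull_mult:
  assumes "coalg S" "coalg T" "coalgebra_map S T h" "f \<in> carrier (gen H T)" "g \<in> carrier (gen H T)"
  shows "compose (carr S) (f \<otimes>\<^bsub>gen H T\<^esub> g) h =
    compose (carr S) f h \<otimes>\<^bsub>gen H S\<^esub> compose (carr S) g h"
proof
  fix d
  note lin = assms(4,5)[THEN gen_map, THEN coalgebra_map_linear]
  have c: "conv H S (\<lambda>x. f (h x)) (\<lambda>x. g (h x)) = conv H S (compose (carr S) f h) (compose (carr S) g h)"
    by (rule conv_cong) (simp_all add: compose_def)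
  show "compose (carr S) (f \<otimes>\<^bsub>gen H T\<^esub> g) h d = (compose (carr S) f h \<otimes>\<^bsub>gen H S\<^esub> compose (carr S) g h) d"
  proof (cases "d \<in> carr S")
    case True
    then show ?thesis using conv_pull[OF assms(1,2,3) lin True] c by (simp add: gen_mult compose_def)
  next
    case False
    then show ?thesis by (simp add: gen_mult compose_def conv_def)
  qed
qed

lemma pull_comp:
  assumes "\<And>x. x \<in> carr S \<Longrightarrow> h x \<in> carr T"
  shows "compose (carr S) (compose (carr T) k f) h = compose (carr S) k (compose (carr S) f h)"
  by (rule ext) (simp add: compose_def assms)

lemma pull_inv:
  assumes "cocoalg S" "cocoalg T" "coalgebra_map S T h" "f \<in> carrier (gen H T)"
  shows "compose (carr S) (inv\<^bsub>gen H T\<^esub> f) h = inv\<^bsub>gen H S\<^esub> (compose (carr S) f h)"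
  using assms pull_gen[OF _ _ assms(3,4)] coalgebra_mapD(1)[OF assms(3)]
  by (simp add: gen_inv cocoalg_def pull_comp)

definition P1 where "P1 = restrict (proj1 H H) (carr HH)"
definition P2 where "P2 = restrict (proj2 H H) (carr HH)"

lemma P12_gen [simp]: "P1 \<in> carrier (gen H HH)" "P2 \<in> carrier (gen H HH)"
  unfolding P1_def P2_def
  by (rule gen_carrierI, rule coalgebra_map_cong[OF HH.X.coalg_axioms HH.proj1_map], simp, simp)
     (rule gen_carrierI, rule coalgebra_map_cong[OF HH.X.coalg_axioms HH.proj2_map], simp, simp)

text \<open>Any two elements of any \<open>gen H T\<close> are pulled back from the generic pair
  \<open>P1\<close>, \<open>P2\<close> along one coalgebra map. An identity proved for
  \<open>P1\<close> and \<open>P2\<close> thus holds for all elements of all these groups, as soon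
  as its operations commute with pulling back.\<close>

lemma pair_gen:
  assumes T: "cocoalg T" and f: "f \<in> carrier (gen H T)" and g: "g \<in> carrier (gen H T)"
  shows "coalgebra_map T HH (pair T H H f g)"
    and "compose (carr T) P1 (pair T H H f g) = f"
    and "compose (carr T) P2 (pair T H H f g) = g"
proof -
  interpret T: cocoalg T by fact
  interpret P: pairing H H undefined undefined T ..
  note mf = gen_map[OF f] and mg = gen_map[OF g]
  show p: "coalgebra_map T HH (pair T H H f g)" by (rule P.pair_map[OF mf mg])
  have "compose (carr T) P1 (pair T H H f g) x = f x" for x
    using coalgebra_mapD(1)[OF p] gen_ext[OF f] P.proj1_pair[OF coalgebra_map_linear[OF mf] mg]
    by (cases "x \<in> carr T") (auto simp: compose_def P1_def extensional_def)
  moreover have "compose (carr T) P2 (pair T H H f g) x = g x" for x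
    using coalgebra_mapD(1)[OF p] gen_ext[OF g] P.proj2_pair[OF mf coalgebra_map_linear[OF mg]]
    by (cases "x \<in> carr T") (auto simp: compose_def P2_def extensional_def)
  ultimately show "compose (carr T) P1 (pair T H H f g) = f" "compose (carr T) P2 (pair T H H f g) = g"
    by auto
qed

lemma gen_lin: "f \<in> carrier (gen H T) \<Longrightarrow> linear_map T H f"
  by (rule coalgebra_map_linear[OF gen_map])

lemma HH_ext:
  assumes f: "f \<in> carrier (gen H HH)" and g: "g \<in> carrier (gen H HH)"
    and "\<And>x y. x \<in> carr H \<Longrightarrow> y \<in> carr H \<Longrightarrow> f (htens H H x y) = g (htens H H x y)"
  shows "f = g"
proof
  fix z
  show "f z = g z"
  proof (cases "z \<in> carr HH")
    case True
    then show ?thesis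
      using HH.tensor_ext[OF H.vs, of f g z] assms(3)
        coalgebra_mapD(2)[OF gen_map[OF f]] coalgebra_mapD(2)[OF gen_map[OF g]]
      by simp
  next
    case False
    then show ?thesis using gen_ext[OF f] gen_ext[OF g] by (simp add: extensional_def)
  qed
qed

lemma htens_HH [simp]: "x \<in> carr H \<Longrightarrow> y \<in> carr H \<Longrightarrow> htens H H x y \<in> htensor_space H H"
  by (rule htens_in)

lemma eval_12:
  assumes "linear_map H H f" "linear_map H H g" "x \<in> carr H" "y \<in> carr H"
  shows "(compose (carr HH) f P1 \<otimes>\<^bsub>gen H HH\<^esub> compose (carr HH) g P2) (htens H H x y) = mul H (f x) (g y)"
  unfolding gen_mult
  by (rule trans[OF fun_cong[OF conv_cong] conv_12[OF assms]]) (simp_all add: compose_def P1_def P2_def)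

lemma eval_21:
  assumes "linear_map H H f" "linear_map H H g" "x \<in> carr H" "y \<in> carr H"
  shows "(compose (carr HH) f P2 \<otimes>\<^bsub>gen H HH\<^esub> compose (carr HH) g P1) (htens H H x y) = mul H (f y) (g x)"
  unfolding gen_mult
  by (rule trans[OF fun_cong[OF conv_cong] conv_21[OF assms]]) (simp_all add: compose_def P1_def P2_def)

lemma eval_right1:
  assumes "F \<in> carrier (gen H HH)" "linear_map H H g" "x \<in> carr H" "y \<in> carr H"
  shows "(F \<otimes>\<^bsub>gen H HH\<^esub> compose (carr HH) g P1) (htens H H x y) =
    sweedler H (scal H) x (\<lambda>a b. mul H (F (htens H H a y)) (g b))"
  unfolding gen_mult
  by (rule trans[OF fun_cong[OF conv_cong] conv_right1[OF gen_lin[OF assms(1)] assms(2-4)]])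
     (simp_all add: compose_def P1_def)

lemma eval_right2:
  assumes "F \<in> carrier (gen H HH)" "linear_map H H g" "x \<in> carr H" "y \<in> carr H"
  shows "(F \<otimes>\<^bsub>gen H HH\<^esub> compose (carr HH) g P2) (htens H H x y) =
    sweedler H (scal H) y (\<lambda>a b. mul H (F (htens H H x a)) (g b))"
  unfolding gen_mult
  by (rule trans[OF fun_cong[OF conv_cong] conv_right2[OF gen_lin[OF assms(1)] assms(2-4)]])
     (simp_all add: compose_def P2_def)

lemma compose_id: "compose (carr HH) (\<lambda>x. x) P1 = P1" "compose (carr HH) (\<lambda>x. x) P2 = P2"
  by (auto simp: compose_def P1_def P2_def fun_eq_iff)

lemma compose_compose: "compose A k (compose A h f) = compose A (\<lambda>x. k (h x)) f"
  by (auto simp: compose_def fun_eq_iff)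

lemma cocoalg_H: "cocoalg H" by unfold_locales

end

locale rota_baxter = cocommutative_hopf H for H :: "('k::field, 'h::ab_group_add) hopf" +
  fixes B :: "'h \<Rightarrow> 'h"
  assumes B_map: "coalgebra_map H H B"
    and RB: "x \<in> carr H \<Longrightarrow> y \<in> carr H \<Longrightarrow> mul H (B x) (B y) =
       B (sweedler3 H (scal H) x (\<lambda>x1 x2 x3.
         mul H (mul H (mul H (B x1) y) (antip H (B x2))) x3))"
begin

abbreviation Bop where "Bop T \<equiv> compose (carr T) B"

lemmas B_lin = coalgebra_map_linear[OF B_map]
lemmas Bm = linear_mapD[OF B_lin]
lemmas Sm = linear_mapD[OF antip_linear]

lemma Bop_gen: "coalg T \<Longrightarrow> f \<in> carrier (gen H T) \<Longrightarrow> Bop T f \<in> carrier (gen H T)"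
  by (rule gen_compose[OF _ _ B_map])

text \<open>Evaluated at x \<otimes> y, the group identity for the two generic elements is the
  Rota-Baxter axiom of the Hopf algebra.\<close>

lemma RB_universal:
  "Bop HH P1 \<otimes>\<^bsub>gen H HH\<^esub> Bop HH P2 =
    Bop HH (Bop HH P1 \<otimes>\<^bsub>gen H HH\<^esub> P2 \<otimes>\<^bsub>gen H HH\<^esub> inv\<^bsub>gen H HH\<^esub> (Bop HH P1) \<otimes>\<^bsub>gen H HH\<^esub> P1)"
proof -
  interpret G: group "gen H HH" by (rule gen_group[OF HH_cocoalg])
  interpret GH: group "gen H H" by (rule gen_group[OF cocoalg_H])
  note [simp] = Bop_gen[OF HH.X.coalg_axioms, simplified]
  \<comment> \<open>The last two factors in \<open>x\<close> are gathered into one map of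
    \<open>x\<close>, so that \<open>eval_right1\<close> has to read off a single duplication of
    \<open>x\<close>; expanding \<open>h\<close> afterwards gives the right-nested
    \<open>sweedler3\<close>.\<close>
  define h where "h = conv H H (\<lambda>x. antip H (B x)) (\<lambda>x. x)"
  have SB: "linear_map H H (\<lambda>x. antip H (B x))" by (rule linear_map_comp[OF B_lin antip_linear])
  have h: "linear_map H H h" unfolding h_def by (rule conv_linear[OF cocoalg_H SB linear_map_id])
  have "conv H HH (inv\<^bsub>gen H HH\<^esub> (Bop HH P1)) P1 = conv H HH (\<lambda>z. antip H (B (proj1 H H z))) (proj1 H H)"
    unfolding gen_inv[OF HH_cocoalg Bop_gen[OF HH.X.coalg_axioms P12_gen(1)]]
    by (rule conv_cong) (simp_all add: compose_def P1_def)
  also have "\<dots> = compose (carr HH) h P1"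
  proof
    fix z
    show "conv H HH (\<lambda>z. antip H (B (proj1 H H z))) (proj1 H H) z = compose (carr HH) h P1 z"
      using conv_pull[OF HH.X.coalg_axioms H.coalg_axioms HH.proj1_map SB linear_map_id, of z]
      by (cases "z \<in> carr HH") (auto simp: h_def compose_def P1_def conv_def)
  qed
  finally have e: "inv\<^bsub>gen H HH\<^esub> (Bop HH P1) \<otimes>\<^bsub>gen H HH\<^esub> P1 = compose (carr HH) h P1"
    by (simp add: gen_mult)
  have hP: "compose (carr HH) h P1 \<in> carrier (gen H HH)"
    unfolding e[symmetric] by (intro G.m_closed G.inv_closed Bop_gen[OF HH.X.coalg_axioms] P12_gen)
  have "Bop HH P1 \<otimes>\<^bsub>gen H HH\<^esub> Bop HH P2 =
    Bop HH ((Bop HH P1 \<otimes>\<^bsub>gen H HH\<^esub> P2) \<otimes>\<^bsub>gen H HH\<^esub> compose (carr HH) h P1)"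
  proof (rule HH_ext)
    fix x y assume x: "x \<in> carr H" and y: "y \<in> carr H"
    have "((Bop HH P1 \<otimes>\<^bsub>gen H HH\<^esub> P2) \<otimes>\<^bsub>gen H HH\<^esub> compose (carr HH) h P1) (htens H H x y) =
      sweedler H (scal H) x (\<lambda>a b. mul H ((Bop HH P1 \<otimes>\<^bsub>gen H HH\<^esub> P2) (htens H H a y)) (h b))"
      by (rule eval_right1[OF _ h x y]) simp
    also have "\<dots> = sweedler H (scal H) x (\<lambda>a b. mul H (mul H (B a) y) (h b))"
      by (rule sweedler_cong) (use eval_12[OF B_lin linear_map_id _ y] in \<open>simp add: compose_id[simplified]\<close>)
    also have "\<dots> = sweedler H (scal H) x (\<lambda>a b. sweedler H (scal H) b (\<lambda>x2 x3. mul H (mul H (mul H (B a) y) (antip H (B x2))) x3))"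
    proof (rule sweedler_cong)
      fix a b assume *: "a \<in> carr H" "b \<in> carr H"
      have "mul H (mul H (B a) y) (h b) = sweedler H (scal H) b (\<lambda>x2 x3. mul H (mul H (B a) y) (mul H (antip H (B x2)) x3))"
        using * y unfolding h_def conv_def
        by simp (rule H.sweedler_apply[OF H.vs H.vs H.sub _ conv_bilin[OF SB linear_map_id]],
          simp_all add: mul_lin Bm Sm)
      also have "\<dots> = sweedler H (scal H) b (\<lambda>x2 x3. mul H (mul H (mul H (B a) y) (antip H (B x2))) x3)"
        by (rule sweedler_cong) (simp add: mul_assoc * y Bm Sm)
      finally show "mul H (mul H (B a) y) (h b) = sweedler H (scal H) b (\<lambda>x2 x3. mul H (mul H (mul H (B a) y) (antip H (B x2))) x3)" .
    qed
    finally have "((Bop HH P1 \<otimes>\<^bsub>gen H HH\<^esub> P2) \<otimes>\<^bsub>gen H HH\<^esub> compose (carr HH) h P1) (htens H H x y) =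
      sweedler3 H (scal H) x (\<lambda>x1 x2 x3. mul H (mul H (mul H (B x1) y) (antip H (B x2))) x3)"
      by (simp add: sweedler3_def)
    then show "(Bop HH P1 \<otimes>\<^bsub>gen H HH\<^esub> Bop HH P2) (htens H H x y) =
      Bop HH ((Bop HH P1 \<otimes>\<^bsub>gen H HH\<^esub> P2) \<otimes>\<^bsub>gen H HH\<^esub> compose (carr HH) h P1) (htens H H x y)"
      unfolding eval_12[OF B_lin B_lin x y] using RB[OF x y] x y by (simp add: compose_def)
  qed (intro Bop_gen[OF HH.X.coalg_axioms] G.m_closed P12_gen hP)+
  then show ?thesis unfolding e[symmetric]
    by (subst G.m_assoc) (simp_all only: G.m_closed G.inv_closed Bop_gen[OF HH.X.coalg_axioms] P12_gen)
qed

text \<open>The identity for \<open>f\<close> and \<open>g\<close> is \<open>RB_universal\<close>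
  pulled back along the map that carries \<open>P1\<close> and \<open>P2\<close> to them.\<close>

lemma rb_group_gen:
  assumes T: "cocoalg T"
  shows "rb_group (gen H T) (Bop T)"
proof -
  interpret T: cocoalg T by fact
  interpret G: group "gen H T" by (rule gen_group[OF T])
  interpret GH: group "gen H HH" by (rule gen_group[OF HH_cocoalg])
  show ?thesis
  proof
    show "Bop T f \<in> carrier (gen H T)" if "f \<in> carrier (gen H T)" for f
      by (rule Bop_gen[OF T.coalg_axioms that])
    fix f g assume f: "f \<in> carrier (gen H T)" and g: "g \<in> carrier (gen H T)"
    note p = pair_gen[OF T f g]
    note pm = pull_mult[OF T.coalg_axioms HH.X.coalg_axioms p(1)]
    note pi = pull_inv[OF T HH_cocoalg p(1)]
    have pc: "compose (carr T) (compose (carr HH) k F) (pair T H H f g) = compose (carr T) k (compose (carr T) F (pair T H H f g))"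
      for k :: "'h \<Rightarrow> 'h" and F
      by (rule pull_comp) (rule coalgebra_mapD(1)[OF p(1)])
    note [simp] = Bop_gen[OF HH.X.coalg_axioms]
    show "Bop T f \<otimes>\<^bsub>gen H T\<^esub> Bop T g = Bop T (Bop T f \<otimes>\<^bsub>gen H T\<^esub> g \<otimes>\<^bsub>gen H T\<^esub> inv\<^bsub>gen H T\<^esub> (Bop T f) \<otimes>\<^bsub>gen H T\<^esub> f)"
      using arg_cong[OF RB_universal, of "\<lambda>F. compose (carr T) F (pair T H H f g)"]
      by (simp only: pm pi pc p(2,3) P12_gen Bop_gen[OF HH.X.coalg_axioms] GH.m_closed GH.inv_closed)
  qed
qed

section \<open>The group operators as composition with maps of the Hopf algebra\<close>

abbreviation gBt where "gBt T \<equiv> rb_group.Bt (gen H T) (Bop T)"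
abbreviation gbeta where "gbeta T \<equiv> rb_group.beta (gen H T) (Bop T)"
abbreviation gract where "gract T \<equiv> rb_group.ract (gen H T) (Bop T)"
abbreviation Bt where "Bt \<equiv> rb_tilde H B"

lemma beta_gen:
  assumes T: "cocoalg T" and f: "f \<in> carrier (gen H T)"
  shows "gbeta T f = compose (carr T) (\<lambda>x. B (antip H x)) f"
proof -
  interpret R: rb_group "gen H T" "Bop T" by (rule rb_group_gen[OF T])
  show ?thesis by (simp add: R.beta_def gen_inv[OF T f] compose_compose)
qed

lemma Bt_conv: "x \<in> carr H \<Longrightarrow> Bt x = conv H H (\<lambda>x. x) (\<lambda>x. B (antip H x)) x"
  by (simp add: rb_tilde_def conv_def)

lemma BS_map: "coalgebra_map H H (\<lambda>x. B (antip H x))"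
  by (rule coalgebra_map_comp[OF H.coalg_axioms H.coalg_axioms antip_map B_map])

lemma Bt_map: "coalgebra_map H H Bt"
  by (rule coalgebra_map_cong[OF H.coalg_axioms conv_map[OF cocoalg_H coalgebra_map_id[OF H.coalg_axioms] BS_map]])
     (simp add: Bt_conv)

lemmas Bt_lin = coalgebra_map_linear[OF Bt_map]
lemmas Btm = linear_mapD[OF Bt_lin]

lemma Bt_gen:
  assumes T: "cocoalg T" and f: "f \<in> carrier (gen H T)"
  shows "gBt T f = compose (carr T) Bt f"
proof -
  interpret T: cocoalg T by fact
  interpret R: rb_group "gen H T" "Bop T" by (rule rb_group_gen[OF T])
  note m = coalgebra_mapD[OF gen_map[OF f]]
  have "gBt T f = conv H T f (compose (carr T) (\<lambda>x. B (antip H x)) f)"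
    by (simp add: R.Bt_def beta_gen[OF T f] gen_mult)
  also have "\<dots> = conv H T f (\<lambda>x. B (antip H (f x)))"
    by (rule conv_cong) (simp_all add: compose_def)
  also have "\<dots> = compose (carr T) Bt f"
  proof
    fix d
    show "conv H T f (\<lambda>x. B (antip H (f x))) d = compose (carr T) Bt f d"
      using conv_pull[OF T.coalg_axioms H.coalg_axioms gen_map[OF f] linear_map_id coalgebra_map_linear[OF BS_map], of d] m(1)
      by (cases "d \<in> carr T") (simp_all add: compose_def Bt_conv, simp add: conv_def)
  qed
  finally show ?thesis .
qed

text \<open>\<open>rb_antip\<close> is a convolution of three maps; the group product is bracketed
  to the right to match the nesting of \<open>sweedler3\<close>.\<close>

lemma SB_gen:
  assumes T: "cocoalg T" and f: "f \<in> carrier (gen H T)"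
  shows "rb_group.SB (gen H T) (Bop T) f = compose (carr T) (rb_antip H B) f"
proof -
  interpret T: cocoalg T by fact
  interpret R: rb_group "gen H T" "Bop T" by (rule rb_group_gen[OF T])
  note m = coalgebra_mapD[OF gen_map[OF f]]
  note [simp] = Bop_gen[OF T.coalg_axioms f] f
  have SBl: "linear_map H H (\<lambda>x. antip H (B x))" by (rule linear_map_comp[OF B_lin antip_linear])
  have cl: "linear_map H H (conv H H (antip H) B)" by (rule conv_linear[OF cocoalg_H antip_linear B_lin])
  have "rb_antip H B x = sweedler H (scal H) x (\<lambda>a b. mul H (antip H (B a)) (conv H H (antip H) B b))" for x
    unfolding rb_antip_def sweedler3_def
  proof (rule sweedler_cong)
    fix a b assume *: "a \<in> carr H" "b \<in> carr H"
    have "mul H (antip H (B a)) (conv H H (antip H) B b) =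
        sweedler H (scal H) b (\<lambda>x2 x3. mul H (antip H (B a)) (mul H (antip H x2) (B x3)))"
      using * unfolding conv_def
      by simp (rule H.sweedler_apply[OF H.vs H.vs H.sub _ conv_bilin[OF antip_linear B_lin]],
        simp_all add: mul_lin Bm Sm)
    also have "\<dots> = sweedler H (scal H) b (\<lambda>x2 x3. mul H (mul H (antip H (B a)) (antip H x2)) (B x3))"
      by (rule sweedler_cong) (simp add: mul_assoc * Bm Sm)
    finally show "sweedler H (scal H) b (\<lambda>x2 x3. mul H (mul H (antip H (B a)) (antip H x2)) (B x3)) =
      mul H (antip H (B a)) (conv H H (antip H) B b)" by simp
  qed
  then have rb: "rb_antip H B x = conv H H (\<lambda>x. antip H (B x)) (conv H H (antip H) B) x" if "x \<in> carr H" for x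
    using that by (simp add: conv_def[of H H "\<lambda>x. antip H (B x)"])
  have "R.SB f = inv\<^bsub>gen H T\<^esub> (Bop T f) \<otimes>\<^bsub>gen H T\<^esub> (inv\<^bsub>gen H T\<^esub> f \<otimes>\<^bsub>gen H T\<^esub> Bop T f)"
    by (simp add: R.SB_def R.m_assoc)
  also have "\<dots> = conv H T (\<lambda>x. antip H (B (f x))) (conv H T (\<lambda>x. antip H (f x)) (\<lambda>x. B (f x)))"
    unfolding gen_mult gen_inv[OF T f] gen_inv[OF T Bop_gen[OF T.coalg_axioms f]]
    by (intro conv_cong) (auto simp: compose_def cong: conv_cong intro!: arg_cong2[where f = "\<lambda>f. conv H T f"] fun_cong[OF conv_cong])
  also have "\<dots> = compose (carr T) (rb_antip H B) f"
  proof
    fix d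
    have "conv H T (\<lambda>x. antip H (B (f x))) (conv H T (\<lambda>x. antip H (f x)) (\<lambda>x. B (f x))) =
        conv H T (\<lambda>x. antip H (B (f x))) (\<lambda>x. conv H H (antip H) B (f x))"
      by (rule conv_cong) (simp_all add: conv_pull[OF T.coalg_axioms H.coalg_axioms gen_map[OF f] antip_linear B_lin])
    then show "conv H T (\<lambda>x. antip H (B (f x))) (conv H T (\<lambda>x. antip H (f x)) (\<lambda>x. B (f x))) d =
        compose (carr T) (rb_antip H B) f d"
      using conv_pull[OF T.coalg_axioms H.coalg_axioms gen_map[OF f] SBl cl, of d] m(1)
      by (cases "d \<in> carr T") (simp_all add: compose_def rb, simp add: conv_def)
  qed
  finally show ?thesis .
qed

text \<open>These operations are words in products, inverses and compositions with \<open>B\<close>,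
  each of which commutes with a change of test coalgebra.\<close>

lemma pull_rb:
  assumes S: "cocoalg S" and T: "cocoalg T" and h: "coalgebra_map S T h"
  shows "f \<in> carrier (gen H T) \<Longrightarrow> compose (carr S) (gBt T f) h = gBt S (compose (carr S) f h)"
    and "f \<in> carrier (gen H T) \<Longrightarrow> compose (carr S) (gbeta T f) h = gbeta S (compose (carr S) f h)"
    and "f \<in> carrier (gen H T) \<Longrightarrow> g \<in> carrier (gen H T) \<Longrightarrow>
      compose (carr S) (gract T f g) h = gract S (compose (carr S) f h) (compose (carr S) g h)"
proof -
  interpret S: cocoalg S by fact
  interpret T: cocoalg T by fact
  interpret RS: rb_group "gen H S" "Bop S" by (rule rb_group_gen[OF S])
  interpret RT: rb_group "gen H T" "Bop T" by (rule rb_group_gen[OF T])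
  note pm = pull_mult[OF S.coalg_axioms T.coalg_axioms h] and pi = pull_inv[OF S T h]
  have pc: "compose (carr S) (compose (carr T) k F) h = compose (carr S) k (compose (carr S) F h)" for k :: "'h \<Rightarrow> 'h" and F
    by (rule pull_comp) (rule coalgebra_mapD(1)[OF h])
  show b: "compose (carr S) (gbeta T f) h = gbeta S (compose (carr S) f h)" if "f \<in> carrier (gen H T)" for f
    using that by (simp add: RS.beta_def RT.beta_def pc pi)
  show Bt: "compose (carr S) (gBt T f) h = gBt S (compose (carr S) f h)" if "f \<in> carrier (gen H T)" for f
    using that by (simp add: RS.Bt_def RT.Bt_def b pm)
  show "compose (carr S) (gract T f g) h = gract S (compose (carr S) f h) (compose (carr S) g h)"
    if "f \<in> carrier (gen H T)" "g \<in> carrier (gen H T)"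
    using that by (simp add: RS.ract_def RT.ract_def RS.SB_def RT.SB_def pc pi pm Bt)
qed

end

section \<open>The matched pair\<close>

context rota_baxter
begin

sublocale R: rb_group "gen H HH" "Bop HH" by (rule rb_group_gen[OF HH_cocoalg])

text \<open>The actions as functions of the representatives, \<open>P1\<close> standing for
  \<open>x\<close> in \<open>B x\<close> and \<open>P2\<close> for \<open>y\<close> in
  \<open>Bt y\<close>. In this form they are elements of the group at \<open>HH\<close> before the
  actions are known to be well defined.\<close>

definition univ_left where "univ_left = R.Bt (Bop HH P1 \<otimes>\<^bsub>gen H HH\<^esub> P2 \<otimes>\<^bsub>gen H HH\<^esub> inv\<^bsub>gen H HH\<^esub> (Bop HH P1))"
definition univ_right where "univ_right = R.ract P1 P2"

lemmas Bop_HH_closed [simp] = Bop_gen[OF HH.X.coalg_axioms, simplified]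

lemma univ_left_gen [simp]: "univ_left \<in> carrier (gen H HH)" and univ_right_gen [simp]: "univ_right \<in> carrier (gen H HH)"
  unfolding univ_left_def univ_right_def
  by (intro R.closed R.m_closed R.inv_closed R.B_closed R.ract_closed P12_gen)+

text \<open>\<open>rb_antip\<close> is \<open>SB\<close> of the identity in the group
  \<open>gen H H\<close>, hence a coalgebra map.\<close>

lemma rb_antip_lin: "linear_map H H (rb_antip H B)"
proof -
  interpret RH: rb_group "gen H H" "Bop H" by (rule rb_group_gen[OF cocoalg_H])
  have i: "restrict (\<lambda>x. x) (carr H) \<in> carrier (gen H H)"
    by (rule gen_carrierI, rule coalgebra_map_cong[OF H.coalg_axioms coalgebra_map_id[OF H.coalg_axioms]]) simp_all
  have "coalgebra_map H H (compose (carr H) (rb_antip H B) (restrict (\<lambda>x. x) (carr H)))"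
    using gen_map[OF RH.SB_closed[OF i]] by (simp add: SB_gen[OF cocoalg_H i])
  then show ?thesis
    by (rule coalgebra_map_linear[OF coalgebra_map_cong[OF H.coalg_axioms]]) (simp add: compose_def)
qed

lemma univ_left_eval:
  assumes x: "x \<in> carr H" and y: "y \<in> carr H"
  shows "univ_left (htens H H x y) = Bt (sweedler H (scal H) x (\<lambda>x1 x2. mul H (mul H (B x1) y) (antip H (B x2))))"
proof -
  have "inv\<^bsub>gen H HH\<^esub> (Bop HH P1) = compose (carr HH) (\<lambda>x. antip H (B x)) P1"
    unfolding gen_inv[OF HH_cocoalg Bop_gen[OF HH.X.coalg_axioms P12_gen(1)]] compose_compose ..
  moreover have "(Bop HH P1 \<otimes>\<^bsub>gen H HH\<^esub> P2 \<otimes>\<^bsub>gen H HH\<^esub> compose (carr HH) (\<lambda>x. antip H (B x)) P1) (htens H H x y) =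
     sweedler H (scal H) x (\<lambda>a b. mul H ((Bop HH P1 \<otimes>\<^bsub>gen H HH\<^esub> P2) (htens H H a y)) (antip H (B b)))"
    by (rule eval_right1[OF _ linear_map_comp[OF B_lin antip_linear] x y]) simp
  moreover have "\<dots> = sweedler H (scal H) x (\<lambda>x1 x2. mul H (mul H (B x1) y) (antip H (B x2)))"
    by (rule sweedler_cong) (use eval_12[OF B_lin linear_map_id _ y] in \<open>simp add: compose_id[simplified]\<close>)
  moreover have "univ_left = compose (carr HH) Bt (Bop HH P1 \<otimes>\<^bsub>gen H HH\<^esub> P2 \<otimes>\<^bsub>gen H HH\<^esub> inv\<^bsub>gen H HH\<^esub> (Bop HH P1))"
    unfolding univ_left_def
    by (rule Bt_gen[OF HH_cocoalg]) (intro R.m_closed R.inv_closed R.B_closed P12_gen)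
  ultimately show ?thesis using x y by (simp add: compose_eq)
qed

lemma univ_right_eval:
  assumes x: "x \<in> carr H" and y: "y \<in> carr H"
  shows "univ_right (htens H H x y) = antip H (B (sweedler H (scal H) y (\<lambda>y1 y2.
      mul H (mul H (antip H (Bt y1)) (rb_antip H B x)) (Bt y2))))"
proof -
  have b: "R.Bt P2 = compose (carr HH) Bt P2" by (rule Bt_gen[OF HH_cocoalg P12_gen(2)])
  have sb: "R.SB P1 = compose (carr HH) (rb_antip H B) P1" by (rule SB_gen[OF HH_cocoalg P12_gen(1)])
  have i: "inv\<^bsub>gen H HH\<^esub> (R.Bt P2) = compose (carr HH) (\<lambda>x. antip H (Bt x)) P2"
    by (subst gen_inv[OF HH_cocoalg]) (simp_all only: R.closed P12_gen, simp only: b compose_compose)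
  have "(compose (carr HH) (\<lambda>x. antip H (Bt x)) P2 \<otimes>\<^bsub>gen H HH\<^esub> compose (carr HH) (rb_antip H B) P1 \<otimes>\<^bsub>gen H HH\<^esub> compose (carr HH) Bt P2) (htens H H x y) =
     sweedler H (scal H) y (\<lambda>a b. mul H ((compose (carr HH) (\<lambda>x. antip H (Bt x)) P2 \<otimes>\<^bsub>gen H HH\<^esub> compose (carr HH) (rb_antip H B) P1) (htens H H x a)) (Bt b))"
    by (rule eval_right2[OF _ Bt_lin x y]) (simp only: i[symmetric] sb[symmetric] R.m_closed R.inv_closed R.closed R.SB_closed P12_gen)
  also have "\<dots> = sweedler H (scal H) y (\<lambda>y1 y2. mul H (mul H (antip H (Bt y1)) (rb_antip H B x)) (Bt y2))"
    by (rule sweedler_cong) (simp only: eval_21[OF linear_map_comp[OF Bt_lin antip_linear] rb_antip_lin x])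
  finally have e: "(inv\<^bsub>gen H HH\<^esub> (R.Bt P2) \<otimes>\<^bsub>gen H HH\<^esub> R.SB P1 \<otimes>\<^bsub>gen H HH\<^esub> R.Bt P2) (htens H H x y) = \<dots>"
    unfolding i unfolding sb b .
  have "univ_right = compose (carr HH) (antip H) (Bop HH (inv\<^bsub>gen H HH\<^esub> (R.Bt P2) \<otimes>\<^bsub>gen H HH\<^esub> R.SB P1 \<otimes>\<^bsub>gen H HH\<^esub> R.Bt P2))"
    unfolding univ_right_def R.ract_def
    by (rule gen_inv[OF HH_cocoalg]) (simp only: R.B_closed R.m_closed R.inv_closed R.closed R.SB_closed P12_gen)
  then show ?thesis using e x y by (simp add: compose_eq)
qed

text \<open>\<open>q\<close> is the map f \<otimes> g on H \<otimes> H. Pulling back along it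
  substitutes \<open>f\<close> and \<open>g\<close> at the generic elements, and every pullback of
  this kind depends on \<open>x\<close> and \<open>y\<close> only through \<open>f x\<close> and
  \<open>g y\<close>.\<close>

lemma prod_map:
  assumes f: "coalgebra_map H H f" and g: "coalgebra_map H H g"
  defines "q \<equiv> pair HH H H (compose (carr HH) f P1) (compose (carr HH) g P2)"
  shows "coalgebra_map HH HH q"
    and "compose (carr HH) P1 q = compose (carr HH) f P1"
    and "compose (carr HH) P2 q = compose (carr HH) g P2"
    and "x \<in> carr H \<Longrightarrow> y \<in> carr H \<Longrightarrow> q (htens H H x y) = htens H H (f x) (g y)"
proof -
  note c = gen_compose[OF HH.X.coalg_axioms P12_gen(1) f] gen_compose[OF HH.X.coalg_axioms P12_gen(2) g]
  show "coalgebra_map HH HH q"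
    and "compose (carr HH) P1 q = compose (carr HH) f P1"
    and "compose (carr HH) P2 q = compose (carr HH) g P2"
    unfolding q_def by (rule pair_gen[OF HH_cocoalg c])+
  show "q (htens H H x y) = htens H H (f x) (g y)" if "x \<in> carr H" "y \<in> carr H"
    unfolding q_def
    by (rule trans[OF pair_cong HH.pair_proj[OF coalgebra_map_linear[OF f] coalgebra_map_linear[OF g] that]])
       (simp_all add: compose_def P1_def P2_def)
qed

text \<open>\<open>Bt_conj\<close> rewrites the generic left action as a word in \<open>P1\<close>
  and \<open>R.Bt P2\<close>. The same word with \<open>P2\<close> for \<open>R.Bt P2\<close> is
  \<open>Th\<close>; substituting \<open>Bt\<close> by means of \<open>q\<close> recovers
  \<open>univ_left\<close>, which therefore factors through id \<otimes> \<open>Bt\<close>.\<close>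

lemma univ_left_right_dep:
  assumes x: "x \<in> carr H" and y: "y \<in> carr H" "y' \<in> carr H" and eq: "Bt y = Bt y'"
  shows "univ_left (htens H H x y) = univ_left (htens H H x y')"
proof -
  define q where "q = pair HH H H (compose (carr HH) (\<lambda>x. x) P1) (compose (carr HH) Bt P2)"
  note q = prod_map[OF coalgebra_map_id[OF H.coalg_axioms] Bt_map, folded q_def, unfolded compose_id]
  note pm = pull_mult[OF HH.X.coalg_axioms HH.X.coalg_axioms q(1)]
  note pi = pull_inv[OF HH_cocoalg HH_cocoalg q(1)]
  note pr = pull_rb(1,2)[OF HH_cocoalg HH_cocoalg q(1)]
  \<comment> \<open>The auxiliary element of \<open>Bt_conj\<close> for \<open>s = inv P1\<close>,
    so that \<open>R.beta s\<close> is the generic \<open>B x\<close>, with \<open>P2\<close> in the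
    place of \<open>R.Bt P2\<close>.\<close>
  define k where "k = R.Bt (R.beta (inv\<^bsub>gen H HH\<^esub> P1) \<otimes>\<^bsub>gen H HH\<^esub> P2)"
  define Th where "Th = k \<otimes>\<^bsub>gen H HH\<^esub> R.beta (inv\<^bsub>gen H HH\<^esub> k \<otimes>\<^bsub>gen H HH\<^esub>
    inv\<^bsub>gen H HH\<^esub> (R.Bt (inv\<^bsub>gen H HH\<^esub> P1) \<otimes>\<^bsub>gen H HH\<^esub> P2) \<otimes>\<^bsub>gen H HH\<^esub> k)"
  note cl = R.closed R.m_closed R.inv_closed P12_gen
  have P2q: "compose (carr HH) P2 q = R.Bt P2"
    unfolding q(3) by (rule Bt_gen[OF HH_cocoalg P12_gen(2), symmetric])
  have k: "k \<in> carrier (gen H HH)" unfolding k_def by (intro cl)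
  have kq: "compose (carr HH) k q = R.Bt (R.beta (inv\<^bsub>gen H HH\<^esub> P1) \<otimes>\<^bsub>gen H HH\<^esub> R.Bt P2)"
    unfolding k_def
    by (simp only: pm pi pr cl q(2) P2q)
  have "compose (carr HH) Th q = univ_left"
    unfolding Th_def univ_left_def R.B_beta[OF P12_gen(1)]
    by (simp only: pm pi pr cl q(2) P2q k kq R.Bt_conj)
  moreover have "compose (carr HH) Th q (htens H H x y) = compose (carr HH) Th q (htens H H x y')"
    using x y eq by (simp add: compose_def q(4))
  ultimately show ?thesis by simp
qed

text \<open>Dependence on \<open>x\<close> through \<open>B x\<close> is visible: since
  \<open>B\<close> is a coalgebra map, the sum over \<open>x\<close> is a Sweedler sum over
  \<open>B x\<close>.\<close>

lemma univ_left_dep: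
  assumes x: "x \<in> carr H" "x' \<in> carr H" and y: "y \<in> carr H" "y' \<in> carr H"
    and "B x = B x'" "Bt y = Bt y'"
  shows "univ_left (htens H H x y) = univ_left (htens H H x' y')"
proof -
  have b: "H.bilin (scal H) (\<lambda>u v. mul H (mul H u y) (antip H v))"
    by (intro bilinear_onI linear_onI; simp add: y Sm linear_onD[OF Sm(2)])
  have "univ_left (htens H H x y) = Bt (sweedler H (scal H) (B x) (\<lambda>u v. mul H (mul H u y) (antip H v)))" if "x \<in> carr H" for x
    unfolding univ_left_eval[OF that y(1)]
    by (simp only: sweedler_cmap[OF H.coalg_axioms H.coalg_axioms H.vs b that B_map])
  then have "univ_left (htens H H x y) = univ_left (htens H H x' y)" using x assms(5) by simp
  then show ?thesis using univ_left_right_dep[OF x(2) y assms(6)] by simp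
qed

text \<open>The roles are reversed. Dependence on \<open>y\<close> through \<open>Bt y\<close> is
  visible, whereas \<open>rb_antip\<close> hides the dependence on \<open>x\<close>. Solving
  \<open>factor\<close> for the right action gives a word in the left action, \<open>B x\<close> and
  \<open>Bt y\<close>, where \<open>x\<close> occurs only as \<open>B x\<close>.\<close>

lemma univ_right_dep:
  assumes x: "x \<in> carr H" "x' \<in> carr H" and y: "y \<in> carr H" "y' \<in> carr H"
    and "B x = B x'" "Bt y = Bt y'"
  shows "univ_right (htens H H x y) = univ_right (htens H H x' y')"
proof -
  have b: "H.bilin (scal H) (\<lambda>u v. mul H (mul H (antip H u) (rb_antip H B x)) v)"
    by (intro bilinear_onI linear_onI; simp add: x Sm linear_onD[OF Sm(2)] linear_mapD[OF rb_antip_lin])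
  have 1: "univ_right (htens H H x y) = antip H (B (sweedler H (scal H) (Bt y) (\<lambda>u v. mul H (mul H (antip H u) (rb_antip H B x)) v)))" if "y \<in> carr H" for y
    unfolding univ_right_eval[OF x(1) that]
    by (simp only: sweedler_cmap[OF H.coalg_axioms H.coalg_axioms H.vs b that Bt_map])
  define q where "q = pair HH H H (Bop HH P1) (compose (carr HH) (\<lambda>x. x) P2)"
  note q = prod_map[OF B_map coalgebra_map_id[OF H.coalg_axioms], folded q_def, unfolded compose_id]
  note pm = pull_mult[OF HH.X.coalg_axioms HH.X.coalg_axioms q(1)]
  note pi = pull_inv[OF HH_cocoalg HH_cocoalg q(1)]
  note pr = pull_rb(1,2)[OF HH_cocoalg HH_cocoalg q(1)]
  note cl = R.closed R.m_closed R.inv_closed P12_gen R.B_closed R.ract_closed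
  \<comment> \<open>The word obtained from \<open>factor\<close>, with \<open>P1\<close> in the
    place of \<open>Bop HH P1\<close>.\<close>
  define Xi where "Xi = inv\<^bsub>gen H HH\<^esub> (R.Bt (P1 \<otimes>\<^bsub>gen H HH\<^esub> P2 \<otimes>\<^bsub>gen H HH\<^esub> inv\<^bsub>gen H HH\<^esub> P1)) \<otimes>\<^bsub>gen H HH\<^esub> (P1 \<otimes>\<^bsub>gen H HH\<^esub> R.Bt P2)"
  have "compose (carr HH) Xi q = inv\<^bsub>gen H HH\<^esub> univ_left \<otimes>\<^bsub>gen H HH\<^esub> (Bop HH P1 \<otimes>\<^bsub>gen H HH\<^esub> R.Bt P2)"
    unfolding Xi_def univ_left_def by (simp only: pm pi pr cl q(2,3))
  also have "\<dots> = univ_right"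
    unfolding R.factor[OF P12_gen(2,1), symmetric] univ_right_def univ_left_def by (simp only: R.cancel cl)
  finally have "univ_right = compose (carr HH) Xi q" by simp
  then have "univ_right (htens H H x y') = univ_right (htens H H x' y')"
    using x y assms(5) by (simp add: compose_def q(4))
  moreover have "univ_right (htens H H x y) = univ_right (htens H H x y')"
    unfolding 1[OF y(1)] 1[OF y(2)] assms(6) ..
  ultimately show ?thesis by simp
qed

text \<open>Consistency on fibres lets the function be defined by choosing preimages. Besides the
  two actions it serves the maps on the double cross product, with the arguments in the other
  order.\<close>

lemma action_exists:
  assumes "\<And>x x' y y'. x \<in> carr H \<Longrightarrow> x' \<in> carr H \<Longrightarrow> y \<in> carr H \<Longrightarrow> y' \<in> carr H \<Longrightarrow>
    B x = B x' \<Longrightarrow> Bt y = Bt y' \<Longrightarrow> F x y = F x' y'"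
  shows "\<exists>l. \<forall>x\<in>carr H. \<forall>y\<in>carr H. l (B x) (Bt y) = F x y"
proof (intro exI ballI)
  fix x y assume x: "x \<in> carr H" and y: "y \<in> carr H"
  define x' where "x' = (SOME x'. x' \<in> carr H \<and> B x' = B x)"
  define y' where "y' = (SOME y'. y' \<in> carr H \<and> Bt y' = Bt y)"
  have "x' \<in> carr H \<and> B x' = B x" "y' \<in> carr H \<and> Bt y' = Bt y"
    unfolding x'_def y'_def by (rule someI[of _ x], use x in simp, rule someI[of _ y], use y in simp)
  then have "F x' y' = F x y" by (intro assms x y) simp_all
  then show "(\<lambda>u a. F (SOME x'. x' \<in> carr H \<and> B x' = u) (SOME y'. y' \<in> carr H \<and> Bt y' = a)) (B x) (Bt y) = F x y"
    by (simp add: x'_def y'_def)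
qed

abbreviation lact where "lact \<equiv> rb_left H B"
abbreviation ract where "ract \<equiv> rb_right H B"
abbreviation Hm where "Hm \<equiv> rb_minus H B"
abbreviation Hp where "Hp \<equiv> rb_plus H B"

text \<open>\<open>rb_left\<close> is a choice, so its equation becomes available once a solution
  exists; existence is \<open>univ_left_dep\<close>.\<close>

lemma lact:
  assumes "x \<in> carr H" "y \<in> carr H"
  shows "lact (B x) (Bt y) = univ_left (htens H H x y)"
proof -
  let ?F = "\<lambda>x y. Bt (sweedler H (scal H) x (\<lambda>x1 x2. mul H (mul H (B x1) y) (antip H (B x2))))"
  let ?P = "\<lambda>l. \<forall>x\<in>carr H. \<forall>y\<in>carr H. l (B x) (Bt y) = ?F x y"
  have "\<exists>l. ?P l"
  proof (rule action_exists)
    fix x x' y y' assume *: "x \<in> carr H" "x' \<in> carr H" "y \<in> carr H" "y' \<in> carr H" "B x = B x'" "Bt y = Bt y'"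
    from univ_left_dep[OF *] show "?F x y = ?F x' y'" unfolding univ_left_eval[OF *(1,3)] univ_left_eval[OF *(2,4)] .
  qed
  then have "?P (rb_left H B)" unfolding rb_left_def by (rule someI_ex)
  then show ?thesis using assms by (simp only: univ_left_eval)
qed

lemma ract:
  assumes "x \<in> carr H" "y \<in> carr H"
  shows "ract (B x) (Bt y) = univ_right (htens H H x y)"
proof -
  let ?F = "\<lambda>x y. antip H (B (sweedler H (scal H) y (\<lambda>y1 y2.
      mul H (mul H (antip H (Bt y1)) (rb_antip H B x)) (Bt y2))))"
  let ?P = "\<lambda>r. \<forall>x\<in>carr H. \<forall>y\<in>carr H. r (B x) (Bt y) = ?F x y"
  have "\<exists>r. ?P r"
  proof (rule action_exists)
    fix x x' y y' assume *: "x \<in> carr H" "x' \<in> carr H" "y \<in> carr H" "y' \<in> carr H" "B x = B x'" "Bt y = Bt y'"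
    from univ_right_dep[OF *] show "?F x y = ?F x' y'" unfolding univ_right_eval[OF *(1,3)] univ_right_eval[OF *(2,4)] .
  qed
  then have "?P (rb_right H B)" unfolding rb_right_def by (rule someI_ex)
  then show ?thesis using assms by (simp only: univ_right_eval)
qed

lemma sub_simps [simp]:
  "carr Hm = Bt ` carr H" "scal Hm = scal H" "mul Hm = mul H" "unt Hm = unt H" "comul Hm = comul H"
  "counit Hm = counit H" "antip Hm = antip H"
  "carr Hp = B ` carr H" "scal Hp = scal H" "mul Hp = mul H" "unt Hp = unt H" "comul Hp = comul H"
  "counit Hp = counit H" "antip Hp = antip H"
  by (simp_all add: rb_minus_def rb_plus_def)

text \<open>Elementary tensors depend only on the ambient scalar multiplication, which the
  subobjects keep; tensors over \<open>Hm\<close> and \<open>Hp\<close> are literally tensors over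
  \<open>H\<close>.\<close>

lemma htens_sub [simp]: "htens Hm Hp = htens H H" "htens Hm Hm = htens H H" "htens Hp Hp = htens H H"
  by (simp_all add: htens_def fun_eq_iff)

lemma pair_sub: "pair T Hm Hp = pair T H H"
  by (simp add: pair_def fun_eq_iff)

lemma sub_H: "a \<in> carr Hm \<Longrightarrow> a \<in> carr H" "u \<in> carr Hp \<Longrightarrow> u \<in> carr H"
  by (auto simp: Bm Btm)

lemma Bt_Hm: "coalgebra_map H Hm Bt" and B_Hp: "coalgebra_map H Hp B"
  using Bt_map B_map by (auto simp: coalgebra_map_def linear_map_def)

lemma Hm_cocoalg: "cocoalg Hm"
proof -
  have sub: "carr Hm \<subseteq> carr H" using Btm(1) by auto
  have "vector_space (scal Hm)" "module.subspace (scal Hm) (carr Hm)"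
    "linear_on (scal Hm) tscale (carr Hm) (comul Hm)" "linear_on (scal Hm) (*) (carr Hm) (counit Hm)"
    "Bt ` carr H = carr Hm"
    using linear_on_mono[OF H.comul_lin sub] linear_on_mono[OF H.counit_lin sub] H.vs
      subspace_image[OF H.vs H.vs Btm(2) H.sub] by (simp_all only: sub_simps)
  note c = coalgebra_image[OF H.coalg_axioms cocomm Bt_Hm this]
  show ?thesis by (intro cocoalg.intro cocoalg_axioms.intro c)
qed

lemma Hp_cocoalg: "cocoalg Hp"
proof -
  have sub: "carr Hp \<subseteq> carr H" using Bm(1) by auto
  have "vector_space (scal Hp)" "module.subspace (scal Hp) (carr Hp)"
    "linear_on (scal Hp) tscale (carr Hp) (comul Hp)" "linear_on (scal Hp) (*) (carr Hp) (counit Hp)"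
    "B ` carr H = carr Hp"
    using linear_on_mono[OF H.comul_lin sub] linear_on_mono[OF H.counit_lin sub] H.vs
      subspace_image[OF H.vs H.vs Bm(2) H.sub] by (simp_all only: sub_simps)
  note c = coalgebra_image[OF H.coalg_axioms cocomm B_Hp this]
  show ?thesis by (intro cocoalg.intro cocoalg_axioms.intro c)
qed

sublocale Hm: cocoalg Hm by (rule Hm_cocoalg)
sublocale Hp: cocoalg Hp by (rule Hp_cocoalg)
sublocale D: coalg2 Hm Hp lact ract ..

abbreviation DD where "DD \<equiv> dcp Hp Hm lact ract"

lemma gBt_minus:
  assumes T: "cocoalg T" and f: "f \<in> carrier (gen H T)" and d: "d \<in> carr T"
  shows "gBt T f d \<in> carr Hm"
  using d coalgebra_mapD(1)[OF gen_map[OF f] d] by (simp add: Bt_gen[OF T f] compose_def)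

lemma gplus_plus:
  assumes T: "cocoalg T" and f: "f \<in> rb_group.plus (gen H T) (Bop T)" and d: "d \<in> carr T"
  shows "f d \<in> carr Hp"
proof -
  interpret RT: rb_group "gen H T" "Bop T" by (rule rb_group_gen[OF T])
  from f obtain g where g: "f = Bop T g" "g \<in> carrier (gen H T)" by (auto simp: RT.plus_def)
  then show ?thesis using d coalgebra_mapD(1)[OF gen_map[OF g(2)] d] by (simp add: compose_def)
qed

lemma lact_in: assumes "u \<in> carr Hp" "a \<in> carr Hm" shows "lact u a \<in> carr Hm"
proof -
  from assms obtain x y where u: "u = B x" "a = Bt y" and xy: "x \<in> carr H" "y \<in> carr H" by auto
  have "univ_left (htens H H x y) \<in> carr Hm"
    unfolding univ_left_def
    by (rule gBt_minus[OF HH_cocoalg]) (intro R.m_closed R.inv_closed R.B_closed P12_gen, simp add: xy)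
  then show ?thesis by (simp only: u lact[OF xy])
qed

lemma univ_right_plus: "univ_right \<in> R.plus"
  unfolding univ_right_def R.ract_def
  by (intro R.plus_inv R.B_plus R.m_closed R.inv_closed R.closed R.SB_closed P12_gen)

lemma ract_in: assumes "u \<in> carr Hp" "a \<in> carr Hm" shows "ract u a \<in> carr Hp"
proof -
  from assms obtain x y where "u = B x" "a = Bt y" and xy: "x \<in> carr H" "y \<in> carr H" by auto
  then show ?thesis
    using gplus_plus[OF HH_cocoalg univ_right_plus, of "htens H H x y"] by (simp add: ract)
qed

text \<open>Sums and multiples in \<open>Hp\<close> and \<open>Hm\<close> can be formed on
  representatives because \<open>B\<close> and \<open>Bt\<close> are linear, and there
  \<open>f\<close> is the linear map \<open>F\<close>.\<close>

lemma act_bilinear: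
  assumes F: "F \<in> carrier (gen H HH)"
    and f: "\<And>x y. x \<in> carr H \<Longrightarrow> y \<in> carr H \<Longrightarrow> f (B x) (Bt y) = F (htens H H x y)"
  shows "bilinear_on (scal H) (scal H) (scal H) (carr Hp) (carr Hm) f"
proof -
  note l = coalgebra_mapD(2)[OF gen_map[OF F], simplified]
  note [simp] = linear_onD[OF l]
  show ?thesis
    by (intro bilinear_onI linear_onI)
       (auto simp: f linear_onD[OF Bm(2), symmetric] linear_onD[OF Btm(2), symmetric])
qed

lemmas lact_bilinear = act_bilinear[OF univ_left_gen, of lact, OF lact]
lemmas ract_bilinear = act_bilinear[OF univ_right_gen, of ract, OF ract]

end

section \<open>The double cross product\<close>

context rota_baxter
begin

declare sub_simps(1,8)[simp del]

lemma lact_linD: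
  "u \<in> carr Hp \<Longrightarrow> v \<in> carr Hp \<Longrightarrow> a \<in> carr Hm \<Longrightarrow> lact (u + v) a = lact u a + lact v a"
  "u \<in> carr Hp \<Longrightarrow> a \<in> carr Hm \<Longrightarrow> lact (scal H c u) a = scal H c (lact u a)"
  "u \<in> carr Hp \<Longrightarrow> a \<in> carr Hm \<Longrightarrow> b \<in> carr Hm \<Longrightarrow> lact u (a + b) = lact u a + lact u b"
  "u \<in> carr Hp \<Longrightarrow> a \<in> carr Hm \<Longrightarrow> lact u (scal H c a) = scal H c (lact u a)"
  using lact_bilinear by (simp_all add: bilinear_on_def linear_on_def)

lemma ract_linD:
  "u \<in> carr Hp \<Longrightarrow> v \<in> carr Hp \<Longrightarrow> a \<in> carr Hm \<Longrightarrow> ract (u + v) a = ract u a + ract v a"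
  "u \<in> carr Hp \<Longrightarrow> a \<in> carr Hm \<Longrightarrow> ract (scal H c u) a = scal H c (ract u a)"
  "u \<in> carr Hp \<Longrightarrow> a \<in> carr Hm \<Longrightarrow> b \<in> carr Hm \<Longrightarrow> ract u (a + b) = ract u a + ract u b"
  "u \<in> carr Hp \<Longrightarrow> a \<in> carr Hm \<Longrightarrow> ract u (scal H c a) = scal H c (ract u a)"
  using ract_bilinear by (simp_all add: bilinear_on_def linear_on_def)

abbreviation dmul where "dmul \<equiv> dcp_mul Hp Hm lact ract"

definition elem_mul where
  "elem_mul a u a' u' = sweedler Hp tscale u (\<lambda>u1 u2. sweedler Hm tscale a' (\<lambda>a1 a2.
    htens H H (mul H a (lact u1 a1)) (mul H (ract u2 a2) u')))"

lemma elem_mul_inner: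
  assumes "a \<in> carr Hm" "u' \<in> carr Hp"
  shows "a1 \<in> carr Hm \<Longrightarrow> a2 \<in> carr Hm \<Longrightarrow>
      Hp.bilin tscale (\<lambda>u1 u2. htens H H (mul H a (lact u1 a1)) (mul H (ract u2 a2) u'))"
    and "u1 \<in> carr Hp \<Longrightarrow> u2 \<in> carr Hp \<Longrightarrow>
      Hm.bilin tscale (\<lambda>a1 a2. htens H H (mul H a (lact u1 a1)) (mul H (ract u2 a2) u'))"
proof -
  note [simp] = sub_H lact_in ract_in assms lact_linD ract_linD
  show "a1 \<in> carr Hm \<Longrightarrow> a2 \<in> carr Hm \<Longrightarrow>
      Hp.bilin tscale (\<lambda>u1 u2. htens H H (mul H a (lact u1 a1)) (mul H (ract u2 a2) u'))"
    by (intro bilinear_onI linear_onI; simp)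
  show "u1 \<in> carr Hp \<Longrightarrow> u2 \<in> carr Hp \<Longrightarrow>
      Hm.bilin tscale (\<lambda>a1 a2. htens H H (mul H a (lact u1 a1)) (mul H (ract u2 a2) u'))"
    by (intro bilinear_onI linear_onI; simp)
qed

lemma elem_mul_lin:
  assumes "a \<in> carr Hm" "u \<in> carr Hp" "a' \<in> carr Hm" "u' \<in> carr Hp"
  shows "linear_on (scal H) tscale (carr Hm) (\<lambda>a. elem_mul a u a' u')"
    and "linear_on (scal H) tscale (carr Hp) (\<lambda>u. elem_mul a u a' u')"
    and "linear_on (scal H) tscale (carr Hm) (\<lambda>a'. elem_mul a u a' u')"
    and "linear_on (scal H) tscale (carr Hp) (\<lambda>u'. elem_mul a u a' u')"
proof -
  interpret PM: coalg2 Hp Hm undefined undefined ..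
  note vt = vector_space_tscale
  note [simp] = sub_H lact_in ract_in
  have sub: "module.subspace (scal H) (carr Hm)" "module.subspace (scal H) (carr Hp)"
    using Hm.sub Hp.sub by simp_all
  note b = PM.bilin_sweedler2[OF vt elem_mul_inner(2,1), folded elem_mul_def, simplified]
  note b2 = PM.bilin_sweedler2(1)[OF vt elem_mul_inner(2,1)]
  show "linear_on (scal H) tscale (carr Hp) (\<lambda>u. elem_mul a u a' u')"
    and "linear_on (scal H) tscale (carr Hm) (\<lambda>a'. elem_mul a u a' u')"
    using b(2)[of a u'] assms by (auto simp: bilinear_on_def)
  show "linear_on (scal H) tscale (carr Hm) (\<lambda>a. elem_mul a u a' u')"
    unfolding elem_mul_def
    by (rule Hp.sweedler_param[OF vt H.vs sub(1) _ _ assms(2)], rule b2,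
        simp_all add: assms, rule Hm.sweedler_param[OF vt H.vs sub(1) _ _ assms(3)], rule elem_mul_inner(2))
      (simp_all add: assms linear_on_def)
  show "linear_on (scal H) tscale (carr Hp) (\<lambda>u'. elem_mul a u a' u')"
    unfolding elem_mul_def
    by (rule Hp.sweedler_param[OF vt H.vs sub(2) _ _ assms(2)], rule b2,
        simp_all add: assms, rule Hm.sweedler_param[OF vt H.vs sub(2) _ _ assms(3)], rule elem_mul_inner(2))
      (simp_all add: assms linear_on_def)
qed

lemma dmul_eq: "dmul s t = hlift Hm Hp tscale (\<lambda>a u. hlift Hm Hp tscale (elem_mul a u) t) s"
proof -
  have "(\<lambda>a' u'. elem_mul a u a' u') = elem_mul a u" for a u by simp
  then show ?thesis unfolding dcp_mul_def elem_mul_def[abs_def] by simp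
qed

lemma dmul:
  shows "bilinear_on tscale tscale tscale (carr DD) (carr DD) dmul"
    and "a \<in> carr Hm \<Longrightarrow> u \<in> carr Hp \<Longrightarrow> a' \<in> carr Hm \<Longrightarrow> u' \<in> carr Hp \<Longrightarrow>
      dmul (htens H H a u) (htens H H a' u') = elem_mul a u a' u'"
proof -
  note vt = vector_space_tscale
  have b1: "bilinear_on (scal Hm) (scal Hp) tscale (carr Hm) (carr Hp) (elem_mul a u)"
    if "a \<in> carr Hm" "u \<in> carr Hp" for a u
    using elem_mul_lin that by (auto simp: bilinear_on_def)
  note h1 = D.hlift[OF vt b1]
  have b2: "bilinear_on (scal Hm) (scal Hp) tscale (carr Hm) (carr Hp) (\<lambda>a u. hlift Hm Hp tscale (elem_mul a u) t)"
    if "t \<in> carr DD" for t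
  proof (rule bilinear_onI)
    show "linear_on (scal Hm) tscale (carr Hm) (\<lambda>a. hlift Hm Hp tscale (elem_mul a u) t)" if "u \<in> carr Hp" for u
      unfolding hlift_def
      by (rule linear_on_tensor_lift_param[OF Hm.vs Hp.vs vt Hm.sub Hp.sub Hm.vs Hm.sub b1])
         (use that \<open>t \<in> carr DD\<close> elem_mul_lin in \<open>simp_all add: htensor_space_def\<close>)
    show "linear_on (scal Hp) tscale (carr Hp) (\<lambda>u. hlift Hm Hp tscale (elem_mul a u) t)" if "a \<in> carr Hm" for a
      unfolding hlift_def
      by (rule linear_on_tensor_lift_param[OF Hm.vs Hp.vs vt Hm.sub Hp.sub Hp.vs Hp.sub b1])
         (use that \<open>t \<in> carr DD\<close> elem_mul_lin in \<open>simp_all add: htensor_space_def\<close>)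
  qed
  note h2 = D.hlift[OF vt b2]
  show "bilinear_on tscale tscale tscale (carr DD) (carr DD) dmul"
    unfolding dmul_eq[abs_def]
  proof (rule bilinear_onI)
    show "linear_on tscale tscale (carr DD) (\<lambda>s. hlift Hm Hp tscale (\<lambda>a u. hlift Hm Hp tscale (elem_mul a u) t) s)"
      if "t \<in> carr DD" for t
      using h2(1)[OF that] by simp
    show "linear_on tscale tscale (carr DD) (\<lambda>t. hlift Hm Hp tscale (\<lambda>a u. hlift Hm Hp tscale (elem_mul a u) t) s)"
      if "s \<in> carr DD" for s
      unfolding hlift_def[of Hm Hp tscale "\<lambda>a u. hlift Hm Hp tscale (elem_mul a u) t" for t]
      by (rule linear_on_tensor_lift_param[OF Hm.vs Hp.vs vt Hm.sub Hp.sub vt _ b2])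
         (use that h1(1) in \<open>simp_all add: htensor_space_def[symmetric] subspace_htensor,
           simp_all add: htensor_space_def\<close>)
  qed
  show "dmul (htens H H a u) (htens H H a' u') = elem_mul a u a' u'"
    if "a \<in> carr Hm" "u \<in> carr Hp" "a' \<in> carr Hm" "u' \<in> carr Hp"
    using h2(2)[of "htens H H a' u'" a u] h1(2)[of a u a' u'] that htens_in[of a' Hm u' Hp]
    by (simp add: dmul_eq)
qed

text \<open>The actions involve only the inner entries \<open>B y\<close> and \<open>Bt x'\<close>,
  so the two Sweedler sums of the product combine into one over y \<otimes> x', on which the actions
  are \<open>univ_left\<close> and \<open>univ_right\<close>.\<close>

lemma dmul_htens:
  assumes x: "x \<in> carr H" and y: "y \<in> carr H" and x': "x' \<in> carr H" and y': "y' \<in> carr H"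
  shows "dmul (htens H H (Bt x) (B y)) (htens H H (Bt x') (B y')) =
    sweedler HH tscale (htens H H y x') (\<lambda>z1 z2. htens H H (mul H (Bt x) (univ_left z1)) (mul H (univ_right z2) (B y')))"
proof -
  interpret PM: coalg2 Hp Hm undefined undefined ..
  note vt = vector_space_tscale
  have in': "Bt x \<in> carr Hm" "Bt x' \<in> carr Hm" "B y \<in> carr Hp" "B y' \<in> carr Hp"
    using assms by (simp_all add: sub_simps(1,8))
  have inn: "\<And>x. x \<in> carr H \<Longrightarrow> Bt x \<in> carr Hm" "\<And>y. y \<in> carr H \<Longrightarrow> B y \<in> carr Hp"
    by (simp_all add: sub_simps(1,8))
  note b = PM.bilin_sweedler2(1)[OF vt elem_mul_inner(2,1)[OF in'(1,4)] in'(2)]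
  note L = linear_onD[OF linear_mapD(2)[OF gen_lin[OF univ_left_gen], simplified]]
    and Rh = linear_onD[OF linear_mapD(2)[OF gen_lin[OF univ_right_gen], simplified]]
  note mL = linear_mapD(1)[OF gen_lin[OF univ_left_gen], simplified]
    linear_mapD(1)[OF gen_lin[OF univ_right_gen], simplified]
  have bX: "HH.X.bilin tscale (\<lambda>z1 z2. htens H H (mul H (Bt x) (univ_left z1)) (mul H (univ_right z2) (B y')))"
    by (intro bilinear_onI linear_onI; simp add: L Rh mL x y' Bm Btm)
  have "dmul (htens H H (Bt x) (B y)) (htens H H (Bt x') (B y')) = elem_mul (Bt x) (B y) (Bt x') (B y')"
    by (rule dmul(2)[OF in'(1,3,2,4)])
  also have "\<dots> = sweedler H tscale y (\<lambda>y1 y2. sweedler Hm tscale (Bt x') (\<lambda>a1 a2.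
    htens H H (mul H (Bt x) (lact (B y1) a1)) (mul H (ract (B y2) a2) (B y'))))"
    unfolding elem_mul_def
    by (rule sweedler_cmap[OF H.coalg_axioms Hp.coalg_axioms vt b y B_Hp])
  also have "\<dots> = sweedler H tscale y (\<lambda>y1 y2. sweedler H tscale x' (\<lambda>x1 x2.
    htens H H (mul H (Bt x) (lact (B y1) (Bt x1))) (mul H (ract (B y2) (Bt x2)) (B y'))))"
    by (rule sweedler_cong, rule sweedler_cmap[OF H.coalg_axioms Hm.coalg_axioms vt elem_mul_inner(2)[OF in'(1,4) inn(2) inn(2)] x' Bt_Hm])
  also have "\<dots> = sweedler H tscale y (\<lambda>y1 y2. sweedler H tscale x' (\<lambda>x1 x2.
    htens H H (mul H (Bt x) (univ_left (htens H H y1 x1))) (mul H (univ_right (htens H H y2 x2)) (B y'))))"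
    by (intro sweedler_cong) (simp add: lact ract)
  also have "\<dots> = sweedler HH tscale (htens H H y x') (\<lambda>z1 z2. htens H H (mul H (Bt x) (univ_left z1)) (mul H (univ_right z2) (B y')))"
    by (rule HH.sweedler_X[OF vt bX y x', symmetric])
  finally show ?thesis .
qed

lemma gen_in: "f \<in> carrier (gen H T) \<Longrightarrow> d \<in> carr T \<Longrightarrow> f d \<in> carr H"
  by (rule linear_mapD(1)[OF gen_lin])

lemma gen_minus: "cocoalg T \<Longrightarrow> x \<in> carrier (gen H T) \<Longrightarrow> coalgebra_map T Hm (gBt T x)"
  and gen_plus: "cocoalg T \<Longrightarrow> y \<in> carrier (gen H T) \<Longrightarrow> coalgebra_map T Hp (Bop T y)"
proof -
  assume T: "cocoalg T"
  interpret T: cocoalg T by (rule T)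
  show "coalgebra_map T Hm (gBt T x)" if "x \<in> carrier (gen H T)"
    unfolding Bt_gen[OF T that]
    by (rule coalgebra_map_cong[OF T.coalg_axioms coalgebra_map_comp[OF T.coalg_axioms H.coalg_axioms gen_map[OF that] Bt_Hm]])
       (simp add: compose_eq)
  show "coalgebra_map T Hp (Bop T y)" if "y \<in> carrier (gen H T)"
    by (rule coalgebra_map_cong[OF T.coalg_axioms coalgebra_map_comp[OF T.coalg_axioms H.coalg_axioms gen_map[OF that] B_Hp]])
       (simp add: compose_eq)
qed

text \<open>The convolution of two \<open>T\<close>-points of the double cross product obeys the
  double cross product formula inside the group \<open>gen H T\<close>. Both sides use
  \<open>d\<close> in four places; the two middle ones enter the actions through the single map
  \<open>P\<close>, and \<open>coassoc4\<close> isolates them.\<close>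

lemma mul_rule:
  assumes T: "cocoalg T"
    and x: "x \<in> carrier (gen H T)" and y: "y \<in> carrier (gen H T)"
    and x': "x' \<in> carrier (gen H T)" and y': "y' \<in> carrier (gen H T)" and d: "d \<in> carr T"
  shows "sweedler T tscale d (\<lambda>d1 d2. dmul (pair T H H (gBt T x) (Bop T y) d1) (pair T H H (gBt T x') (Bop T y') d2)) =
    pair T H H (gBt T x \<otimes>\<^bsub>gen H T\<^esub> gBt T (Bop T y \<otimes>\<^bsub>gen H T\<^esub> x' \<otimes>\<^bsub>gen H T\<^esub> inv\<^bsub>gen H T\<^esub> (Bop T y)))
      (gract T y x' \<otimes>\<^bsub>gen H T\<^esub> Bop T y') d"
proof -
  interpret T: cocoalg T by (rule T)
  interpret RT: rb_group "gen H T" "Bop T" by (rule rb_group_gen[OF T])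
  interpret PD: pairing Hm Hp lact ract T ..
  interpret PH: pairing H H undefined undefined T ..
  note vt = vector_space_tscale
  define f where "f = gBt T x" define f' where "f' = gBt T x'"
  define g where "g = Bop T y" define g' where "g' = Bop T y'"
  have fg: "f \<in> carrier (gen H T)" "f' \<in> carrier (gen H T)" "g \<in> carrier (gen H T)" "g' \<in> carrier (gen H T)"
    using x y x' y' by (simp_all add: f_def f'_def g_def g'_def)
  have cm: "coalgebra_map T Hm f" "coalgebra_map T Hp g" "coalgebra_map T Hm f'" "coalgebra_map T Hp g'"
    unfolding f_def f'_def g_def g'_def using gen_minus gen_plus T x y x' y' by blast+
  note lm = cm[THEN coalgebra_map_linear]
  define P where "P = pair T H H y x'"
  note P = pair_gen[OF T y x', folded P_def]
  define L where "L = compose (carr T) univ_left P"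
  define R' where "R' = compose (carr T) univ_right P"
  have LR: "L \<in> carrier (gen H T)" "R' \<in> carrier (gen H T)"
    unfolding L_def R'_def by (rule pull_gen[OF T.coalg_axioms HH.X.coalg_axioms P(1)]; simp)+
  have L: "L = gBt T (Bop T y \<otimes>\<^bsub>gen H T\<^esub> x' \<otimes>\<^bsub>gen H T\<^esub> inv\<^bsub>gen H T\<^esub> (Bop T y))"
  proof -
    have pc: "compose (carr T) (compose (carr HH) k F) P = compose (carr T) k (compose (carr T) F P)"
      for k :: "'h \<Rightarrow> 'h" and F
      by (rule pull_comp) (rule coalgebra_mapD(1)[OF P(1)])
    show ?thesis unfolding L_def univ_left_def
      by (simp only: pull_rb[OF T HH_cocoalg P(1)] pull_mult[OF T.coalg_axioms HH.X.coalg_axioms P(1)]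
          pull_inv[OF T HH_cocoalg P(1)] pc P(2,3) P12_gen R.B_closed R.m_closed R.inv_closed)
  qed
  have R': "R' = gract T y x'"
    unfolding R'_def univ_right_def by (simp only: pull_rb[OF T HH_cocoalg P(1)] P(2,3) P12_gen)
  define N where "N = (\<lambda>a b c e. dmul (htens H H (f a) (g b)) (htens H H (f' c) (g' e)))"
  note Mb = dmul(1)[simplified]
  note lfg = lm[THEN linear_mapD(2), simplified] and ifg = lm[THEN linear_mapD(1)]
  note Mlin = linear_onD[OF bilinear_onD(1)[OF Mb]] linear_onD[OF bilinear_onD(2)[OF Mb]]
  have hin: "htens H H (f a) (g b) \<in> htensor_space Hm Hp" "htens H H (f' a) (g' b) \<in> htensor_space Hm Hp"
    if "a \<in> carr T" "b \<in> carr T" for a b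
    using htens_in[of "f a" Hm "g b" Hp] htens_in[of "f' a" Hm "g' b" Hp] ifg that by simp_all
  have bN: "T.bilin tscale (N a b)" "T.bilin tscale (\<lambda>c e. N c e a b)" if "a \<in> carr T" "b \<in> carr T" for a b
    unfolding N_def using that
    by (intro bilinear_onI linear_onI; simp add: linear_onD[OF lfg(1)] linear_onD[OF lfg(2)]
        linear_onD[OF lfg(3)] linear_onD[OF lfg(4)] hin Mlin)+
  have pin: "pair T H H f g a \<in> htensor_space Hm Hp" "pair T H H f' g' a \<in> htensor_space Hm Hp" if "a \<in> carr T" for a
    using linear_mapD(1)[OF PD.pair_linear[OF lm(1,2)] that] linear_mapD(1)[OF PD.pair_linear[OF lm(3,4)] that]
    by (simp_all add: pair_sub)
  have step1: "dmul (pair T H H f g d1) (pair T H H f' g' d2) = sweedler T tscale d1 (\<lambda>a b. sweedler T tscale d2 (N a b))"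
    if "d1 \<in> carr T" "d2 \<in> carr T" for d1 d2
  proof -
    have "dmul (pair T H H f g d1) (pair T H H f' g' d2) =
        sweedler T tscale d1 (\<lambda>a b. dmul (htens H H (f a) (g b)) (pair T H H f' g' d2))"
      using PD.pair_apply[OF lm(1,2) vt bilinear_onD(1)[OF Mb pin(2)[OF that(2)]] that(1)]
      by (simp add: pair_sub)
    also have "\<dots> = sweedler T tscale d1 (\<lambda>a b. sweedler T tscale d2 (N a b))"
      unfolding N_def
      by (rule sweedler_cong)
         (use PD.pair_apply[OF lm(3,4) vt bilinear_onD(2)[OF Mb hin(1)] that(2)] in \<open>simp add: pair_sub\<close>)
    finally show ?thesis .
  qed
  define N' where "N' = (\<lambda>a s t e. htens H H (mul H (f a) (L s)) (mul H (R' t) (g' e)))"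
  note mfg = fg[THEN gen_lin, THEN linear_mapD(1)] LR[THEN gen_lin, THEN linear_mapD(1)]
  have lfgT: "linear_on (scal T) (scal H) (carr T) f" "linear_on (scal T) (scal H) (carr T) g'"
    "linear_on (scal T) (scal H) (carr T) L" "linear_on (scal T) (scal H) (carr T) R'"
    using fg LR linear_mapD(2)[OF gen_lin] by blast+
  note lDT = linear_onD[OF lfgT(1)] linear_onD[OF lfgT(2)] linear_onD[OF lfgT(3)] linear_onD[OF lfgT(4)]
  have bN': "T.bilin tscale (N' a b)" "T.bilin tscale (\<lambda>c e. N' c e a b)" if "a \<in> carr T" "b \<in> carr T" for a b
    unfolding N'_def using that
    by (intro bilinear_onI linear_onI; simp add: lDT mfg)+
  note lL = linear_onD[OF linear_mapD(2)[OF gen_lin[OF univ_left_gen], simplified]]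
    and lR = linear_onD[OF linear_mapD(2)[OF gen_lin[OF univ_right_gen], simplified]]
  note mL = linear_mapD(1)[OF gen_lin[OF univ_left_gen], simplified]
    linear_mapD(1)[OF gen_lin[OF univ_right_gen], simplified]
  \<comment> \<open>Only the middle pair changes: \<open>dmul_htens\<close> turns the product into a
    Sweedler sum in \<open>HH\<close>, and the coalgebra map \<open>P\<close> turns that sum into
    one over \<open>d''\<close>.\<close>
  have step3: "sweedler T tscale d'' (\<lambda>b c. N a b c e) = sweedler T tscale d'' (\<lambda>s t. N' a s t e)"
    if "a \<in> carr T" "d'' \<in> carr T" "e \<in> carr T" for a d'' e
  proof -
    let ?G = "\<lambda>z1 z2. htens H H (mul H (f a) (univ_left z1)) (mul H (univ_right z2) (g' e))"
    have bX: "HH.X.bilin tscale ?G"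
      using that by (intro bilinear_onI linear_onI; simp add: lL lR mL mfg)
    have "sweedler T tscale d'' (\<lambda>b c. N a b c e) =
        sweedler T tscale d'' (\<lambda>b c. sweedler HH tscale (htens H H (y b) (x' c)) ?G)"
    proof (rule sweedler_cong)
      fix b c assume bc: "b \<in> carr T" "c \<in> carr T"
      show "N a b c e = sweedler HH tscale (htens H H (y b) (x' c)) ?G"
        unfolding N_def f_def f'_def g_def g'_def Bt_gen[OF T x] Bt_gen[OF T x']
        using dmul_htens[OF gen_in[OF x that(1)] gen_in[OF y bc(1)] gen_in[OF x' bc(2)] gen_in[OF y' that(3)]] that bc
        by (simp add: compose_eq)
    qed
    also have "\<dots> = sweedler HH tscale (P d'') ?G"
      unfolding P_def
      by (rule PH.pair_apply[OF gen_lin[OF y] gen_lin[OF x'] vt _ that(2), symmetric])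
         (use HH.X.sweedler_lin[OF vt bX] in simp)
    also have "\<dots> = sweedler T tscale d'' (\<lambda>s t. ?G (P s) (P t))"
      by (rule sweedler_cmap[OF T.coalg_axioms HH.X.coalg_axioms vt bX that(2) P(1)])
    also have "\<dots> = sweedler T tscale d'' (\<lambda>s t. N' a s t e)"
      by (rule sweedler_cong) (simp add: N'_def L_def R'_def compose_eq)
    finally show ?thesis .
  qed
  have "sweedler T tscale d (\<lambda>d1 d2. dmul (pair T H H f g d1) (pair T H H f' g' d2)) =
      sweedler T tscale d (\<lambda>d1 d2. sweedler T tscale d1 (\<lambda>a b. sweedler T tscale d2 (N a b)))"
    by (rule sweedler_cong) (rule step1)
  also have "\<dots> = sweedler T tscale d (\<lambda>a d'. sweedler T tscale d' (\<lambda>d'' e. sweedler T tscale d'' (\<lambda>b c. N a b c e)))"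
    by (rule T.coassoc4[OF vt d bN])
  also have "\<dots> = sweedler T tscale d (\<lambda>a d'. sweedler T tscale d' (\<lambda>d'' e. sweedler T tscale d'' (\<lambda>s t. N' a s t e)))"
    by (rule sweedler_cong, rule sweedler_cong, rule step3)
  also have "\<dots> = sweedler T tscale d (\<lambda>d1 d2. sweedler T tscale d1 (\<lambda>a b. sweedler T tscale d2 (N' a b)))"
    by (rule T.coassoc4[OF vt d bN', symmetric])
  also have "\<dots> = sweedler T tscale d (\<lambda>d1 d2. htens H H (conv H T f L d1) (conv H T R' g' d2))"
  proof (rule sweedler_cong)
    fix d1 d2 assume d12: "d1 \<in> carr T" "d2 \<in> carr T"
    have "htens H H (conv H T f L d1) (conv H T R' g' d2) =
        sweedler T tscale d1 (\<lambda>a s. htens H H (mul H (f a) (L s)) (conv H T R' g' d2))"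
      unfolding conv_def[of H T f L] restrict_apply' [OF d12(1)]
      by (rule T.sweedler_apply[OF H.vs vt H.sub _ conv_bilin[OF gen_lin[OF fg(1)] gen_lin[OF LR(1)]] _ d12(1),
            where L = "\<lambda>z. htens H H z (conv H T R' g' d2)"])
         (auto simp: mfg intro!: linear_onI)
    also have "\<dots> = sweedler T tscale d1 (\<lambda>a b. sweedler T tscale d2 (N' a b))"
    proof (rule sweedler_cong)
      fix a s assume as: "a \<in> carr T" "s \<in> carr T"
      show "htens H H (mul H (f a) (L s)) (conv H T R' g' d2) = sweedler T tscale d2 (N' a s)"
        unfolding conv_def restrict_apply'[OF d12(2)] N'_def
        by (rule T.sweedler_apply[OF H.vs vt H.sub _ conv_bilin[OF gen_lin[OF LR(2)] gen_lin[OF fg(4)]] _ d12(2)])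
           (auto simp: mfg intro!: linear_onI)
    qed
    finally show "sweedler T tscale d1 (\<lambda>a b. sweedler T tscale d2 (N' a b)) =
      htens H H (conv H T f L d1) (conv H T R' g' d2)" by simp
  qed
  also have "\<dots> = pair T H H (f \<otimes>\<^bsub>gen H T\<^esub> L) (R' \<otimes>\<^bsub>gen H T\<^esub> g') d"
    by (simp add: pair_def gen_mult)
  finally show ?thesis unfolding f_def g_def f'_def g'_def L R' .
qed

end

context rota_baxter
begin

text \<open>
  \<open>elt T x g\<close> is the pair \<open>[x, g]\<close> from the beginning; \<open>admissible\<close> ensures that its second component
  lies in the image of \<open>B\<close>.
\<close>

definition elt where
  "elt T x g = pair T H H (gBt T x) (inv\<^bsub>gen H T\<^esub> (gBt T x) \<otimes>\<^bsub>gen H T\<^esub> g)"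

definition admissible where
  "admissible T x g \<longleftrightarrow> x \<in> carrier (gen H T) \<and> g \<in> carrier (gen H T) \<and>
    inv\<^bsub>gen H T\<^esub> (gBt T x) \<otimes>\<^bsub>gen H T\<^esub> g \<in> rb_group.plus (gen H T) (Bop T)"

lemma admissibleE:
  assumes T: "cocoalg T" and "admissible T x g"
  obtains y where "x \<in> carrier (gen H T)" "g \<in> carrier (gen H T)" "y \<in> carrier (gen H T)"
    "inv\<^bsub>gen H T\<^esub> (gBt T x) \<otimes>\<^bsub>gen H T\<^esub> g = Bop T y" "g = gBt T x \<otimes>\<^bsub>gen H T\<^esub> Bop T y"
proof -
  interpret RT: rb_group "gen H T" "Bop T" by (rule rb_group_gen[OF T])
  from assms(2) obtain y where y: "x \<in> carrier (gen H T)" "g \<in> carrier (gen H T)" "y \<in> carrier (gen H T)"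
    "inv\<^bsub>gen H T\<^esub> (gBt T x) \<otimes>\<^bsub>gen H T\<^esub> g = Bop T y"
    by (auto simp: admissible_def RT.plus_def)
  then have "g = gBt T x \<otimes>\<^bsub>gen H T\<^esub> Bop T y" by (simp flip: y(4) add: RT.cancel)
  with y that show ?thesis by blast
qed

lemma elt_pair:
  assumes T: "cocoalg T" and x: "x \<in> carrier (gen H T)" and y: "y \<in> carrier (gen H T)"
  shows "pair T H H (gBt T x) (Bop T y) = elt T x (gBt T x \<otimes>\<^bsub>gen H T\<^esub> Bop T y)"
    and "admissible T x (gBt T x \<otimes>\<^bsub>gen H T\<^esub> Bop T y)"
proof -
  interpret RT: rb_group "gen H T" "Bop T" by (rule rb_group_gen[OF T])
  have "inv\<^bsub>gen H T\<^esub> (gBt T x) \<otimes>\<^bsub>gen H T\<^esub> (gBt T x \<otimes>\<^bsub>gen H T\<^esub> Bop T y) = Bop T y"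
    using x y by (simp add: RT.cancel)
  then show "pair T H H (gBt T x) (Bop T y) = elt T x (gBt T x \<otimes>\<^bsub>gen H T\<^esub> Bop T y)"
    and "admissible T x (gBt T x \<otimes>\<^bsub>gen H T\<^esub> Bop T y)"
    using x y by (simp_all add: elt_def admissible_def RT.B_plus)
qed

lemma elt_map:
  assumes T: "cocoalg T" and "admissible T x g"
  shows "coalgebra_map T DD (elt T x g)"
proof -
  interpret T: cocoalg T by (rule T)
  interpret PD: pairing Hm Hp lact ract T ..
  from admissibleE[OF assms] obtain y where y: "x \<in> carrier (gen H T)" "y \<in> carrier (gen H T)"
    "inv\<^bsub>gen H T\<^esub> (gBt T x) \<otimes>\<^bsub>gen H T\<^esub> g = Bop T y" by metis
  show ?thesis
    unfolding elt_def y(3) using PD.pair_map[OF gen_minus[OF T y(1)] gen_plus[OF T y(2)]] by (simp add: pair_sub)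
qed

text \<open>\<open>left_mult\<close> and \<open>right_mult\<close> rewrite \<open>mul_rule\<close>
  in the coordinates [x, g]. The result is admissible because its second component is the inverse of
  a value of \<open>B\<close> times a value of \<open>B\<close>.\<close>

lemma elt_mul:
  assumes T: "cocoalg T" and 1: "admissible T x g" and 2: "admissible T x' g'"
  defines "X \<equiv> g \<otimes>\<^bsub>gen H T\<^esub> x' \<otimes>\<^bsub>gen H T\<^esub> inv\<^bsub>gen H T\<^esub> g \<otimes>\<^bsub>gen H T\<^esub> x"
  shows "admissible T X (g \<otimes>\<^bsub>gen H T\<^esub> g')"
    and "d \<in> carr T \<Longrightarrow> sweedler T tscale d (\<lambda>d1 d2. dmul (elt T x g d1) (elt T x' g' d2)) = elt T X (g \<otimes>\<^bsub>gen H T\<^esub> g') d"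
proof -
  interpret RT: rb_group "gen H T" "Bop T" by (rule rb_group_gen[OF T])
  obtain y where y: "x \<in> carrier (gen H T)" "g \<in> carrier (gen H T)" "y \<in> carrier (gen H T)"
    "inv\<^bsub>gen H T\<^esub> (gBt T x) \<otimes>\<^bsub>gen H T\<^esub> g = Bop T y" "g = gBt T x \<otimes>\<^bsub>gen H T\<^esub> Bop T y"
    by (rule admissibleE[OF T 1])
  obtain y' where y': "x' \<in> carrier (gen H T)" "g' \<in> carrier (gen H T)" "y' \<in> carrier (gen H T)"
    "inv\<^bsub>gen H T\<^esub> (gBt T x') \<otimes>\<^bsub>gen H T\<^esub> g' = Bop T y'" "g' = gBt T x' \<otimes>\<^bsub>gen H T\<^esub> Bop T y'"
    by (rule admissibleE[OF T 2])
  have X: "X \<in> carrier (gen H T)" using y(1,2) y'(1) by (simp add: X_def)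
  note l = RT.left_mult[OF y(1) y'(1) y(3), folded y(5), folded X_def]
  note r = RT.right_mult[OF y(1) y'(1) y(3) y'(3), folded y(5) y'(5), folded X_def]
  have "gract T y x' \<otimes>\<^bsub>gen H T\<^esub> Bop T y' \<in> RT.plus"
    unfolding RT.ract_def
    by (intro RT.plus_mult RT.plus_inv RT.B_plus RT.m_closed RT.inv_closed RT.closed RT.SB_closed y y')
  then show "admissible T X (g \<otimes>\<^bsub>gen H T\<^esub> g')"
    unfolding r using X y(2) y'(2) by (simp add: admissible_def)
  show "sweedler T tscale d (\<lambda>d1 d2. dmul (elt T x g d1) (elt T x' g' d2)) = elt T X (g \<otimes>\<^bsub>gen H T\<^esub> g') d" if "d \<in> carr T"
    unfolding elt_def[of T x g] elt_def[of T x' g'] y(4) y'(4) mul_rule[OF T y(1,3) y'(1,3) that]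
    unfolding l r elt_def ..
qed

lemma elt_pull:
  assumes S: "cocoalg S" and T: "cocoalg T" and h: "coalgebra_map S T h" and "admissible T x g"
  defines "x' \<equiv> compose (carr S) x h" and "g' \<equiv> compose (carr S) g h"
  shows "admissible S x' g'" and "d \<in> carr S \<Longrightarrow> elt T x g (h d) = elt S x' g' d"
proof -
  interpret S: cocoalg S by (rule S)
  interpret T: cocoalg T by (rule T)
  interpret RS: rb_group "gen H S" "Bop S" by (rule rb_group_gen[OF S])
  interpret RT: rb_group "gen H T" "Bop T" by (rule rb_group_gen[OF T])
  from admissibleE[OF T assms(4)] obtain y where y: "x \<in> carrier (gen H T)" "g \<in> carrier (gen H T)" "y \<in> carrier (gen H T)"
    "inv\<^bsub>gen H T\<^esub> (gBt T x) \<otimes>\<^bsub>gen H T\<^esub> g = Bop T y" by metis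
  have c: "x' \<in> carrier (gen H S)" "g' \<in> carrier (gen H S)" "compose (carr S) y h \<in> carrier (gen H S)"
    unfolding x'_def g'_def using pull_gen[OF S.coalg_axioms T.coalg_axioms h] y by blast+
  have p: "compose (carr S) (inv\<^bsub>gen H T\<^esub> (gBt T x) \<otimes>\<^bsub>gen H T\<^esub> g) h = inv\<^bsub>gen H S\<^esub> (gBt S x') \<otimes>\<^bsub>gen H S\<^esub> g'"
    unfolding x'_def g'_def
    by (simp only: pull_rb[OF S T h] pull_mult[OF S.coalg_axioms T.coalg_axioms h] pull_inv[OF S T h]
        RT.closed RT.m_closed RT.inv_closed y(1,2))
  have q: "inv\<^bsub>gen H S\<^esub> (gBt S x') \<otimes>\<^bsub>gen H S\<^esub> g' = Bop S (compose (carr S) y h)"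
    unfolding p[symmetric] y(4) by (rule pull_comp) (rule coalgebra_mapD(1)[OF h])
  show "admissible S x' g'" using c q by (simp add: admissible_def RS.B_plus)
  have Bx: "compose (carr S) (gBt T x) h = gBt S x'"
    unfolding x'_def by (rule pull_rb(1)[OF S T h y(1)])
  show "elt T x g (h d) = elt S x' g' d" if "d \<in> carr S"
  proof -
    have "elt T x g (h d) = pair S H H (\<lambda>d. gBt T x (h d)) (\<lambda>d. (inv\<^bsub>gen H T\<^esub> (gBt T x) \<otimes>\<^bsub>gen H T\<^esub> g) (h d)) d"
      unfolding elt_def
      by (rule pair_comp[OF S.coalg_axioms T.coalg_axioms h _ _ that]) (use y in \<open>simp_all add: gen_lin\<close>)
    also have "\<dots> = elt S x' g' d"
      unfolding elt_def p[symmetric] unfolding Bx[symmetric] by (rule pair_cong) (simp_all add: compose_eq)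
    finally show ?thesis .
  qed
qed

text \<open>\<open>elt_mul\<close> multiplies two points at the two halves of one coproduct. For
  independent arguments \<open>s\<close> and \<open>t\<close>, both points are pulled back to S
  \<otimes> S along the two projections, and the product is read off at s \<otimes> t.\<close>

lemma dmul_elt:
  assumes S: "cocoalg S" and 1: "admissible S x g" and 2: "admissible S x' g'" and s: "s \<in> carr S" and t: "t \<in> carr S"
  defines "Q \<equiv> dcp S S undefined undefined"
  defines "X \<equiv> compose (carr Q) x (proj1 S S)" and "X' \<equiv> compose (carr Q) x' (proj2 S S)"
    and "G \<equiv> compose (carr Q) g (proj1 S S)" and "G' \<equiv> compose (carr Q) g' (proj2 S S)"
  shows "dmul (elt S x g s) (elt S x' g' t) =
    elt Q (G \<otimes>\<^bsub>gen H Q\<^esub> X' \<otimes>\<^bsub>gen H Q\<^esub> inv\<^bsub>gen H Q\<^esub> G \<otimes>\<^bsub>gen H Q\<^esub> X) (G \<otimes>\<^bsub>gen H Q\<^esub> G') (htens S S s t)"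
proof -
  interpret S: cocoalg S by (rule S)
  interpret Q: coalg2 S S undefined undefined ..
  note vt = vector_space_tscale
  have Qc: "cocoalg Q" unfolding Q_def by (rule cocoalg_dcp[OF S S])
  have st: "htens S S s t \<in> carr Q" using s t by (simp add: Q_def htens_in)
  note e1 = elt_map[OF S 1, THEN coalgebra_map_linear] and e2 = elt_map[OF S 2, THEN coalgebra_map_linear]
  have pj: "coalgebra_map Q S (proj1 S S)" "coalgebra_map Q S (proj2 S S)"
    unfolding Q_def by (rule Q.proj1_map, rule Q.proj2_map)
  note p1 = elt_pull[OF Qc S pj(1) 1, folded X_def G_def] and p2 = elt_pull[OF Qc S pj(2) 2, folded X'_def G'_def]
  have b: "bilinear_on (scal S) (scal S) tscale (carr S) (carr S) (\<lambda>a b. dmul (elt S x g a) (elt S x' g' b))"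
    using bilinear_on_linear_maps[OF e1 e2] dmul(1) by simp
  have "dmul (elt S x g s) (elt S x' g' t) =
      sweedler Q tscale (htens S S s t) (\<lambda>z1 z2. dmul (elt S x g (proj1 S S z1)) (elt S x' g' (proj2 S S z2)))"
    unfolding Q_def by (rule Q.sweedler_proj[OF vt s t b, symmetric])
  also have "\<dots> = sweedler Q tscale (htens S S s t) (\<lambda>z1 z2. dmul (elt Q X G z1) (elt Q X' G' z2))"
    by (rule sweedler_cong) (simp add: p1(2) p2(2))
  also have "\<dots> = elt Q (G \<otimes>\<^bsub>gen H Q\<^esub> X' \<otimes>\<^bsub>gen H Q\<^esub> inv\<^bsub>gen H Q\<^esub> G \<otimes>\<^bsub>gen H Q\<^esub> X) (G \<otimes>\<^bsub>gen H Q\<^esub> G') (htens S S s t)"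
    by (rule elt_mul(2)[OF Qc p1(1) p2(1) st])
  finally show ?thesis .
qed

section \<open>Unit and antipode of the double cross product\<close>

definition idH where "idH = restrict (\<lambda>x. x) (carr H)"

lemma idH_gen: "idH \<in> carrier (gen H H)"
  unfolding idH_def
  by (rule gen_carrierI, rule coalgebra_map_cong[OF H.coalg_axioms coalgebra_map_id[OF H.coalg_axioms]]) simp_all

sublocale RH: rb_group "gen H H" "Bop H" by (rule rb_group_gen[OF cocoalg_H])

lemma eta_unt: "one (gen H H) (unt H) = unt H"
  by (simp add: gen_one)

text \<open>The group unit takes the value \<open>unt H\<close> at \<open>unt H\<close>, and it is
  its own image under \<open>Bt\<close> and under \<open>B\<close>.\<close>

lemma sub_unt: "unt H \<in> carr Hm" "unt H \<in> carr Hp"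
proof -
  have "gBt H (one (gen H H)) (unt H) \<in> carr Hm" by (rule gBt_minus[OF cocoalg_H]) simp_all
  then show "unt H \<in> carr Hm" by (simp only: RH.Bt_one eta_unt)
  have "Bop H (one (gen H H)) (unt H) \<in> carr Hp" by (rule gplus_plus[OF cocoalg_H RH.B_plus]) simp_all
  then show "unt H \<in> carr Hp" by (simp only: RH.B_one eta_unt)
qed

text \<open>Composition with the antipode is inversion in \<open>gen H H\<close>, and the inverse of
  \<open>Bt\<close> at the identity map is \<open>Bt\<close> at its \<open>cinv\<close>.\<close>

lemma antip_Hm: assumes "a \<in> carr Hm" shows "antip H a \<in> carr Hm"
proof -
  from assms obtain x where x: "a = Bt x" "x \<in> carr H" by (auto simp: sub_simps(1))
  have "gBt H (RH.cinv idH) x \<in> carr Hm" by (rule gBt_minus[OF cocoalg_H _ x(2)]) (simp add: idH_gen)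
  also have "gBt H (RH.cinv idH) = inv\<^bsub>gen H H\<^esub> (gBt H idH)" by (rule RH.Bt_cinv[OF idH_gen])
  also have "\<dots> x = antip H a"
    by (subst gen_inv[OF cocoalg_H], rule RH.closed(2)[OF idH_gen])
       (simp add: Bt_gen[OF cocoalg_H idH_gen] x compose_eq, simp add: idH_def x)
  finally show ?thesis .
qed

lemma antip_Hp: assumes "u \<in> carr Hp" shows "antip H u \<in> carr Hp"
proof -
  from assms obtain x where x: "u = B x" "x \<in> carr H" by (auto simp: sub_simps(8))
  have "(inv\<^bsub>gen H H\<^esub> (Bop H idH)) x \<in> carr Hp"
    by (rule gplus_plus[OF cocoalg_H _ x(2)]) (intro RH.plus_inv RH.B_plus idH_gen)
  also have "(inv\<^bsub>gen H H\<^esub> (Bop H idH)) x = antip H u"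
    by (subst gen_inv[OF cocoalg_H], rule RH.B_closed[OF idH_gen]) (simp add: x compose_eq idH_def)
  finally show ?thesis .
qed

lemma antip_DD:
  shows "linear_on tscale tscale (carr DD) (antip DD)"
    and "a \<in> carr Hm \<Longrightarrow> u \<in> carr Hp \<Longrightarrow>
      antip DD (htens H H a u) = dmul (htens H H (unt H) (antip H u)) (htens H H (antip H a) (unt H))"
proof -
  note vt = vector_space_tscale
  note Mlin = linear_onD[OF bilinear_onD(1)[OF dmul(1)]] linear_onD[OF bilinear_onD(2)[OF dmul(1)]]
  have hin: "a \<in> carr Hm \<Longrightarrow> u \<in> carr Hp \<Longrightarrow> htens H H a u \<in> carr DD" for a u
    using htens_in[of a Hm u Hp] by simp
  note [simp] = antip_Hm antip_Hp sub_unt sub_H linear_onD[OF Sm(2)]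
  have b: "bilinear_on (scal Hm) (scal Hp) tscale (carr Hm) (carr Hp)
      (\<lambda>a u. dmul (htens H H (unt H) (antip H u)) (htens H H (antip H a) (unt H)))"
    by (intro bilinear_onI linear_onI; simp add: Mlin hin del: dcp_simps)
  note h = D.hlift[OF vt b]
  have e: "antip DD = hlift Hm Hp tscale (\<lambda>a u. dmul (htens H H (unt H) (antip H u)) (htens H H (antip H a) (unt H)))"
    by (simp add: dcp_def)
  show "linear_on tscale tscale (carr DD) (antip DD)" unfolding e using h(1) by simp
  show "antip DD (htens H H a u) = dmul (htens H H (unt H) (antip H u)) (htens H H (antip H a) (unt H))"
    if "a \<in> carr Hm" "u \<in> carr Hp"
    unfolding e using h(2)[OF that] by simp
qed

lemma pair_one:
  assumes T: "cocoalg T" and f: "f \<in> carrier (gen H T)" and d: "d \<in> carr T"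
  shows "pair T H H (one (gen H T)) f d = htens H H (unt H) (f d)"
    and "pair T H H f (one (gen H T)) d = htens H H (f d) (unt H)"
proof -
  interpret T: cocoalg T by (rule T)
  note vt = vector_space_tscale and m = linear_mapD[OF gen_lin[OF f]]
  have "pair T H H (one (gen H T)) f d = sweedler T tscale d (\<lambda>a b. tscale (counit T a) (htens H H (unt H) (f b)))"
    unfolding pair_def by (rule sweedler_cong) (simp add: gen_one)
  also have "\<dots> = htens H H (unt H) (f d)"
    by (rule T.sweedler_counit(1)[OF vt _ d]) (auto intro!: linear_onI simp: linear_onD[OF m(2)])
  finally show "pair T H H (one (gen H T)) f d = htens H H (unt H) (f d)" .
  have "pair T H H f (one (gen H T)) d = sweedler T tscale d (\<lambda>a b. tscale (counit T b) (htens H H (f a) (unt H)))"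
    unfolding pair_def by (rule sweedler_cong) (simp add: gen_one)
  also have "\<dots> = htens H H (f d) (unt H)"
    by (rule T.sweedler_counit(2)[OF vt _ d]) (auto intro!: linear_onI simp: linear_onD[OF m(2)])
  finally show "pair T H H f (one (gen H T)) d = htens H H (f d) (unt H)" .
qed

text \<open>The antipode is defined by S(a \<otimes> u) = (1 \<otimes> S u)(S a \<otimes> 1). For a
  = \<open>Bt x\<close> and u = \<open>B y\<close> the two factors are the points [1, inv u] and
  [cinv x, inv a], and \<open>elt_mul\<close> computes their product.\<close>

lemma elt_antip:
  assumes T: "cocoalg T" and 1: "admissible T x g" and d: "d \<in> carr T"
  shows "antip DD (elt T x g d) = elt T (inv\<^bsub>gen H T\<^esub> g \<otimes>\<^bsub>gen H T\<^esub> inv\<^bsub>gen H T\<^esub> x \<otimes>\<^bsub>gen H T\<^esub> g) (inv\<^bsub>gen H T\<^esub> g) d"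
    and "admissible T (inv\<^bsub>gen H T\<^esub> g \<otimes>\<^bsub>gen H T\<^esub> inv\<^bsub>gen H T\<^esub> x \<otimes>\<^bsub>gen H T\<^esub> g) (inv\<^bsub>gen H T\<^esub> g)"
proof -
  interpret T: cocoalg T by (rule T)
  interpret RT: rb_group "gen H T" "Bop T" by (rule rb_group_gen[OF T])
  interpret PD: pairing Hm Hp lact ract T ..
  note vt = vector_space_tscale
  let ?G = "gen H T" and ?one = "one (gen H T)"
  obtain y where y: "x \<in> carrier ?G" "g \<in> carrier ?G" "y \<in> carrier ?G"
    "inv\<^bsub>?G\<^esub> (gBt T x) \<otimes>\<^bsub>?G\<^esub> g = Bop T y" "g = gBt T x \<otimes>\<^bsub>?G\<^esub> Bop T y"
    by (rule admissibleE[OF T 1])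
  let ?u = "inv\<^bsub>?G\<^esub> (Bop T y)" and ?a = "inv\<^bsub>?G\<^esub> (gBt T x)"
  have adm1: "admissible T ?one ?u" using y(3) by (simp add: admissible_def RT.plus_inv RT.B_plus)
  \<comment> \<open>The second component is trivial, since \<open>Bt\<close> of
    \<open>cinv x\<close> already equals \<open>?a\<close>.\<close>
  have adm2: "admissible T (RT.cinv x) ?a"
    using y(1) RT.B_plus[of ?one] by (simp add: admissible_def RT.Bt_cinv)
  have e1: "elt T ?one ?u = pair T H H ?one ?u" using y(3) by (simp add: elt_def)
  have e2: "elt T (RT.cinv x) ?a = pair T H H ?a ?one" using y(1) by (simp add: elt_def RT.Bt_cinv)
  have "?u \<otimes>\<^bsub>?G\<^esub> RT.cinv x \<otimes>\<^bsub>?G\<^esub> inv\<^bsub>?G\<^esub> ?u \<otimes>\<^bsub>?G\<^esub> ?one = inv\<^bsub>?G\<^esub> g \<otimes>\<^bsub>?G\<^esub> inv\<^bsub>?G\<^esub> x \<otimes>\<^bsub>?G\<^esub> g"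
    using y(1,3) by (simp add: y(5) RT.cinv_def RT.Bt_def RT.grp)
  moreover have "?u \<otimes>\<^bsub>?G\<^esub> ?a = inv\<^bsub>?G\<^esub> g"
    using y(1,3) by (simp add: y(5) RT.inv_mult_group)
  ultimately have m: "sweedler T tscale d (\<lambda>d1 d2. dmul (pair T H H ?one ?u d1) (pair T H H ?a ?one d2)) =
      elt T (inv\<^bsub>?G\<^esub> g \<otimes>\<^bsub>?G\<^esub> inv\<^bsub>?G\<^esub> x \<otimes>\<^bsub>?G\<^esub> g) (inv\<^bsub>?G\<^esub> g) d"
    and "admissible T (inv\<^bsub>?G\<^esub> g \<otimes>\<^bsub>?G\<^esub> inv\<^bsub>?G\<^esub> x \<otimes>\<^bsub>?G\<^esub> g) (inv\<^bsub>?G\<^esub> g)"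
    using elt_mul[OF T adm1 adm2] d by (simp_all only: e1 e2)
  then show "admissible T (inv\<^bsub>?G\<^esub> g \<otimes>\<^bsub>?G\<^esub> inv\<^bsub>?G\<^esub> x \<otimes>\<^bsub>?G\<^esub> g) (inv\<^bsub>?G\<^esub> g)" by simp
  note lx = coalgebra_map_linear[OF gen_minus[OF T y(1)]] and ly = coalgebra_map_linear[OF gen_plus[OF T y(3)]]
  have u: "?u = compose (carr T) (antip H) (Bop T y)" by (rule gen_inv[OF T RT.B_closed[OF y(3)]])
  have a: "?a = compose (carr T) (antip H) (gBt T x)" by (rule gen_inv[OF T RT.closed(2)[OF y(1)]])
  let ?\<Phi> = "\<lambda>d1 d2. dmul (htens H H (unt H) (?u d1)) (htens H H (?a d2) (unt H))"
  have "linear_map T DD (pair T H H ?one ?u)" "linear_map T DD (pair T H H ?a ?one)"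
    using elt_map[OF T adm1] elt_map[OF T adm2] by (simp_all only: e1 e2 coalgebra_map_linear)
  then have "T.bilin tscale (\<lambda>d1 d2. dmul (pair T H H ?one ?u d1) (pair T H H ?a ?one d2))"
    by (rule bilinear_on_linear_maps) (use dmul(1) in simp)
  moreover have uc: "?u \<in> carrier ?G" "?a \<in> carrier ?G" using y by simp_all
  ultimately have b: "T.bilin tscale ?\<Phi>"
    using pair_one[OF T] unfolding bilinear_on_def linear_on_def by simp
  have "antip DD (elt T x g d) = sweedler T tscale d (\<lambda>a b. antip DD (htens H H (gBt T x a) (Bop T y b)))"
    unfolding elt_def y(4)
    using PD.pair_apply[OF lx ly vt antip_DD(1)[simplified] d] by (simp add: pair_sub)
  also have "\<dots> = sweedler T tscale d (\<lambda>a b. ?\<Phi> b a)"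
    by (rule sweedler_cong, subst antip_DD(2))
       (simp_all add: linear_mapD(1)[OF lx] linear_mapD(1)[OF ly] u a compose_eq[of _ _ "antip H"])
  \<comment> \<open>The antipode takes the second Sweedler factor first; cocommutativity restores
    the order of the convolution.\<close>
  also have "\<dots> = sweedler T tscale d ?\<Phi>" by (rule T.cocomm[OF T.cocommutative vt b d])
  also have "\<dots> = sweedler T tscale d (\<lambda>d1 d2. dmul (pair T H H ?one ?u d1) (pair T H H ?a ?one d2))"
    by (rule sweedler_cong) (simp add: pair_one[OF T uc(1)] pair_one[OF T uc(2)])
  finally show "antip DD (elt T x g d) = elt T (inv\<^bsub>?G\<^esub> g \<otimes>\<^bsub>?G\<^esub> inv\<^bsub>?G\<^esub> x \<otimes>\<^bsub>?G\<^esub> g) (inv\<^bsub>?G\<^esub> g) d"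
    unfolding m .
qed

end

section \<open>The projection homomorphism pair\<close>

context rota_baxter
begin

lemma pull_pair:
  assumes S: "cocoalg S" and T: "cocoalg T" and h: "coalgebra_map S T h"
    and F: "F \<in> carrier (gen H T)" and G: "G \<in> carrier (gen H T)" and d: "d \<in> carr S"
  shows "pair T H H F G (h d) = pair S H H (compose (carr S) F h) (compose (carr S) G h) d"
proof -
  interpret S: cocoalg S by (rule S)
  interpret T: cocoalg T by (rule T)
  show ?thesis
    by (rule trans[OF pair_comp[OF S.coalg_axioms T.coalg_axioms h gen_lin[OF F] gen_lin[OF G] d] pair_cong])
       (simp_all add: compose_eq)
qed

lemma pair_htens:
  assumes F: "F \<in> carrier (gen H HH)" and G: "G \<in> carrier (gen H HH)" and x: "x \<in> carr H" and y: "y \<in> carr H"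
  shows "pair HH H H F G (htens H H x y) = sweedler H tscale x (\<lambda>x1 x2. sweedler H tscale y (\<lambda>y1 y2.
    htens H H (F (htens H H x1 y1)) (G (htens H H x2 y2))))"
  unfolding pair_def
  by (rule HH.sweedler_X[OF vector_space_tscale _ x y])
     (rule bilinear_on_linear_maps[OF gen_lin[OF F] gen_lin[OF G] bilinear_on_htens])

text \<open>A prescription in representatives that is constant on the fibres of \<open>Bt\<close>
  and \<open>B\<close> is a function of the two values. It is bilinear because sums can be formed on
  representatives, and so extends to the tensor product.\<close>

lemma lift_exists:
  assumes F: "F \<in> carrier (gen H HH)" and G: "G \<in> carrier (gen H HH)"
    and Fm: "\<And>z. z \<in> carr HH \<Longrightarrow> F z \<in> carr Hm" and Gp: "\<And>z. z \<in> carr HH \<Longrightarrow> G z \<in> carr Hp"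
    and dep: "\<And>x x' y y'. x \<in> carr H \<Longrightarrow> x' \<in> carr H \<Longrightarrow> y \<in> carr H \<Longrightarrow> y' \<in> carr H \<Longrightarrow>
      Bt x = Bt x' \<Longrightarrow> B y = B y' \<Longrightarrow> pair HH H H F G (htens H H x y) = pair HH H H F G (htens H H x' y')"
  shows "\<exists>C. linear_map DD DD C \<and> (\<forall>x\<in>carr H. \<forall>y\<in>carr H.
    C (htens H H (Bt x) (B y)) = pair HH H H F G (htens H H x y))"
proof -
  interpret T: cocoalg HH by (rule HH_cocoalg)
  interpret PD: pairing Hm Hp lact ract HH ..
  let ?p = "pair HH H H F G"
  have "linear_map HH Hm F" "linear_map HH Hp G"
    using Fm Gp linear_mapD(2)[OF gen_lin[OF F]] linear_mapD(2)[OF gen_lin[OF G]]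
    by (auto intro!: linear_mapI)
  from PD.pair_linear[OF this] have p: "linear_map HH DD ?p" by (simp add: pair_sub)
  have "\<exists>c. \<forall>y\<in>carr H. \<forall>x\<in>carr H. c (B y) (Bt x) = ?p (htens H H x y)"
    by (rule action_exists) (rule dep)
  then obtain c where c: "\<And>x y. x \<in> carr H \<Longrightarrow> y \<in> carr H \<Longrightarrow> c (B y) (Bt x) = ?p (htens H H x y)"
    by blast
  note lp = linear_onD[OF linear_mapD(2)[OF p, simplified]]
  have b: "bilinear_on (scal Hm) (scal Hp) tscale (carr Hm) (carr Hp) (\<lambda>a u. c u a)"
    by (intro bilinear_onI linear_onI)
       (auto simp: sub_simps(1,8) c lp linear_onD[OF Bm(2), symmetric] linear_onD[OF Btm(2), symmetric])
  note h = D.hlift[OF vector_space_tscale b]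
  let ?C = "hlift Hm Hp tscale (\<lambda>a u. c u a)"
  have e: "?C (htens H H (Bt x) (B y)) = ?p (htens H H x y)" if "x \<in> carr H" "y \<in> carr H" for x y
    using h(2)[of "Bt x" "B y"] that by (simp add: sub_simps(1,8) c)
  have "linear_map DD DD ?C"
  proof (rule linear_mapI)
    show "linear_on (scal DD) (scal DD) (carr DD) ?C" using h(1) by simp
    have "?C z \<in> htensor_space Hm Hp" if "z \<in> htensor_space Hm Hp" for z
    proof (rule D.tensor_in[OF vector_space_tscale subspace_htensor h(1)])
      fix a u assume "a \<in> carr Hm" "u \<in> carr Hp"
      then obtain x y where "a = Bt x" "u = B y" "x \<in> carr H" "y \<in> carr H" by (auto simp: sub_simps(1,8))
      then show "?C (htens Hm Hp a u) \<in> htensor_space Hm Hp"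
        using linear_mapD(1)[OF p] by (simp add: e)
    qed (use that in simp)
    then show "?C z \<in> carr DD" if "z \<in> carr DD" for z using that by simp
  qed
  with e show ?thesis by blast
qed

text \<open>Passes from elementary tensors to arbitrary \<open>T\<close>-points: linearity moves
  \<open>C\<close> inside the Sweedler sum, and the generic pair is then pulled back along
  \<open>pair T H H x y\<close>.\<close>

lemma lift_apply:
  assumes F: "F \<in> carrier (gen H HH)" and G: "G \<in> carrier (gen H HH)"
    and C: "linear_map DD DD C"
    and Ce: "\<forall>x\<in>carr H. \<forall>y\<in>carr H. C (htens H H (Bt x) (B y)) = pair HH H H F G (htens H H x y)"
    and T: "cocoalg T" and x: "x \<in> carrier (gen H T)" and y: "y \<in> carrier (gen H T)" and d: "d \<in> carr T"
  shows "C (pair T H H (gBt T x) (Bop T y) d) =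
    pair T H H (compose (carr T) F (pair T H H x y)) (compose (carr T) G (pair T H H x y)) d"
proof -
  interpret T: cocoalg T by (rule T)
  interpret THH: cocoalg HH by (rule HH_cocoalg)
  interpret PD: pairing Hm Hp lact ract T ..
  interpret PH: pairing H H undefined undefined T ..
  interpret PHH: pairing H H undefined undefined HH ..
  note vt = vector_space_tscale
  have "C (pair T H H (gBt T x) (Bop T y) d) = sweedler T tscale d (\<lambda>a b. C (htens H H (gBt T x a) (Bop T y b)))"
    using PD.pair_apply[OF coalgebra_map_linear[OF gen_minus[OF T x]] coalgebra_map_linear[OF gen_plus[OF T y]]
        vt linear_mapD(2)[OF C, simplified] d] by (simp add: pair_sub)
  also have "\<dots> = sweedler T tscale d (\<lambda>a b. pair HH H H F G (htens H H (x a) (y b)))"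
    by (rule sweedler_cong) (simp add: Bt_gen[OF T x] compose_eq Ce gen_in[OF x] gen_in[OF y])
  also have "\<dots> = pair HH H H F G (pair T H H x y d)"
    using PH.pair_apply[OF gen_lin[OF x] gen_lin[OF y] vt _ d, of "pair HH H H F G"]
      linear_mapD(2)[OF PHH.pair_linear[OF gen_lin[OF F] gen_lin[OF G]]] by simp
  also have "\<dots> = pair T H H (compose (carr T) F (pair T H H x y)) (compose (carr T) G (pair T H H x y)) d"
    by (rule pull_pair[OF T HH_cocoalg pair_gen(1)[OF T x y] F G d])
  finally show ?thesis .
qed

text \<open>The coordinate g of the generic point; the four definitions below are the components of
  C and C' there.\<close>

definition univ_prod where "univ_prod = R.Bt P1 \<otimes>\<^bsub>gen H HH\<^esub> Bop HH P2"
definition C_left where "C_left = R.Bt univ_prod"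
definition C_right where "C_right = inv\<^bsub>gen H HH\<^esub> (Bop HH (inv\<^bsub>gen H HH\<^esub> univ_prod))"
definition Ct_left where "Ct_left = R.Bt (inv\<^bsub>gen H HH\<^esub> (Bop HH (inv\<^bsub>gen H HH\<^esub> P1) \<otimes>\<^bsub>gen H HH\<^esub> Bop HH P2))"
definition Ct_right where "Ct_right = inv\<^bsub>gen H HH\<^esub> (Bop HH (R.Bt P1 \<otimes>\<^bsub>gen H HH\<^esub> R.Bt (inv\<^bsub>gen H HH\<^esub> P2)))"

lemmas R_closed = R.closed R.m_closed R.inv_closed R.B_closed P12_gen

lemma comps_gen: "univ_prod \<in> carrier (gen H HH)" "C_left \<in> carrier (gen H HH)" "C_right \<in> carrier (gen H HH)"
  "Ct_left \<in> carrier (gen H HH)" "Ct_right \<in> carrier (gen H HH)"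
  unfolding C_left_def C_right_def Ct_left_def Ct_right_def univ_prod_def by (intro R_closed)+

lemma comps_sub: assumes "z \<in> carr HH"
  shows "C_left z \<in> carr Hm" "C_right z \<in> carr Hp" "Ct_left z \<in> carr Hm" "Ct_right z \<in> carr Hp"
proof -
  show "C_left z \<in> carr Hm" unfolding C_left_def by (rule gBt_minus[OF HH_cocoalg comps_gen(1) assms])
  show "Ct_left z \<in> carr Hm" unfolding Ct_left_def by (rule gBt_minus[OF HH_cocoalg _ assms]) (intro R_closed)
  show "C_right z \<in> carr Hp" unfolding C_right_def univ_prod_def
    by (rule gplus_plus[OF HH_cocoalg _ assms]) (intro R.plus_inv R.B_plus R_closed)
  show "Ct_right z \<in> carr Hp" unfolding Ct_right_def
    by (rule gplus_plus[OF HH_cocoalg _ assms]) (intro R.plus_inv R.B_plus R_closed)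
qed

lemma inv_eval: "f \<in> carrier (gen H HH) \<Longrightarrow> z \<in> carr HH \<Longrightarrow> (inv\<^bsub>gen H HH\<^esub> f) z = antip H (f z)"
  by (simp add: gen_inv[OF HH_cocoalg] compose_eq)

lemma Bt_eval: "f \<in> carrier (gen H HH) \<Longrightarrow> z \<in> carr HH \<Longrightarrow> R.Bt f z = Bt (f z)"
  by (subst Bt_gen[OF HH_cocoalg]) (simp_all add: compose_eq)

lemma B_eval: "z \<in> carr HH \<Longrightarrow> Bop HH f z = B (f z)"
  by (simp add: compose_eq)

lemma comps_eval:
  assumes x: "x \<in> carr H" and y: "y \<in> carr H"
  shows "C_left (htens H H x y) = Bt (mul H (Bt x) (B y))"
    and "C_right (htens H H x y) = antip H (B (antip H (mul H (Bt x) (B y))))"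
    and "Ct_left (htens H H x y) = Bt (antip H (mul H (B (antip H x)) (B y)))"
    and "Ct_right (htens H H x y) = antip H (B (mul H (Bt x) (Bt (antip H y))))"
proof -
  have z: "htens H H x y \<in> carr HH" using x y by simp
  have BSl: "linear_map H H (\<lambda>x. B (antip H x))" "linear_map H H (\<lambda>x. Bt (antip H x))"
    by (rule linear_map_comp[OF antip_linear B_lin], rule linear_map_comp[OF antip_linear Bt_lin])
  have b: "R.Bt P1 = compose (carr HH) Bt P1" by (rule Bt_gen[OF HH_cocoalg P12_gen(1)])
  have univ_prod: "univ_prod (htens H H x y) = mul H (Bt x) (B y)"
    unfolding univ_prod_def b by (rule eval_12[OF Bt_lin B_lin x y])
  show "C_left (htens H H x y) = Bt (mul H (Bt x) (B y))"
    unfolding C_left_def Bt_eval[OF comps_gen(1) z] univ_prod ..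
  show "C_right (htens H H x y) = antip H (B (antip H (mul H (Bt x) (B y))))"
    unfolding C_right_def inv_eval[OF R.B_closed[OF R.inv_closed[OF comps_gen(1)]] z] B_eval[OF z] inv_eval[OF comps_gen(1) z] univ_prod ..
  have i: "Bop HH (inv\<^bsub>gen H HH\<^esub> P1) = compose (carr HH) (\<lambda>x. B (antip H x)) P1"
    unfolding gen_inv[OF HH_cocoalg P12_gen(1)] by (rule compose_compose)
  have e: "(Bop HH (inv\<^bsub>gen H HH\<^esub> P1) \<otimes>\<^bsub>gen H HH\<^esub> Bop HH P2) (htens H H x y) = mul H (B (antip H x)) (B y)"
    unfolding i by (rule eval_12[OF BSl(1) B_lin x y])
  have k: "Bop HH (inv\<^bsub>gen H HH\<^esub> P1) \<otimes>\<^bsub>gen H HH\<^esub> Bop HH P2 \<in> carrier (gen H HH)"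
    "Bop HH (R.Bt P1 \<otimes>\<^bsub>gen H HH\<^esub> R.Bt (inv\<^bsub>gen H HH\<^esub> P2)) \<in> carrier (gen H HH)"
    by (intro R_closed)+
  show "Ct_left (htens H H x y) = Bt (antip H (mul H (B (antip H x)) (B y)))"
    unfolding Ct_left_def Bt_eval[OF R.inv_closed[OF k(1)] z] inv_eval[OF k(1) z] e ..
  have j: "R.Bt (inv\<^bsub>gen H HH\<^esub> P2) = compose (carr HH) (\<lambda>x. Bt (antip H x)) P2"
    by (subst Bt_gen[OF HH_cocoalg R.inv_closed[OF P12_gen(2)]])
       (simp only: gen_inv[OF HH_cocoalg P12_gen(2)] compose_compose)
  have e': "(R.Bt P1 \<otimes>\<^bsub>gen H HH\<^esub> R.Bt (inv\<^bsub>gen H HH\<^esub> P2)) (htens H H x y) = mul H (Bt x) (Bt (antip H y))"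
    unfolding b j by (rule eval_12[OF Bt_lin BSl(2) x y])
  show "Ct_right (htens H H x y) = antip H (B (mul H (Bt x) (Bt (antip H y))))"
    unfolding Ct_right_def inv_eval[OF k(2) z] B_eval[OF z] e' ..
qed

text \<open>Turns the formula for \<open>C\<close> into a pair of group elements at
  \<open>HH\<close>, the form required by \<open>lift_exists\<close> and
  \<open>lift_apply\<close>.\<close>

lemma is_C_iff: "is_C H B C \<longleftrightarrow> linear_map DD DD C \<and> (\<forall>x\<in>carr H. \<forall>y\<in>carr H.
    C (htens H H (Bt x) (B y)) = pair HH H H C_left C_right (htens H H x y))"
proof -
  have "pair HH H H C_left C_right (htens H H x y) = sweedler H tscale x (\<lambda>x1 x2. sweedler H tscale y (\<lambda>y1 y2.
         htens H H (Bt (mul H (Bt x1) (B y1))) (antip H (B (antip H (mul H (Bt x2) (B y2)))))))"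
    if "x \<in> carr H" "y \<in> carr H" for x y
    unfolding pair_htens[OF comps_gen(2,3) that]
    by (rule sweedler_cong, rule sweedler_cong) (simp only: comps_eval)
  then show ?thesis unfolding is_C_def rb_dcp_def by (simp only: ball_simps cong: ball_cong)
qed

lemma is_C_tilde_iff: "is_C_tilde H B C \<longleftrightarrow> linear_map DD DD C \<and> (\<forall>x\<in>carr H. \<forall>y\<in>carr H.
    C (htens H H (Bt x) (B y)) = pair HH H H Ct_left Ct_right (htens H H x y))"
proof -
  have "pair HH H H Ct_left Ct_right (htens H H x y) = sweedler H tscale x (\<lambda>x1 x2. sweedler H tscale y (\<lambda>y1 y2.
         htens H H (Bt (antip H (mul H (B (antip H x1)) (B y1)))) (antip H (B (mul H (Bt x2) (Bt (antip H y2)))))))"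
    if "x \<in> carr H" "y \<in> carr H" for x y
    unfolding pair_htens[OF comps_gen(4,5) that]
    by (rule sweedler_cong, rule sweedler_cong) (simp only: comps_eval)
  then show ?thesis unfolding is_C_tilde_def rb_dcp_def by (simp only: ball_simps cong: ball_cong)
qed

text \<open>Both components involve \<open>x\<close> and \<open>y\<close> only through the product
  of \<open>Bt x\<close> and \<open>B y\<close>, so they factor through \<open>Bt\<close> \<otimes>
  \<open>B\<close>.\<close>

lemma C_exists: "\<exists>C. is_C H B C"
  unfolding is_C_iff
proof (rule lift_exists[OF comps_gen(2,3) comps_sub(1,2)])
  define q where "q = pair HH H H (compose (carr HH) Bt P1) (compose (carr HH) B P2)"
  note q = prod_map[OF Bt_map B_map, folded q_def]
  note pl = pull_rb[OF HH_cocoalg HH_cocoalg q(1)] pull_mult[OF HH.X.coalg_axioms HH.X.coalg_axioms q(1)]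
    pull_inv[OF HH_cocoalg HH_cocoalg q(1)]
  have pc: "compose (carr HH) (compose (carr HH) k F) q = compose (carr HH) k (compose (carr HH) F q)" for k :: "'h \<Rightarrow> 'h" and F
    by (rule pull_comp) (rule coalgebra_mapD(1)[OF q(1)])
  let ?F = "R.Bt (P1 \<otimes>\<^bsub>gen H HH\<^esub> P2)" and ?G = "inv\<^bsub>gen H HH\<^esub> (Bop HH (inv\<^bsub>gen H HH\<^esub> (P1 \<otimes>\<^bsub>gen H HH\<^esub> P2)))"
  have FG: "?F \<in> carrier (gen H HH)" "?G \<in> carrier (gen H HH)" by (intro R_closed)+
  have "compose (carr HH) ?F q = C_left" "compose (carr HH) ?G q = C_right"
    unfolding C_left_def C_right_def univ_prod_def by (simp_all only: pl pc q(2,3) R_closed Bt_gen[OF HH_cocoalg P12_gen(1)])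
  then have e: "pair HH H H C_left C_right z = pair HH H H ?F ?G (q z)" if "z \<in> carr HH" for z
    using pull_pair[OF HH_cocoalg HH_cocoalg q(1) FG that] by simp
  show "pair HH H H C_left C_right (htens H H x y) = pair HH H H C_left C_right (htens H H x' y')"
    if "x \<in> carr H" "x' \<in> carr H" "y \<in> carr H" "y' \<in> carr H" "Bt x = Bt x'" "B y = B y'" for x x' y y'
    using that by (simp add: e q(4))
qed

text \<open>By \<open>tilde_fst\<close> and \<open>tilde_snd\<close> the components are
  \<open>Bt\<close> and the inverse of \<open>Bt\<close> at the same element.\<close>

lemma Ct_left_right: "Ct_right = inv\<^bsub>gen H HH\<^esub> Ct_left" "Ct_left = inv\<^bsub>gen H HH\<^esub> Ct_right"
proof -
  show "Ct_right = inv\<^bsub>gen H HH\<^esub> Ct_left"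
    unfolding Ct_right_def Ct_left_def R.tilde_snd[OF P12_gen] R.tilde_fst[OF P12_gen] ..
  then show "Ct_left = inv\<^bsub>gen H HH\<^esub> Ct_right" using comps_gen(4) by simp
qed

text \<open>As given, \<open>Ct_left\<close> involves \<open>y\<close> only through
  \<open>B y\<close>, and \<open>Ct_right\<close> involves \<open>x\<close> only through
  \<open>Bt x\<close>; neither formula settles both variables. Since the components are mutually
  inverse, a change of \<open>y\<close> is treated with the first formula for both of them, and a
  change of \<open>x\<close> with the second.\<close>

lemma C_tilde_exists: "\<exists>C. is_C_tilde H B C"
  unfolding is_C_tilde_iff
proof (rule lift_exists[OF comps_gen(4,5) comps_sub(3,4)])
  have r: "pair HH H H Ct_left Ct_right (htens H H x y) = pair HH H H Ct_left Ct_right (htens H H x y')"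
    if "x \<in> carr H" "y \<in> carr H" "y' \<in> carr H" "B y = B y'" for x y y'
  proof -
    define q where "q = pair HH H H (compose (carr HH) (\<lambda>x. x) P1) (compose (carr HH) B P2)"
    note q = prod_map[OF coalgebra_map_id[OF H.coalg_axioms] B_map, folded q_def, unfolded compose_id]
    note pl = pull_rb[OF HH_cocoalg HH_cocoalg q(1)] pull_mult[OF HH.X.coalg_axioms HH.X.coalg_axioms q(1)]
      pull_inv[OF HH_cocoalg HH_cocoalg q(1)]
    have pc: "compose (carr HH) (compose (carr HH) k F) q = compose (carr HH) k (compose (carr HH) F q)" for k :: "'h \<Rightarrow> 'h" and F
      by (rule pull_comp) (rule coalgebra_mapD(1)[OF q(1)])
    let ?F = "R.Bt (inv\<^bsub>gen H HH\<^esub> (Bop HH (inv\<^bsub>gen H HH\<^esub> P1) \<otimes>\<^bsub>gen H HH\<^esub> P2))"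
    have F: "?F \<in> carrier (gen H HH)" by (intro R_closed)
    have Fq: "compose (carr HH) ?F q = Ct_left"
      unfolding Ct_left_def by (simp only: pl pc q(2,3) R_closed)
    have Gq: "compose (carr HH) (inv\<^bsub>gen H HH\<^esub> ?F) q = Ct_right"
      unfolding Ct_left_right(1) Fq[symmetric] by (rule pull_inv[OF HH_cocoalg HH_cocoalg q(1) F])
    have "pair HH H H Ct_left Ct_right z = pair HH H H ?F (inv\<^bsub>gen H HH\<^esub> ?F) (q z)" if "z \<in> carr HH" for z
      using pull_pair[OF HH_cocoalg HH_cocoalg q(1) F R.inv_closed[OF F] that] by (simp only: Fq Gq)
    then show ?thesis using that by (simp add: q(4))
  qed
  have l: "pair HH H H Ct_left Ct_right (htens H H x y) = pair HH H H Ct_left Ct_right (htens H H x' y)"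
    if "x \<in> carr H" "x' \<in> carr H" "y \<in> carr H" "Bt x = Bt x'" for x x' y
  proof -
    define q where "q = pair HH H H (compose (carr HH) Bt P1) (compose (carr HH) (\<lambda>x. x) P2)"
    note q = prod_map[OF Bt_map coalgebra_map_id[OF H.coalg_axioms], folded q_def, unfolded compose_id]
    note pl = pull_rb[OF HH_cocoalg HH_cocoalg q(1)] pull_mult[OF HH.X.coalg_axioms HH.X.coalg_axioms q(1)]
      pull_inv[OF HH_cocoalg HH_cocoalg q(1)]
    have pc: "compose (carr HH) (compose (carr HH) k F) q = compose (carr HH) k (compose (carr HH) F q)" for k :: "'h \<Rightarrow> 'h" and F
      by (rule pull_comp) (rule coalgebra_mapD(1)[OF q(1)])
    let ?G = "inv\<^bsub>gen H HH\<^esub> (Bop HH (P1 \<otimes>\<^bsub>gen H HH\<^esub> R.Bt (inv\<^bsub>gen H HH\<^esub> P2)))"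
    have G: "?G \<in> carrier (gen H HH)" by (intro R_closed)
    have Gq: "compose (carr HH) ?G q = Ct_right"
      unfolding Ct_right_def by (simp only: pl pc q(2,3) R_closed Bt_gen[OF HH_cocoalg P12_gen(1)])
    have Fq: "compose (carr HH) (inv\<^bsub>gen H HH\<^esub> ?G) q = Ct_left"
      by (subst Ct_left_right(2), unfold Gq[symmetric], rule pull_inv[OF HH_cocoalg HH_cocoalg q(1) G])
    have "pair HH H H Ct_left Ct_right z = pair HH H H (inv\<^bsub>gen H HH\<^esub> ?G) ?G (q z)" if "z \<in> carr HH" for z
      using pull_pair[OF HH_cocoalg HH_cocoalg q(1) R.inv_closed[OF G] G that] by (simp only: Fq Gq)
    then show ?thesis using that by (simp add: q(4))
  qed
  show "pair HH H H Ct_left Ct_right (htens H H x y) = pair HH H H Ct_left Ct_right (htens H H x' y')"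
    if "x \<in> carr H" "x' \<in> carr H" "y \<in> carr H" "y' \<in> carr H" "Bt x = Bt x'" "B y = B y'" for x x' y y'
    using r[OF that(1,3,4,6)] l[OF that(1,2,4,5)] by simp
qed

text \<open>The first component is \<open>Bt g\<close> by definition; \<open>C_snd\<close> shows
  that the second is the one completing it to \<open>g\<close>.\<close>

lemma C_elt:
  assumes C: "is_C H B C" and T: "cocoalg T" and 1: "admissible T x g" and d: "d \<in> carr T"
  shows "C (elt T x g d) = elt T g g d"
proof -
  interpret T: cocoalg T by (rule T)
  interpret RT: rb_group "gen H T" "Bop T" by (rule rb_group_gen[OF T])
  obtain y where y: "x \<in> carrier (gen H T)" "g \<in> carrier (gen H T)" "y \<in> carrier (gen H T)"
    "inv\<^bsub>gen H T\<^esub> (gBt T x) \<otimes>\<^bsub>gen H T\<^esub> g = Bop T y" "g = gBt T x \<otimes>\<^bsub>gen H T\<^esub> Bop T y"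
    by (rule admissibleE[OF T 1])
  define P where "P = pair T H H x y"
  note P = pair_gen[OF T y(1,3), folded P_def]
  have pc: "compose (carr T) (compose (carr HH) k F) P = compose (carr T) k (compose (carr T) F P)" for k :: "'h \<Rightarrow> 'h" and F
    by (rule pull_comp) (rule coalgebra_mapD(1)[OF P(1)])
  note pl = pull_rb[OF T HH_cocoalg P(1)] pull_mult[OF T.coalg_axioms HH.X.coalg_axioms P(1)]
    pull_inv[OF T HH_cocoalg P(1)]
  have gP: "compose (carr T) univ_prod P = g"
    unfolding univ_prod_def y(5) by (simp only: pl pc P(2,3) R_closed)
  have "C (elt T x g d) = pair T H H (compose (carr T) C_left P) (compose (carr T) C_right P) d"
    unfolding elt_def y(4) P_def using C unfolding is_C_iff
    by (intro lift_apply[OF comps_gen(2,3) _ _ T y(1,3) d]) blast+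
  also have "compose (carr T) C_left P = gBt T g" unfolding C_left_def by (simp only: pl pc gP comps_gen)
  also have "compose (carr T) C_right P = inv\<^bsub>gen H T\<^esub> (gBt T g) \<otimes>\<^bsub>gen H T\<^esub> g"
    unfolding C_right_def RT.C_snd[OF y(2), symmetric] by (simp only: pl pc gP comps_gen R_closed)
  finally show ?thesis by (simp only: elt_def)
qed

lemma admissible_C: assumes T: "cocoalg T" and 1: "admissible T x g" shows "admissible T g g"
proof -
  interpret RT: rb_group "gen H T" "Bop T" by (rule rb_group_gen[OF T])
  from 1 have g: "g \<in> carrier (gen H T)" by (simp add: admissible_def)
  have "inv\<^bsub>gen H T\<^esub> (Bop T (inv\<^bsub>gen H T\<^esub> g)) \<in> RT.plus"
    by (intro RT.plus_inv RT.B_plus RT.inv_closed g)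
  then show ?thesis using g by (simp add: admissible_def flip: RT.C_snd)
qed

text \<open>By \<open>tilde_fst\<close> and \<open>tilde_snd\<close> the second component is the
  inverse of the first, so the new coordinate \<open>g\<close> is the unit.\<close>

lemma C_tilde_elt:
  assumes C: "is_C_tilde H B C" and T: "cocoalg T" and 1: "admissible T x g" and d: "d \<in> carr T"
  shows "C (elt T x g d) = elt T (inv\<^bsub>gen H T\<^esub> g \<otimes>\<^bsub>gen H T\<^esub> x) (one (gen H T)) d"
proof -
  interpret T: cocoalg T by (rule T)
  interpret RT: rb_group "gen H T" "Bop T" by (rule rb_group_gen[OF T])
  obtain y where y: "x \<in> carrier (gen H T)" "g \<in> carrier (gen H T)" "y \<in> carrier (gen H T)"
    "inv\<^bsub>gen H T\<^esub> (gBt T x) \<otimes>\<^bsub>gen H T\<^esub> g = Bop T y" "g = gBt T x \<otimes>\<^bsub>gen H T\<^esub> Bop T y"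
    by (rule admissibleE[OF T 1])
  define P where "P = pair T H H x y"
  note P = pair_gen[OF T y(1,3), folded P_def]
  have pc: "compose (carr T) (compose (carr HH) k F) P = compose (carr T) k (compose (carr T) F P)" for k :: "'h \<Rightarrow> 'h" and F
    by (rule pull_comp) (rule coalgebra_mapD(1)[OF P(1)])
  note pl = pull_rb[OF T HH_cocoalg P(1)] pull_mult[OF T.coalg_axioms HH.X.coalg_axioms P(1)]
    pull_inv[OF T HH_cocoalg P(1)]
  note tf = RT.tilde_fst[OF y(1,3), folded y(5)] and ts = RT.tilde_snd[OF y(1,3), folded y(5)]
  let ?k = "inv\<^bsub>gen H T\<^esub> g \<otimes>\<^bsub>gen H T\<^esub> x"
  have k: "?k \<in> carrier (gen H T)" using y by simp
  have "C (elt T x g d) = pair T H H (compose (carr T) Ct_left P) (compose (carr T) Ct_right P) d"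
    unfolding elt_def y(4) P_def using C unfolding is_C_tilde_iff
    by (intro lift_apply[OF comps_gen(4,5) _ _ T y(1,3) d]) blast+
  also have "compose (carr T) Ct_left P = gBt T ?k" unfolding Ct_left_def tf[symmetric] by (simp only: pl pc P(2,3) R_closed)
  also have "compose (carr T) Ct_right P = inv\<^bsub>gen H T\<^esub> (gBt T ?k)"
    unfolding Ct_right_def ts[symmetric] by (simp only: pl pc P(2,3) R_closed)
  finally show "C (elt T x g d) = elt T ?k (one (gen H T)) d" using k by (simp add: elt_def)
qed

lemma admissible_C_tilde:
  assumes T: "cocoalg T" and 1: "admissible T x g"
  shows "admissible T (inv\<^bsub>gen H T\<^esub> g \<otimes>\<^bsub>gen H T\<^esub> x) (one (gen H T))"
proof -
  interpret RT: rb_group "gen H T" "Bop T" by (rule rb_group_gen[OF T])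
  obtain y where y: "x \<in> carrier (gen H T)" "g \<in> carrier (gen H T)" "y \<in> carrier (gen H T)"
    "inv\<^bsub>gen H T\<^esub> (gBt T x) \<otimes>\<^bsub>gen H T\<^esub> g = Bop T y" "g = gBt T x \<otimes>\<^bsub>gen H T\<^esub> Bop T y"
    by (rule admissibleE[OF T 1])
  note ts = RT.tilde_snd[OF y(1,3), folded y(5)]
  have "inv\<^bsub>gen H T\<^esub> (Bop T (gBt T x \<otimes>\<^bsub>gen H T\<^esub> gBt T (inv\<^bsub>gen H T\<^esub> y))) \<in> RT.plus"
    by (intro RT.plus_inv RT.B_plus RT.closed RT.m_closed RT.inv_closed y)
  then show "admissible T (inv\<^bsub>gen H T\<^esub> g \<otimes>\<^bsub>gen H T\<^esub> x) (one (gen H T))" unfolding ts using y(1,2) by (simp add: admissible_def)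
qed

text \<open>The generic point, that is, the surjection \<open>Bt\<close> \<otimes> \<open>B\<close>
  from H \<otimes> H onto the double cross product. Identities there are checked at
  \<open>proj s\<close>.\<close>

definition proj where "proj = elt HH P1 univ_prod"

lemma proj_admissible: "admissible HH P1 univ_prod"
  unfolding univ_prod_def by (rule elt_pair(2)[OF HH_cocoalg P12_gen])

lemma proj_map: "coalgebra_map HH DD proj"
  unfolding proj_def by (rule elt_map[OF HH_cocoalg proj_admissible])

lemma proj_htens:
  assumes "x \<in> carr H" "y \<in> carr H"
  shows "proj (htens H H x y) = htens H H (Bt x) (B y)"
  unfolding proj_def univ_prod_def elt_pair(1)[OF HH_cocoalg P12_gen, symmetric]
  unfolding Bt_gen[OF HH_cocoalg P12_gen(1)]
  by (rule prod_map(4)[OF Bt_map B_map assms])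

text \<open>The image is a subspace that contains all elementary tensors.\<close>

lemma proj_surj:
  assumes "z \<in> carr DD"
  obtains s where "s \<in> carr HH" "z = proj s"
proof -
  have "z \<in> proj ` carr HH"
  proof (rule D.tensor_in[OF vector_space_tscale _ _ _ assms[simplified], where L = "\<lambda>z. z"])
    show "module.subspace tscale (proj ` carr HH)"
      using subspace_image[OF HH.X.vs D.X.vs coalgebra_mapD(2)[OF proj_map] HH.X.sub] by simp
    fix a u assume "a \<in> carr Hm" "u \<in> carr Hp"
    then obtain x y where *: "a = Bt x" "u = B y" "x \<in> carr H" "y \<in> carr H" by (auto simp: sub_simps(1,8))
    then have "htens H H a u = proj (htens H H x y)" by (simp add: proj_htens)
    then show "htens Hm Hp a u \<in> proj ` carr HH" using * by simp
  qed (simp add: linear_on_def)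
  with that show ?thesis by blast
qed

text \<open>All conditions are tested on the generic point. For coproducts this suffices because
  \<open>proj\<close> is itself a surjective coalgebra map.\<close>

lemma hopf_homI:
  assumes lin: "linear_map DD DD C"
    and cm: "coalgebra_map HH DD (\<lambda>s. C (proj s))"
    and mult: "\<And>s t. s \<in> carr HH \<Longrightarrow> t \<in> carr HH \<Longrightarrow> C (dmul (proj s) (proj t)) = dmul (C (proj s)) (C (proj t))"
    and unit: "C (htens H H (unt H) (unt H)) = htens H H (unt H) (unt H)"
    and anti: "\<And>s. s \<in> carr HH \<Longrightarrow> C (antip DD (proj s)) = antip DD (C (proj s))"
  shows "hopf_hom DD DD C"
proof -
  note m = coalgebra_mapD[OF cm] and pm = coalgebra_mapD[OF proj_map]
  have b: "D.X.bilin tscale (\<lambda>a b. htens DD DD (C a) (C b))"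
    by (rule bilinear_on_linear_maps[OF lin lin bilinear_on_htens])
  have "comul DD (C z) = sweedler DD tscale z (\<lambda>a b. htens DD DD (C a) (C b)) \<and> counit DD (C z) = counit DD z"
    if "z \<in> carr DD" for z
  proof -
    from proj_surj[OF that] obtain s where s: "s \<in> carr HH" "z = proj s" .
    show ?thesis
      unfolding s(2)
      using m(3)[OF s(1)] m(4)[OF s(1)] pm(4)[OF s(1)]
        sweedler_cmap[OF HH.X.coalg_axioms D.X.coalg_axioms vector_space_tscale b s(1) proj_map] by simp
  qed
  moreover have "C (mul DD z w) = mul DD (C z) (C w)" if "z \<in> carr DD" "w \<in> carr DD" for z w
  proof -
    from proj_surj[OF that(1)] obtain s where s: "s \<in> carr HH" "z = proj s" .
    from proj_surj[OF that(2)] obtain t where t: "t \<in> carr HH" "w = proj t" .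
    show ?thesis using mult[OF s(1) t(1)] by (simp add: s(2) t(2) dcp_def)
  qed
  moreover have "C (unt DD) = unt DD" using unit by (simp add: dcp_def)
  moreover have "C (antip DD z) = antip DD (C z)" if "z \<in> carr DD" for z
  proof -
    from proj_surj[OF that] obtain s where s: "s \<in> carr HH" "z = proj s" .
    show ?thesis unfolding s(2) by (rule anti[OF s(1)])
  qed
  ultimately show ?thesis
    using lin unfolding hopf_hom_def coalgebra_map_def by blast
qed

text \<open>Presents the unit of the double cross product as a value of the trivial point [1, 1], so
  that \<open>C_elt\<close> and \<open>C_tilde_elt\<close> apply to it.\<close>

lemma unit_elt: "elt H (one (gen H H)) (one (gen H H)) (unt H) = htens H H (unt H) (unt H)"
  and unit_admissible: "admissible H (one (gen H H)) (one (gen H H))"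
proof -
  show "elt H (one (gen H H)) (one (gen H H)) (unt H) = htens H H (unt H) (unt H)"
    using pair_one(1)[OF cocoalg_H RH.one_closed unt_in] by (simp add: elt_def eta_unt)
  show "admissible H (one (gen H H)) (one (gen H H))"
    using RH.B_plus[OF RH.one_closed] by (simp add: admissible_def)
qed

text \<open>Multiplicativity concerns two independent elements, each generic over \<open>HH\<close>;
  their common test coalgebra is the tensor square of \<open>HH\<close>.\<close>

definition QQ where "QQ = dcp HH HH undefined undefined"

lemma QQ_cocoalg: "cocoalg QQ"
  unfolding QQ_def by (rule cocoalg_dcp[OF HH_cocoalg HH_cocoalg])

sublocale RQ: rb_group "gen H QQ" "Bop QQ" by (rule rb_group_gen[OF QQ_cocoalg])

lemma QQ_proj: "coalgebra_map QQ HH (proj1 HH HH)" "coalgebra_map QQ HH (proj2 HH HH)"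
proof -
  interpret Q: coalg2 HH HH undefined undefined ..
  show "coalgebra_map QQ HH (proj1 HH HH)" "coalgebra_map QQ HH (proj2 HH HH)"
    unfolding QQ_def by (rule Q.proj1_map, rule Q.proj2_map)
qed

lemma QQ_htens: "s \<in> carr HH \<Longrightarrow> t \<in> carr HH \<Longrightarrow> htens HH HH s t \<in> carr QQ"
  using htens_in[of s HH t HH] by (simp add: QQ_def)

lemmas QQ_pull = pull_gen[OF cocoalg.axioms(1)[OF QQ_cocoalg] HH.X.coalg_axioms]
lemmas QQ_pull_mult = pull_mult[OF cocoalg.axioms(1)[OF QQ_cocoalg] HH.X.coalg_axioms]
lemmas QQ_pull_inv = pull_inv[OF QQ_cocoalg HH_cocoalg]

lemma dmul_proj:
  fixes X X' G G'
  defines "X \<equiv> compose (carr QQ) P1 (proj1 HH HH)" and "X' \<equiv> compose (carr QQ) P1 (proj2 HH HH)"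
    and "G \<equiv> compose (carr QQ) univ_prod (proj1 HH HH)" and "G' \<equiv> compose (carr QQ) univ_prod (proj2 HH HH)"
  assumes s: "s \<in> carr HH" and t: "t \<in> carr HH"
  shows "dmul (proj s) (proj t) = elt QQ (G \<otimes>\<^bsub>gen H QQ\<^esub> X' \<otimes>\<^bsub>gen H QQ\<^esub> inv\<^bsub>gen H QQ\<^esub> G \<otimes>\<^bsub>gen H QQ\<^esub> X) (G \<otimes>\<^bsub>gen H QQ\<^esub> G') (htens HH HH s t)"
    and "admissible QQ (G \<otimes>\<^bsub>gen H QQ\<^esub> X' \<otimes>\<^bsub>gen H QQ\<^esub> inv\<^bsub>gen H QQ\<^esub> G \<otimes>\<^bsub>gen H QQ\<^esub> X) (G \<otimes>\<^bsub>gen H QQ\<^esub> G')"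
    and "X \<in> carrier (gen H QQ)" "X' \<in> carrier (gen H QQ)" "G \<in> carrier (gen H QQ)" "G' \<in> carrier (gen H QQ)"
proof -
  show "dmul (proj s) (proj t) = elt QQ (G \<otimes>\<^bsub>gen H QQ\<^esub> X' \<otimes>\<^bsub>gen H QQ\<^esub> inv\<^bsub>gen H QQ\<^esub> G \<otimes>\<^bsub>gen H QQ\<^esub> X) (G \<otimes>\<^bsub>gen H QQ\<^esub> G') (htens HH HH s t)"
    unfolding proj_def X_def X'_def G_def G'_def
    by (rule dmul_elt[OF HH_cocoalg proj_admissible proj_admissible s t, folded QQ_def])
  show "admissible QQ (G \<otimes>\<^bsub>gen H QQ\<^esub> X' \<otimes>\<^bsub>gen H QQ\<^esub> inv\<^bsub>gen H QQ\<^esub> G \<otimes>\<^bsub>gen H QQ\<^esub> X) (G \<otimes>\<^bsub>gen H QQ\<^esub> G')"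
    unfolding X_def X'_def G_def G'_def
    by (rule elt_mul(1)[OF QQ_cocoalg elt_pull(1)[OF QQ_cocoalg HH_cocoalg QQ_proj(1) proj_admissible]
          elt_pull(1)[OF QQ_cocoalg HH_cocoalg QQ_proj(2) proj_admissible]])
  show "X \<in> carrier (gen H QQ)" "X' \<in> carrier (gen H QQ)" "G \<in> carrier (gen H QQ)" "G' \<in> carrier (gen H QQ)"
    unfolding X_def X'_def G_def G'_def by (rule QQ_pull, rule QQ_proj, rule comps_gen P12_gen)+
qed

text \<open>In coordinates, [g, g][g', g'] = [g g', g g'], and the inverse of [g, g] has the same
  form with \<open>g\<close> inverted.\<close>

lemma C_hom:
  assumes C: "is_C H B C"
  shows "hopf_hom DD DD C"
proof (rule hopf_homI)
  note admissible' = admissible_C[OF HH_cocoalg proj_admissible]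
  show "linear_map DD DD C" using C by (simp add: is_C_iff)
  have Cp: "C (proj s) = elt HH univ_prod univ_prod s" if "s \<in> carr HH" for s
    unfolding proj_def by (rule C_elt[OF C HH_cocoalg proj_admissible that])
  show "coalgebra_map HH DD (\<lambda>s. C (proj s))"
    by (rule coalgebra_map_cong[OF HH.X.coalg_axioms elt_map[OF HH_cocoalg admissible']]) (simp add: Cp)
  show "C (dmul (proj s) (proj t)) = dmul (C (proj s)) (C (proj t))" if "s \<in> carr HH" "t \<in> carr HH" for s t
  proof -
    note m = dmul_proj[OF that]
    show ?thesis
      unfolding m(1) C_elt[OF C QQ_cocoalg m(2) QQ_htens[OF that]] Cp[OF that(1)] Cp[OF that(2)]
        dmul_elt[OF HH_cocoalg admissible' admissible' that, folded QQ_def]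
      using m(3-6) by (simp add: RQ.grp)
  qed
  show "C (htens H H (unt H) (unt H)) = htens H H (unt H) (unt H)"
    using C_elt[OF C cocoalg_H unit_admissible unt_in] by (simp only: unit_elt)
  show "C (antip DD (proj s)) = antip DD (C (proj s))" if "s \<in> carr HH" for s
    unfolding Cp[OF that] elt_antip(1)[OF HH_cocoalg admissible' that]
    unfolding proj_def elt_antip(1)[OF HH_cocoalg proj_admissible that]
      C_elt[OF C HH_cocoalg elt_antip(2)[OF HH_cocoalg proj_admissible that] that]
    using comps_gen(1) by (simp add: R.grp)
qed

text \<open>Put k = g\<inverse> x. Then [k, 1][k', 1] = [k' k, 1], while C' of a product has first
  coordinate (g g')\<inverse> g x' g\<inverse> x = k' k. For the antipode both sides are
  [k\<inverse>, 1].\<close>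

lemma C_tilde_hom:
  assumes C: "is_C_tilde H B C"
  shows "hopf_hom DD DD C"
proof (rule hopf_homI)
  let ?k = "inv\<^bsub>gen H HH\<^esub> univ_prod \<otimes>\<^bsub>gen H HH\<^esub> P1"
  note admissible' = admissible_C_tilde[OF HH_cocoalg proj_admissible]
  show "linear_map DD DD C" using C by (simp add: is_C_tilde_iff)
  have Cp: "C (proj s) = elt HH ?k (one (gen H HH)) s" if "s \<in> carr HH" for s
    unfolding proj_def by (rule C_tilde_elt[OF C HH_cocoalg proj_admissible that])
  show "coalgebra_map HH DD (\<lambda>s. C (proj s))"
    by (rule coalgebra_map_cong[OF HH.X.coalg_axioms elt_map[OF HH_cocoalg admissible']]) (simp add: Cp)
  show "C (dmul (proj s) (proj t)) = dmul (C (proj s)) (C (proj t))" if "s \<in> carr HH" "t \<in> carr HH" for s t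
  proof -
    note m = dmul_proj[OF that]
    \<comment> \<open>The unit is written as \<open>P1\<close> times its inverse, so that its
      pullback follows from those of products and inverses.\<close>
    have one: "compose (carr QQ) (one (gen H HH)) h = one (gen H QQ)" if h: "coalgebra_map QQ HH h" for h
    proof -
      have "compose (carr QQ) (P1 \<otimes>\<^bsub>gen H HH\<^esub> inv\<^bsub>gen H HH\<^esub> P1) h = one (gen H QQ)"
        using QQ_pull[OF h P12_gen(1)]
        by (simp only: QQ_pull_mult[OF h] QQ_pull_inv[OF h] R_closed RQ.r_inv)
      then show ?thesis by (simp only: R.r_inv P12_gen)
    qed
    show ?thesis
      unfolding m(1) C_tilde_elt[OF C QQ_cocoalg m(2) QQ_htens[OF that]] Cp[OF that(1)] Cp[OF that(2)]
        dmul_elt[OF HH_cocoalg admissible' admissible' that, folded QQ_def] QQ_proj[THEN QQ_pull_mult, OF R.inv_closed[OF comps_gen(1)] P12_gen(1)]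
        QQ_proj[THEN QQ_pull_inv, OF comps_gen(1)] QQ_proj[THEN one]
      using m(3-6) by (simp add: RQ.grp)
  qed
  show "C (htens H H (unt H) (unt H)) = htens H H (unt H) (unt H)"
    using C_tilde_elt[OF C cocoalg_H unit_admissible unt_in] by (simp add: unit_elt)
  show "C (antip DD (proj s)) = antip DD (C (proj s))" if "s \<in> carr HH" for s
    unfolding Cp[OF that] elt_antip(1)[OF HH_cocoalg admissible' that]
    unfolding proj_def elt_antip(1)[OF HH_cocoalg proj_admissible that]
      C_tilde_elt[OF C HH_cocoalg elt_antip(2)[OF HH_cocoalg proj_admissible that] that]
    using comps_gen(1) by (simp add: R.grp)
qed

text \<open>Idempotence can be read off the coordinates, and the factorisation is
  [g, g][g\<inverse> x, 1] = [g (g\<inverse> x) g\<inverse> g, g] = [x, g].\<close>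

lemma projection_hom_pair:
  assumes C: "is_C H B C" and C': "is_C_tilde H B C'"
  shows "projection_hom_pair Hp Hm lact ract C C'"
  unfolding projection_hom_pair_def Let_def
proof (intro conjI ballI)
  show "hopf_hom DD DD C" "hopf_hom DD DD C'" by (rule C_hom[OF C], rule C_tilde_hom[OF C'])
  fix z assume "z \<in> carr DD"
  then obtain s where s: "s \<in> carr HH" "z = proj s" by (rule proj_surj)
  note adm1 = admissible_C[OF HH_cocoalg proj_admissible] and adm2 = admissible_C_tilde[OF HH_cocoalg proj_admissible]
  let ?k = "inv\<^bsub>gen H HH\<^esub> univ_prod \<otimes>\<^bsub>gen H HH\<^esub> P1"
  have C1: "C (proj s) = elt HH univ_prod univ_prod s" if "s \<in> carr HH" for s
    unfolding proj_def by (rule C_elt[OF C HH_cocoalg proj_admissible that])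
  have C2: "C' (proj s) = elt HH ?k (one (gen H HH)) s" if "s \<in> carr HH" for s
    unfolding proj_def by (rule C_tilde_elt[OF C' HH_cocoalg proj_admissible that])
  show "C (C z) = C z"
    unfolding s(2) C1[OF s(1)] by (rule C_elt[OF C HH_cocoalg adm1 s(1)])
  show "C' (C' z) = C' z"
    unfolding s(2) C2[OF s(1)] C_tilde_elt[OF C' HH_cocoalg adm2 s(1)]
    using comps_gen(1) by (simp add: R.grp)
  have lin: "linear_map DD DD C" "linear_map DD DD C'"
    using C C' by (simp_all add: is_C_iff is_C_tilde_iff)
  have b: "D.X.bilin tscale (\<lambda>z1 z2. dmul (C z1) (C' z2))"
    by (rule bilinear_on_linear_maps[OF lin]) (use dmul(1) in simp)
  have "sweedler DD tscale z (\<lambda>z1 z2. dmul (C z1) (C' z2)) = sweedler HH tscale s (\<lambda>s1 s2. dmul (C (proj s1)) (C' (proj s2)))"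
    unfolding s(2)
    by (rule sweedler_cmap[OF HH.X.coalg_axioms D.X.coalg_axioms vector_space_tscale b s(1) proj_map])
  also have "\<dots> = sweedler HH tscale s (\<lambda>s1 s2. dmul (elt HH univ_prod univ_prod s1) (elt HH ?k (one (gen H HH)) s2))"
    by (rule sweedler_cong) (simp only: C1 C2)
  also have "\<dots> = z"
    unfolding elt_mul(2)[OF HH_cocoalg adm1 adm2 s(1)] s(2) proj_def
    using comps_gen(1) by (simp add: R.grp)
  finally show "sweedler DD tscale z (\<lambda>z1 z2. mul DD (C z1) (C' z2)) = z"
    by (simp add: dcp_def)
qed

end

text \<open>The maps are prescribed through non-unique representatives, so their existence is a
  claim of its own; the projection property is then stated for all linear maps satisfying the
  prescriptions.\<close>

theorem theorem3p7:
  fixes H :: "('k::field_char_0, 'h::ab_group_add) hopf" and B :: "'h \<Rightarrow> 'h"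
  assumes "rota_baxter_hopf H B"
  shows "(\<exists>C. is_C H B C) \<and> (\<exists>C'. is_C_tilde H B C') \<and>
    (\<forall>C C'. is_C H B C \<longrightarrow> is_C_tilde H B C' \<longrightarrow>
       projection_hom_pair (rb_plus H B) (rb_minus H B) (rb_left H B) (rb_right H B) C C')"
proof -
  interpret rota_baxter H B
    using assms by unfold_locales (simp_all add: rota_baxter_hopf_def)
  show ?thesis using C_exists C_tilde_exists projection_hom_pair by blast
qed

end
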